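(* Let $0<s\le 1$, $1\le p<\infty$, $\frac1p+\frac1{p'}=1$, and let $T_\sigma: L^p(\mathbb{T}^n,L^2(Y,\nu))\to L^p(\mathbb{T}^n,L^2(Y,\nu))$ be a vector-valued periodic pseudo-differential operator with operator-valued symbol $\sigma:\mathbb{T}^n\times\mathbb{Z}^n\to\mathcal{L}(L^2(Y,\nu))$. Then $T_\sigma$ is an $s$-nuclear operator if and only if $$\sigma(x,\xi)=e^{-2\pi i x\cdot\xi}\left(\sum_{k=1}^\infty (h_k\otimes\widehat{g_k})(x,-\xi)\right)\qquad\text{for a.e. }x\in\mathbb{T}^n,\ \xi\in\mathbb{Z}^n,$$ where $\{g_k\}_k$ and $\{h_k\}_k$ are two sequences in $L^{p}(\mathbb{T}^n,L^2(Y,\nu))$ and $L^{p'}(\mathbb{T}^n,L^2(Y,\nu))$ respectively such that $$\sum_{k=1}^\infty \|h_k\|^s_{L^{p'}(\mathbb{T}^n,L^2(Y,\nu))}\,\|g_k\|^s_{L^{p}(\mathbb{T}^n,L^2(Y,\nu))}<\infty,$$ and the series on the right-hand side converges in the operator norm of $\mathcal{L}(L^2(Y,\nu))$.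
   Context: $\mathbb{T}^n=\mathbb{R}^n/\mathbb{Z}^n$. The measure $\nu$ on $Y$ is $\sigma$-finite and $H=L^2(Y,\nu)$ is a separable Hilbert space. $L^q(\mathbb{T}^n,H)$ is the Bochner space, $\mathcal{L}(H)$ is the algebra of bounded linear operators on $H$, and $\widehat f(\xi)=\int_{\mathbb{T}^n}e^{-2\pi i x\cdot\xi}f(x)\,dx\in H$, $\xi\in\mathbb{Z}^n$, is the vector-valued Fourier transform (Bochner integral). The vector-valued pseudo-differential operator with symbol $\sigma:\mathbb{T}^n\times\mathbb{Z}^n\to\mathcal{L}(H)$ is $T_\sigma f(x)=\sum_{\xi\in\mathbb{Z}^n}e^{2\pi i x\cdot\xi}\sigma(x,\xi)\widehat f(\xi)$ for $f\in C^\infty(\mathbb{T}^n,H)$; it is assumed to admit a bounded extension to $L^p(\mathbb{T}^n,H)$, still denoted $T_\sigma$. One sets $(h\otimes\widehat g)(x,\xi)=h(x)\,\widehat g(\xi)$ for $(x,\xi)\in\mathbb{T}^n\times\mathbb{Z}^n$, with $h(x),\widehat g(\xi)\in L^2(Y,\nu)$; this is the function $(z,w)\mapsto h(x)(z)\,\widehat g(\xi)(w)$ on $Y\times Y$, regarded as the kernel of a (rank-one) integral operator on $L^2(Y,\nu)$, $v\mapsto\big(\int_Y\widehat g(\xi)(w)v(w)\,d\nu(w)\big)h(x)$. A compact linear operator $T:E\to F$ between Banach spaces is $s$-nuclear ($0<s\le1$) if there are sequences $\{\phi_k\}\subset E'$, $\{\psi_k\}\subset F$ with $\sum_k\|\phi_k\|_{E'}^s\|\psi_k\|_F^s<\infty$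 and $Tf=\sum_k\langle \phi_k,f\rangle\psi_k$ for all $f\in E$.
   Formalization: The exponents of the two sequences are swapped: h_k lies in L^p and g_k in L^{p'}, with Σ‖h_k‖_{L^p}^s‖g_k‖_{L^{p'}}^s < ∞; as printed the claim fails for p ≠ 2 (e.g. rank-one operators f ↦ ⟨v, f̂(0)⟩ψv with ψ in L^p but not in L^{p'}, p < 2). *)

theory Defs
  imports "HOL-Analysis.Analysis" "HOL-Probability.Essential_Supremum"
begin

section \<open>The Hilbert space $L^2(Y,\nu)$\<close>

definition L2_fun :: "'a measure \<Rightarrow> ('a \<Rightarrow> complex) set" where
  "L2_fun M = {f \<in> borel_measurable M. integrable M (\<lambda>y. (cmod (f y))\<^sup>2)}"

text \<open>
  The measure \<open>\<nu>\<close> is the parameter \<open>nu\<close> of a type class on the points of \<open>Y\<close>, so that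
  $L^2(Y,\nu)$ can be a type and the library's Bochner integral applies to it. A theorem about
  \<open>'a :: L2_measure\<close> is a theorem about every \<open>\<sigma>\<close>-finite measure space (\<open>nu\<close> carries its own
  underlying set and \<open>\<sigma>\<close>-algebra) whose $L^2$ is separable.
\<close>

class L2_measure =
  fixes nu :: "'a measure"
  assumes sigma_finite_nu: "sigma_finite_measure nu"
    and separable_L2_nu:
      "\<exists>D. countable D \<and> D \<subseteq> L2_fun nu \<and>
         (\<forall>f\<in>L2_fun nu. \<forall>e>0. \<exists>d\<in>D. (\<integral>y. (cmod (f y - d y))\<^sup>2 \<partial>nu) < e)"

lemma L2_funI: "f \<in> borel_measurable M \<Longrightarrow> integrable M (\<lambda>y. (cmod (f y))\<^sup>2) \<Longrightarrow> f \<in> L2_fun M"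
  by (simp add: L2_fun_def)

lemma L2_fun_measurable [measurable_dest]: "f \<in> L2_fun M \<Longrightarrow> f \<in> borel_measurable M"
  by (simp add: L2_fun_def)

lemma L2_fun_sq_integrable: "f \<in> L2_fun M \<Longrightarrow> integrable M (\<lambda>y. (cmod (f y))\<^sup>2)"
  by (simp add: L2_fun_def)

lemma L2_fun_prod_integrable:
  assumes f: "f \<in> L2_fun M" and g: "g \<in> L2_fun M"
  shows "integrable M (\<lambda>y. f y * g y)"
proof (rule Bochner_Integration.integrable_bound)
  show "integrable M (\<lambda>y. (cmod (f y))\<^sup>2 + (cmod (g y))\<^sup>2)"
    using f g by (intro Bochner_Integration.integrable_add L2_fun_sq_integrable)
  show "(\<lambda>y. f y * g y) \<in> borel_measurable M" using f g by measurable
  have "cmod (f y * g y) \<le> (cmod (f y))\<^sup>2 + (cmod (g y))\<^sup>2" for y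
  proof -
    have "2 * cmod (f y) * cmod (g y) \<le> (cmod (f y))\<^sup>2 + (cmod (g y))\<^sup>2"
      by (rule sum_squares_bound)
    moreover have "0 \<le> cmod (f y) * cmod (g y)" by simp
    ultimately show ?thesis unfolding norm_mult by linarith
  qed
  then show "AE y in M. norm (f y * g y) \<le> norm ((cmod (f y))\<^sup>2 + (cmod (g y))\<^sup>2)" by simp
qed

lemma L2_fun_cnj: "f \<in> L2_fun M \<Longrightarrow> (\<lambda>y. cnj (f y)) \<in> L2_fun M"
  by (auto simp: L2_fun_def intro: borel_measurable_continuous_on[of cnj])

lemma L2_fun_cmult:
  assumes "f \<in> L2_fun M" shows "(\<lambda>y. c * f y) \<in> L2_fun M"
  using assms by (auto simp: L2_fun_def norm_mult power_mult_distrib)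

lemma L2_fun_add:
  assumes f: "f \<in> L2_fun M" and g: "g \<in> L2_fun M"
  shows "(\<lambda>y. f y + g y) \<in> L2_fun M"
proof (rule L2_funI)
  show m: "(\<lambda>y. f y + g y) \<in> borel_measurable M" using f g by measurable
  show "integrable M (\<lambda>y. (cmod (f y + g y))\<^sup>2)"
  proof (rule Bochner_Integration.integrable_bound)
    show "integrable M (\<lambda>y. 2 * (cmod (f y))\<^sup>2 + 2 * (cmod (g y))\<^sup>2)"
      using f g by (intro Bochner_Integration.integrable_add integrable_mult_right L2_fun_sq_integrable)
    show "(\<lambda>y. (cmod (f y + g y))\<^sup>2) \<in> borel_measurable M" using m by measurable
    have "(cmod (f y + g y))\<^sup>2 \<le> 2 * (cmod (f y))\<^sup>2 + 2 * (cmod (g y))\<^sup>2" for y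
    proof -
      have "(cmod (f y + g y))\<^sup>2 \<le> (cmod (f y) + cmod (g y))\<^sup>2"
        by (intro power_mono norm_triangle_ineq) simp
      moreover have "2 * cmod (f y) * cmod (g y) \<le> (cmod (f y))\<^sup>2 + (cmod (g y))\<^sup>2"
        by (rule sum_squares_bound)
      ultimately show ?thesis by (simp add: power2_sum)
    qed
    then show "AE y in M. norm ((cmod (f y + g y))\<^sup>2) \<le> norm (2 * (cmod (f y))\<^sup>2 + 2 * (cmod (g y))\<^sup>2)"
      by simp
  qed
qed

lemma L2_fun_diff:
  assumes "f \<in> L2_fun M" and "g \<in> L2_fun M"
  shows "(\<lambda>y. f y - g y) \<in> L2_fun M"
  using L2_fun_add[OF assms(1) L2_fun_cmult[OF assms(2), of "-1"]] by simp

lemma L2_fun_zero: "(\<lambda>y. 0) \<in> L2_fun M"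
  by (simp add: L2_fun_def)

definition L2_eq :: "('a::L2_measure \<Rightarrow> complex) \<Rightarrow> ('a \<Rightarrow> complex) \<Rightarrow> bool" where
  "L2_eq f g \<longleftrightarrow> f \<in> L2_fun nu \<and> g \<in> L2_fun nu \<and> (AE y in nu. f y = g y)"

lemma L2_eqD:
  assumes "L2_eq f g" shows "f \<in> L2_fun nu" "g \<in> L2_fun nu" "AE y in nu. f y = g y"
  using assms by (auto simp: L2_eq_def)

lemma part_equivp_L2_eq: "part_equivp (L2_eq :: ('a::L2_measure \<Rightarrow> complex) \<Rightarrow> _)" (is "part_equivp ?R")
proof (rule part_equivpI)
  show "\<exists>f. ?R f f" by (rule exI[of _ "\<lambda>_. 0"]) (simp add: L2_eq_def L2_fun_zero)
  show "symp ?R" by (rule sympI) (auto simp: L2_eq_def elim: eventually_mono)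
  show "transp ?R"
  proof (rule transpI)
    fix f g h :: "'a \<Rightarrow> complex"
    assume a: "L2_eq f g" "L2_eq g h"
    have "AE y in nu. f y = h y"
      using L2_eqD(3)[OF a(1)] L2_eqD(3)[OF a(2)] by eventually_elim simp
    then show "L2_eq f h" using a by (simp add: L2_eq_def)
  qed
qed

quotient_type (overloaded) 'a L2 = "'a::L2_measure \<Rightarrow> complex" / partial: L2_eq
  by (rule part_equivp_L2_eq)

instantiation L2 :: (L2_measure) real_inner
begin

lift_definition zero_L2 :: "'a L2" is "\<lambda>_. 0"
  by (simp add: L2_eq_def L2_fun_zero)

lift_definition plus_L2 :: "'a L2 \<Rightarrow> 'a L2 \<Rightarrow> 'a L2" is "\<lambda>f g y. f y + g y"
  unfolding L2_eq_def by (auto intro: L2_fun_add elim: eventually_elim2)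

lift_definition minus_L2 :: "'a L2 \<Rightarrow> 'a L2 \<Rightarrow> 'a L2" is "\<lambda>f g y. f y - g y"
  unfolding L2_eq_def by (auto intro: L2_fun_diff elim: eventually_elim2)

lift_definition uminus_L2 :: "'a L2 \<Rightarrow> 'a L2" is "\<lambda>f y. - f y"
  unfolding L2_eq_def using L2_fun_cmult[where c = "-1"] by (auto elim: eventually_mono)

lift_definition scaleR_L2 :: "real \<Rightarrow> 'a L2 \<Rightarrow> 'a L2" is "\<lambda>r f y. complex_of_real r * f y"
  unfolding L2_eq_def by (auto intro: L2_fun_cmult elim: eventually_mono)

lift_definition inner_L2 :: "'a L2 \<Rightarrow> 'a L2 \<Rightarrow> real" is "\<lambda>f g. Re (\<integral>y. f y * cnj (g y) \<partial>nu)"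
proof -
  fix f f' g g' :: "'a \<Rightarrow> complex"
  assume a: "L2_eq f f'" "L2_eq g g'"
  note [measurable] = L2_eqD(1,2)[OF a(1)] L2_eqD(1,2)[OF a(2)]
  have [measurable]: "(\<lambda>y. cnj (g y)) \<in> borel_measurable nu" "(\<lambda>y. cnj (g' y)) \<in> borel_measurable nu"
    using L2_fun_cnj[OF L2_eqD(1)[OF a(2)]] L2_fun_cnj[OF L2_eqD(2)[OF a(2)]] by measurable
  have "(\<integral>y. f y * cnj (g y) \<partial>nu) = (\<integral>y. f' y * cnj (g' y) \<partial>nu)"
  proof (rule integral_cong_AE)
    show "AE y in nu. f y * cnj (g y) = f' y * cnj (g' y)"
      using L2_eqD(3)[OF a(1)] L2_eqD(3)[OF a(2)] by eventually_elim simp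
  qed measurable
  then show "Re (\<integral>y. f y * cnj (g y) \<partial>nu) = Re (\<integral>y. f' y * cnj (g' y) \<partial>nu)" by simp
qed

definition norm_L2 :: "'a L2 \<Rightarrow> real" where "norm_L2 x = sqrt (inner x x)"
definition dist_L2 :: "'a L2 \<Rightarrow> 'a L2 \<Rightarrow> real" where "dist_L2 x y = norm (x - y)"
definition sgn_L2 :: "'a L2 \<Rightarrow> 'a L2" where "sgn_L2 x = inverse (norm x) *\<^sub>R x"
definition uniformity_L2 :: "('a L2 \<times> 'a L2) filter" where
  "uniformity_L2 = (INF e\<in>{0<..}. principal {(x, y). dist x y < e})"
definition open_L2 :: "'a L2 set \<Rightarrow> bool" where
  "open_L2 U = (\<forall>x\<in>U. \<forall>\<^sub>F (x', y) in uniformity. x' = x \<longrightarrow> y \<in> U)"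

instance
proof
  fix x y z :: "'a L2" and a b r :: real
  show "x + y + z = x + (y + z)"
    by transfer (simp add: L2_eq_def add.assoc L2_fun_add)
  show "x + y = y + x"
    by transfer (simp add: L2_eq_def add.commute L2_fun_add)
  show "0 + x = x"
    by transfer (simp add: L2_eq_def)
  show "- x + x = 0"
    by (transfer) (simp add: L2_eq_def L2_fun_zero)
  show "x - y = x + - y"
    by (transfer) (simp add: L2_eq_def L2_fun_diff)
  show "a *\<^sub>R (x + y) = a *\<^sub>R x + a *\<^sub>R y"
    by transfer (auto simp: L2_eq_def distrib_left intro!: L2_fun_add L2_fun_cmult)
  show "(a + b) *\<^sub>R x = a *\<^sub>R x + b *\<^sub>R x"
    by transfer (auto simp: L2_eq_def distrib_right intro!: L2_fun_add L2_fun_cmult)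
  show "a *\<^sub>R b *\<^sub>R x = (a * b) *\<^sub>R x"
    by (transfer) (auto simp: L2_eq_def mult.assoc intro!: L2_fun_cmult)
  show "1 *\<^sub>R x = x"
    by (transfer) (auto simp: L2_eq_def)
  show "dist x y = norm (x - y)" "sgn x = inverse (norm x) *\<^sub>R x"
    "norm x = sqrt (inner x x)"
    by (rule dist_L2_def sgn_L2_def norm_L2_def)+
  show "(uniformity :: ('a L2 \<times> 'a L2) filter) = (INF e\<in>{0<..}. principal {(x, y). dist x y < e})"
    by (rule uniformity_L2_def)
  show "open U = (\<forall>x\<in>U. \<forall>\<^sub>F (x', y) in uniformity. x' = x \<longrightarrow> y \<in> U)" for U :: "'a L2 set"
    by (rule open_L2_def)
  show "inner x y = inner y x"
  proof transfer
    fix f g :: "'a \<Rightarrow> complex"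
    have "(\<integral>y. g y * cnj (f y) \<partial>nu) = cnj (\<integral>y. f y * cnj (g y) \<partial>nu)"
      by (subst Bochner_Integration.integral_cnj[symmetric]) (simp add: mult.commute)
    then show "Re (\<integral>y. f y * cnj (g y) \<partial>nu) = Re (\<integral>y. g y * cnj (f y) \<partial>nu)" by simp
  qed
  show "inner (x + y) z = inner x z + inner y z"
  proof transfer
    fix f g h :: "'a \<Rightarrow> complex"
    assume "L2_eq f f" "L2_eq g g" "L2_eq h h"
    then have "f \<in> L2_fun nu" "g \<in> L2_fun nu" "(\<lambda>y. cnj (h y)) \<in> L2_fun nu"
      by (auto simp: L2_eq_def intro: L2_fun_cnj)
    then show "Re (\<integral>y. (f y + g y) * cnj (h y) \<partial>nu) =
        Re (\<integral>y. f y * cnj (h y) \<partial>nu) + Re (\<integral>y. g y * cnj (h y) \<partial>nu)"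
      by (simp add: distrib_right L2_fun_prod_integrable)
  qed
  show "inner (r *\<^sub>R x) y = r * inner x y"
    by transfer (simp add: mult.assoc)
  have ii: "(\<integral>y. f y * cnj (f y) \<partial>nu) = of_real (\<integral>y. (cmod (f y))\<^sup>2 \<partial>nu)" for f :: "'a \<Rightarrow> complex"
    by (simp add: complex_norm_square[symmetric] del: of_real_power)
  show "0 \<le> inner x x"
    by transfer (simp add: ii)
  show "inner x x = 0 \<longleftrightarrow> x = 0"
  proof transfer
    fix f :: "'a \<Rightarrow> complex" assume "L2_eq f f"
    then have f: "f \<in> L2_fun nu" by (simp add: L2_eq_def)
    have "Re (\<integral>y. f y * cnj (f y) \<partial>nu) = 0 \<longleftrightarrow> (AE y in nu. (cmod (f y))\<^sup>2 = 0)"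
      unfolding ii using integral_nonneg_eq_0_iff_AE[OF L2_fun_sq_integrable[OF f]] by simp
    also have "\<dots> \<longleftrightarrow> L2_eq f (\<lambda>_. 0)" using f by (simp add: L2_eq_def L2_fun_zero)
    finally show "Re (\<integral>y. f y * cnj (f y) \<partial>nu) = 0 \<longleftrightarrow> L2_eq f (\<lambda>_. 0)" .
  qed
qed

end

lemma norm_L2_sq:
  assumes "f \<in> L2_fun (nu :: 'a::L2_measure measure)"
  shows "(norm (abs_L2 f))\<^sup>2 = (\<integral>y. (cmod (f y))\<^sup>2 \<partial>nu)"
proof -
  have eq: "L2_eq f f" using assms by (simp add: L2_eq_def)
  have "inner (abs_L2 f) (abs_L2 f) = Re (\<integral>y. f y * cnj (f y) \<partial>nu)"
    by (rule inner_L2.abs_eq[OF eq eq])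
  also have "\<dots> = (\<integral>y. (cmod (f y))\<^sup>2 \<partial>nu)"
    by (simp add: complex_norm_square[symmetric] del: of_real_power)
  finally show ?thesis by (simp add: power2_norm_eq_inner)
qed

lemma L2_cases:
  obtains f where "f \<in> L2_fun nu" "x = abs_L2 f"
proof -
  have "L2_eq (rep_L2 x) (rep_L2 x)" "abs_L2 (rep_L2 x) = x"
    using Quotient_L2 by (auto simp: Quotient_def Quotient_rep_reflp)
  then show ?thesis using that by (auto simp: L2_eq_def)
qed

lemma abs_L2_diff:
  assumes "f \<in> L2_fun nu" "g \<in> L2_fun nu"
  shows "abs_L2 f - abs_L2 g = abs_L2 (\<lambda>y. f y - g y)"
  using assms by (intro minus_L2.abs_eq) (auto simp: L2_eq_def)

lemma norm_L2_diff_sq: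
  assumes "f \<in> L2_fun nu" "g \<in> L2_fun nu"
  shows "(norm (abs_L2 f - abs_L2 g))\<^sup>2 = (\<integral>y. (cmod (f y - g y))\<^sup>2 \<partial>nu)"
  using assms by (simp add: abs_L2_diff norm_L2_sq L2_fun_diff)

instance L2 :: (L2_measure) second_countable_topology
proof
  obtain D :: "('a \<Rightarrow> complex) set" where D: "countable D" "D \<subseteq> L2_fun nu"
    "\<And>f e. f \<in> L2_fun nu \<Longrightarrow> e > 0 \<Longrightarrow> \<exists>d\<in>D. (\<integral>y. (cmod (f y - d y))\<^sup>2 \<partial>nu) < e"
    using separable_L2_nu by blast
  define B where "B = (\<lambda>(d, q). ball (abs_L2 d) (real_of_rat q)) ` (D \<times> UNIV)"
  have cB: "countable B" using D(1) unfolding B_def by (intro countable_image countable_SIGMA) auto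
  have opB: "open b" if "b \<in> B" for b using that by (auto simp: B_def)
  have "\<exists>b\<in>B. x \<in> b \<and> b \<subseteq> U" if Ux: "open U" "x \<in> U" for U x
  proof -
    obtain e where e: "e > 0" "ball x e \<subseteq> U" using openE[OF Ux] by metis
    obtain q where q: "0 < real_of_rat q" "real_of_rat q < e / 2"
      using of_rat_dense[of 0 "e / 2"] e by auto
    obtain f where f: "f \<in> L2_fun nu" "x = abs_L2 f" by (rule L2_cases)
    obtain d where d: "d \<in> D" "(\<integral>y. (cmod (f y - d y))\<^sup>2 \<partial>nu) < (real_of_rat q)\<^sup>2"
      using D(3)[OF f(1), of "(real_of_rat q)\<^sup>2"] q by auto
    have "d \<in> L2_fun nu" using d D by auto
    then have "(dist x (abs_L2 d))\<^sup>2 < (real_of_rat q)\<^sup>2"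
      using d(2) f by (simp add: dist_norm norm_L2_diff_sq)
    then have dx: "dist x (abs_L2 d) < real_of_rat q"
      using q by (auto dest: power2_less_imp_less)
    have "ball (abs_L2 d) (real_of_rat q) \<subseteq> ball x e"
    proof
      fix z assume "z \<in> ball (abs_L2 d) (real_of_rat q)"
      then have "dist x z < e" using dx q dist_triangle[of x z "abs_L2 d"] by (simp add: dist_commute)
      then show "z \<in> ball x e" by simp
    qed
    then show ?thesis using d(1) dx e unfolding B_def
      by (intro bexI[of _ "ball (abs_L2 d) (real_of_rat q)"]) (auto simp: dist_commute)
  qed
  then have "topological_basis B" using opB by (intro topological_basisI) auto
  then have "open = generate_topology B" by (rule topological_basis_imp_subbasis)
  then show "\<exists>B::'a L2 set set. countable B \<and> open = generate_topology B" using cB by blast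
qed

lemma L2_Fatou:
  fixes s :: "nat \<Rightarrow> 'a \<Rightarrow> complex"
  assumes s: "\<And>n. s n \<in> L2_fun M" and [measurable]: "f \<in> borel_measurable M"
    and lim: "AE y in M. (\<lambda>n. s n y) \<longlonglongrightarrow> f y"
    and bd: "\<And>n. (\<integral>y. (cmod (s n y))\<^sup>2 \<partial>M) \<le> C"
  shows "f \<in> L2_fun M" "(\<integral>y. (cmod (f y))\<^sup>2 \<partial>M) \<le> C"
proof -
  note [measurable] = s
  have "0 \<le> (\<integral>y. (cmod (s 0 y))\<^sup>2 \<partial>M)" by simp
  then have C: "0 \<le> C" using bd[of 0] by linarith
  have "(\<integral>\<^sup>+y. ennreal ((cmod (f y))\<^sup>2) \<partial>M) = (\<integral>\<^sup>+y. liminf (\<lambda>n. ennreal ((cmod (s n y))\<^sup>2)) \<partial>M)"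
  proof (rule nn_integral_cong_AE, use lim in eventually_elim)
    case (elim y)
    have "(\<lambda>n. ennreal ((cmod (s n y))\<^sup>2)) \<longlonglongrightarrow> ennreal ((cmod (f y))\<^sup>2)"
      by (intro tendsto_intros tendsto_ennrealI elim)
    then show ?case by (metis lim_imp_Liminf trivial_limit_sequentially)
  qed
  also have "\<dots> \<le> liminf (\<lambda>n. \<integral>\<^sup>+y. ennreal ((cmod (s n y))\<^sup>2) \<partial>M)"
    by (rule nn_integral_liminf) measurable
  also have "\<dots> \<le> liminf (\<lambda>n::nat. ennreal C)"
  proof (intro Liminf_mono always_eventually allI)
    fix n show "(\<integral>\<^sup>+y. ennreal ((cmod (s n y))\<^sup>2) \<partial>M) \<le> ennreal C"
      using bd[of n] by (subst nn_integral_eq_integral) (auto intro: L2_fun_sq_integrable s ennreal_leI)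
  qed
  also have "\<dots> = ennreal C" by (simp add: Liminf_const)
  finally have le: "(\<integral>\<^sup>+y. ennreal ((cmod (f y))\<^sup>2) \<partial>M) \<le> ennreal C" .
  have int: "integrable M (\<lambda>y. (cmod (f y))\<^sup>2)"
    using le by (intro integrableI_nonneg) (auto simp: le_less_trans[OF le])
  then show "f \<in> L2_fun M" by (intro L2_funI) auto
  show "(\<integral>y. (cmod (f y))\<^sup>2 \<partial>M) \<le> C"
    using le C by (subst (asm) nn_integral_eq_integral[OF int]) auto
qed

lemma L2_fast_Cauchy_AE:
  fixes s :: "nat \<Rightarrow> 'a \<Rightarrow> complex"
  assumes s: "\<And>n. s n \<in> L2_fun M"
    and bd: "\<And>n. (\<integral>y. (cmod (s (Suc n) y - s n y))\<^sup>2 \<partial>M) \<le> (1 / 8) ^ n"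
  shows "AE y in M. convergent (\<lambda>n. s n y)"
proof -
  note [measurable] = s
  define a where "a n y = (4::real) ^ n * (cmod (s (Suc n) y - s n y))\<^sup>2" for n y
  have [measurable]: "a n \<in> borel_measurable M" for n unfolding a_def by measurable
  have a0: "0 \<le> a n y" for n y by (simp add: a_def)
  have "(\<integral>\<^sup>+y. (\<Sum>n. ennreal (a n y)) \<partial>M) = (\<Sum>n. \<integral>\<^sup>+y. ennreal (a n y) \<partial>M)"
    by (rule nn_integral_suminf) measurable
  also have "\<dots> \<le> (\<Sum>n. ennreal ((1 / 2) ^ n))"
  proof (intro suminf_le allI)
    fix n
    have i: "integrable M (a n)" unfolding a_def
      by (intro integrable_mult_right L2_fun_sq_integrable L2_fun_diff s)
    have "(\<integral>y. a n y \<partial>M) = 4 ^ n * (\<integral>y. (cmod (s (Suc n) y - s n y))\<^sup>2 \<partial>M)"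
      unfolding a_def by simp
    also have "\<dots> \<le> 4 ^ n * (1 / 8) ^ n" by (intro mult_left_mono bd) simp
    also have "\<dots> = (1 / 2) ^ n" by (simp add: power_mult_distrib[symmetric])
    finally show "(\<integral>\<^sup>+y. ennreal (a n y) \<partial>M) \<le> ennreal ((1 / 2) ^ n)"
      using i a0 by (subst nn_integral_eq_integral) (auto intro: ennreal_leI)
  qed auto
  also have "\<dots> < \<infinity>"
    by (subst suminf_ennreal2) (auto intro: summable_geometric)
  finally have "AE y in M. (\<Sum>n. ennreal (a n y)) \<noteq> \<infinity>"
    by (intro nn_integral_PInf_AE) auto
  then show ?thesis
  proof eventually_elim
    case (elim y)
    have "summable (\<lambda>n. a n y)" using elim a0 by (intro summable_suminf_not_top) auto
    then have "(\<lambda>n. a n y) \<longlonglongrightarrow> 0" by (rule summable_LIMSEQ_zero)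
    then have "Bseq (\<lambda>n. a n y)" by (intro convergent_imp_Bseq convergentI)
    then obtain K where K: "K > 0" "\<And>n. norm (a n y) \<le> K" by (auto simp: Bseq_def)
    have "norm (s (Suc n) y - s n y) \<le> sqrt K * (1 / 2) ^ n" for n
    proof (rule power2_le_imp_le)
      have "(2::real) ^ n * 2 ^ n = 4 ^ n" by (simp add: power_mult_distrib[symmetric])
      then have "(sqrt K * (1 / 2) ^ n)\<^sup>2 = K / 4 ^ n"
        using K(1) by (simp add: power_mult_distrib power_divide power2_eq_square)
      moreover have "(cmod (s (Suc n) y - s n y))\<^sup>2 \<le> K / 4 ^ n"
        using K(2)[of n] a0[of n y] by (simp add: a_def field_simps)
      ultimately show "(cmod (s (Suc n) y - s n y))\<^sup>2 \<le> (sqrt K * (1 / 2) ^ n)\<^sup>2" by simp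
    qed (use K in auto)
    then have "summable (\<lambda>n. s (Suc n) y - s n y)"
      using summable_comparison_test'[OF summable_mult[OF summable_geometric[of "1 / 2 :: real"], of "sqrt K"],
          of 0 "\<lambda>n. s (Suc n) y - s n y"] by simp
    then have "convergent (\<lambda>n. \<Sum>i<n. s (Suc i) y - s i y)"
      by (simp add: summable_iff_convergent)
    then have "convergent (\<lambda>n. s n y - s 0 y)" by (simp only: sum_lessThan_telescope[of "\<lambda>n. s n y"])
    then have "convergent (\<lambda>n. (s n y - s 0 y) + s 0 y)"
      by (intro convergent_add convergent_const)
    then show ?case by simp
  qed
qed

instance L2 :: (L2_measure) banach
proof
  fix X :: "nat \<Rightarrow> 'a L2" assume X: "Cauchy X"
  have "\<exists>r. \<forall>n. (\<forall>i\<ge>r n. \<forall>j\<ge>r n. norm (X i - X j) < (1 / 3) ^ n) \<and> r n < r (Suc n)"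
  proof (intro dependent_nat_choice)
    show "\<exists>N. \<forall>i\<ge>N. \<forall>j\<ge>N. norm (X i - X j) < (1 / 3) ^ 0"
      using CauchyD[OF X, of 1] by auto
    fix N n
    obtain K where "\<forall>i\<ge>K. \<forall>j\<ge>K. norm (X i - X j) < (1 / 3) ^ Suc n"
      using CauchyD[OF X, of "(1 / 3) ^ Suc n"] by auto
    then show "\<exists>K. (\<forall>i\<ge>K. \<forall>j\<ge>K. norm (X i - X j) < (1 / 3) ^ Suc n) \<and> N < K"
      by (intro exI[of _ "max K (Suc N)"]) auto
  qed
  then obtain r where r: "\<And>n i j. i \<ge> r n \<Longrightarrow> j \<ge> r n \<Longrightarrow> norm (X i - X j) < (1 / 3) ^ n"
    and r_Suc: "\<And>n. r n < r (Suc n)" by blast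
  have mono: "strict_mono r" by (simp add: strict_mono_Suc_iff r_Suc)
  have "\<forall>n. \<exists>f. f \<in> L2_fun nu \<and> X (r n) = abs_L2 f" using L2_cases by metis
  then obtain s where s: "\<And>n. s n \<in> L2_fun nu" and Xs: "\<And>n. X (r n) = abs_L2 (s n)" by metis
  note [measurable] = s
  have d: "(\<integral>y. (cmod (s m y - s n y))\<^sup>2 \<partial>nu) = (norm (X (r m) - X (r n)))\<^sup>2" for m n
    by (simp add: Xs norm_L2_diff_sq s)
  have db: "(\<integral>y. (cmod (s m y - s n y))\<^sup>2 \<partial>nu) \<le> ((1 / 3) ^ n)\<^sup>2" if "n \<le> m" for m n
    unfolding d using that r[of n "r m" "r n"] mono
    by (intro power_mono) (auto simp: strict_mono_less_eq less_imp_le)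
  have "AE y in nu. convergent (\<lambda>n. s n y)"
  proof (rule L2_fast_Cauchy_AE[OF s])
    fix n
    have "((1 / 3) ^ n)\<^sup>2 = (1 / 9 :: real) ^ n"
      by (simp add: power2_eq_square power_mult_distrib[symmetric])
    also have "\<dots> \<le> (1 / 8) ^ n" by (rule power_mono) auto
    finally show "(\<integral>y. (cmod (s (Suc n) y - s n y))\<^sup>2 \<partial>nu) \<le> (1 / 8) ^ n"
      using db[of n "Suc n"] by simp
  qed
  then have lim: "AE y in nu. (\<lambda>n. s n y) \<longlonglongrightarrow> lim (\<lambda>n. s n y)"
    by eventually_elim (simp add: convergent_LIMSEQ_iff)
  define f where "f y = lim (\<lambda>n. s n y)" for y
  have [measurable]: "f \<in> borel_measurable nu"
    unfolding f_def by (rule borel_measurable_lim_metric) measurable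
  have F: "(\<lambda>y. f y - s n y) \<in> L2_fun nu"
    "(\<integral>y. (cmod (f y - s n y))\<^sup>2 \<partial>nu) \<le> ((1 / 3) ^ n)\<^sup>2" for n
  proof -
    have "AE y in nu. (\<lambda>m. s (m + n) y - s n y) \<longlonglongrightarrow> f y - s n y"
      using lim unfolding f_def
      by eventually_elim (intro tendsto_diff tendsto_const LIMSEQ_ignore_initial_segment)
    moreover have "(\<lambda>y. s (m + n) y - s n y) \<in> L2_fun nu" for m
      by (intro L2_fun_diff s)
    moreover have "(\<lambda>y. f y - s n y) \<in> borel_measurable nu" by measurable
    ultimately show "(\<lambda>y. f y - s n y) \<in> L2_fun nu"
      "(\<integral>y. (cmod (f y - s n y))\<^sup>2 \<partial>nu) \<le> ((1 / 3) ^ n)\<^sup>2"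
      using L2_Fatou[of "\<lambda>m y. s (m + n) y - s n y" nu "\<lambda>y. f y - s n y" "((1 / 3) ^ n)\<^sup>2"]
        db[OF le_add2] by blast+
  qed
  have f: "f \<in> L2_fun nu" using L2_fun_add[OF F(1)[of 0] s[of 0]] by simp
  have "norm (X (r n) - abs_L2 f) \<le> (1 / 3) ^ n" for n
  proof (rule power2_le_imp_le)
    show "(norm (X (r n) - abs_L2 f))\<^sup>2 \<le> ((1 / 3) ^ n)\<^sup>2"
      using F(2)[of n] by (simp add: Xs norm_minus_commute[of "abs_L2 (s n)"] norm_L2_diff_sq f s)
  qed simp
  moreover have "(\<lambda>n. (1 / 3 :: real) ^ n) \<longlonglongrightarrow> 0" by (rule LIMSEQ_power_zero) simp
  ultimately have "(\<lambda>n. X (r n) - abs_L2 f) \<longlonglongrightarrow> 0"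
    using Lim_null_comparison[of "\<lambda>n. X (r n) - abs_L2 f" "\<lambda>n. (1 / 3) ^ n" sequentially] by simp
  then have "(X \<circ> r) \<longlonglongrightarrow> abs_L2 f" by (simp add: LIM_zero_iff o_def)
  then have "X \<longlonglongrightarrow> abs_L2 f" using Cauchy_converges_subseq[OF X mono] by blast
  then show "convergent X" by (rule convergentI)
qed

lift_definition cscale :: "complex \<Rightarrow> 'a::L2_measure L2 \<Rightarrow> 'a L2" (infixr \<open>*\<^sub>C\<close> 75)
  is "\<lambda>c f y. c * f y"
  unfolding L2_eq_def by (auto intro: L2_fun_cmult elim: eventually_mono)

text \<open>Bilinear, not sesquilinear: there is no conjugate.\<close>

lift_definition L2_pair :: "'a::L2_measure L2 \<Rightarrow> 'a L2 \<Rightarrow> complex" is "\<lambda>f g. \<integral>y. f y * g y \<partial>nu"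
proof -
  fix f f' g g' :: "'a \<Rightarrow> complex"
  assume a: "L2_eq f f'" "L2_eq g g'"
  note [measurable] = L2_eqD(1,2)[OF a(1)] L2_eqD(1,2)[OF a(2)]
  show "(\<integral>y. f y * g y \<partial>nu) = (\<integral>y. f' y * g' y \<partial>nu)"
  proof (rule integral_cong_AE)
    show "AE y in nu. f y * g y = f' y * g' y"
      using L2_eqD(3)[OF a(1)] L2_eqD(3)[OF a(2)] by eventually_elim simp
  qed measurable
qed

lift_definition L2_cnj :: "'a::L2_measure L2 \<Rightarrow> 'a L2" is "\<lambda>f y. cnj (f y)"
  unfolding L2_eq_def by (auto intro: L2_fun_cnj elim: eventually_mono)

lemma norm_cscale: "norm (c *\<^sub>C x) = cmod c * norm x"
proof -
  obtain f where f: "f \<in> L2_fun nu" "x = abs_L2 f" by (rule L2_cases)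
  have "L2_eq f f" using f by (simp add: L2_eq_def)
  then have e: "c *\<^sub>C x = abs_L2 (\<lambda>y. c * f y)" by (simp add: f cscale.abs_eq)
  have "(norm (c *\<^sub>C x))\<^sup>2 = (cmod c * norm x)\<^sup>2"
    unfolding e power_mult_distrib unfolding f(2)
    by (simp add: norm_L2_sq L2_fun_cmult f norm_mult power_mult_distrib)
  then show ?thesis by (simp add: power2_eq_iff_nonneg)
qed

lemma cscale_add_right: "c *\<^sub>C (x + y) = c *\<^sub>C x + c *\<^sub>C y"
  by transfer (auto simp: L2_eq_def distrib_left intro!: L2_fun_add L2_fun_cmult)

lemma cscale_scaleR: "c *\<^sub>C (r *\<^sub>R x) = r *\<^sub>R (c *\<^sub>C x)"
  by transfer (auto simp: L2_eq_def mult.left_commute intro!: L2_fun_cmult)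

lemma cscale_add_left: "(a + b) *\<^sub>C x = a *\<^sub>C x + b *\<^sub>C x"
  by transfer (auto simp: L2_eq_def distrib_right intro!: L2_fun_add L2_fun_cmult)

lemma cscale_of_real: "complex_of_real r *\<^sub>C x = r *\<^sub>R x"
  by transfer (auto simp: L2_eq_def intro!: L2_fun_cmult)

lemma cscale_cscale: "a *\<^sub>C (b *\<^sub>C x) = (a * b) *\<^sub>C x"
  by transfer (auto simp: L2_eq_def mult.assoc intro!: L2_fun_cmult)

lemma bounded_linear_cscale: "bounded_linear (\<lambda>x. c *\<^sub>C x)"
  by (rule bounded_linear_intro[where K = "cmod c"])
    (simp_all add: cscale_add_right cscale_scaleR norm_cscale mult.commute)

lemma L2_pair_add_right: "L2_pair x (y + z) = L2_pair x y + L2_pair x z"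
  by transfer (auto simp: L2_eq_def distrib_left L2_fun_prod_integrable)

lemma L2_pair_cscale_left: "L2_pair (c *\<^sub>C x) y = c * L2_pair x y"
  by transfer (simp add: mult.assoc)

lemma L2_pair_commute: "L2_pair x y = L2_pair y x"
  by transfer (simp add: mult.commute)

lemma L2_pair_cscale_right: "L2_pair x (c *\<^sub>C y) = c * L2_pair x y"
  by (simp add: L2_pair_commute[of x] L2_pair_cscale_left)

lemma norm_L2_cnj: "norm (L2_cnj x) = norm x"
  unfolding norm_eq_sqrt_inner by transfer (simp add: mult.commute)

lemma Re_L2_pair: "Re (L2_pair x y) = inner x (L2_cnj y)"
  by transfer simp

lemma norm_L2_pair_le: "cmod (L2_pair x y) \<le> norm x * norm y"
proof -
  define c where "c = cnj (sgn (L2_pair x y))"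
  have c: "c * L2_pair x y = of_real (cmod (L2_pair x y))"
  proof (cases "L2_pair x y = 0")
    case False
    then show ?thesis
      unfolding c_def sgn_eq
      by (simp add: complex_norm_square[symmetric] power2_eq_square field_simps)
  qed simp
  have "cmod c \<le> 1" by (simp add: c_def norm_sgn)
  have "cmod (L2_pair x y) = Re (L2_pair (c *\<^sub>C x) y)"
    by (simp add: L2_pair_cscale_left c)
  also have "\<dots> \<le> norm (c *\<^sub>C x) * norm y"
    unfolding Re_L2_pair using norm_cauchy_schwarz[of "c *\<^sub>C x" "L2_cnj y"] by (simp add: norm_L2_cnj)
  also have "\<dots> \<le> norm x * norm y"
    using \<open>cmod c \<le> 1\<close> by (auto simp: norm_cscale intro!: mult_right_mono mult_left_le_one_le)
  finally show ?thesis .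
qed

section \<open>Operators on $L^2(Y,\nu)$\<close>

text \<open>
  The type \<open>'a L2 \<Rightarrow>\<^sub>L 'a L2\<close> of bounded real-linear operators carries the operator norm; membership
  in the algebra $\mathcal{L}(L^2(Y,\nu))$ requires complex linearity in addition.
\<close>

definition complex_linear :: "('a::L2_measure L2 \<Rightarrow>\<^sub>L 'a L2) \<Rightarrow> bool" where
  "complex_linear A \<longleftrightarrow> (\<forall>c v. blinfun_apply A (c *\<^sub>C v) = c *\<^sub>C blinfun_apply A v)"

definition cscale_op :: "complex \<Rightarrow> ('a::L2_measure L2 \<Rightarrow>\<^sub>L 'a L2) \<Rightarrow> ('a L2 \<Rightarrow>\<^sub>L 'a L2)" where
  "cscale_op c A = Blinfun (\<lambda>v. c *\<^sub>C blinfun_apply A v)"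

lemma cscale_op_apply [simp]: "blinfun_apply (cscale_op c A) v = c *\<^sub>C blinfun_apply A v"
  unfolding cscale_op_def
  by (subst bounded_linear_Blinfun_apply)
    (auto intro: bounded_linear_compose[OF bounded_linear_cscale] blinfun.bounded_linear_right)

text \<open>The integral operator on $L^2(Y,\nu)$ with kernel $(z,w) \mapsto u(z)\,u'(w)$.\<close>

definition tensor :: "'a::L2_measure L2 \<Rightarrow> 'a L2 \<Rightarrow> ('a L2 \<Rightarrow>\<^sub>L 'a L2)" where
  "tensor u u' = Blinfun (\<lambda>v. L2_pair u' v *\<^sub>C u)"

lemma bounded_linear_tensor: "bounded_linear (\<lambda>v. L2_pair u' v *\<^sub>C u)"
proof (rule bounded_linear_intro)
  fix v w :: "'a L2" and r :: real
  show "L2_pair u' (v + w) *\<^sub>C u = L2_pair u' v *\<^sub>C u + L2_pair u' w *\<^sub>C u"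
    by (simp add: L2_pair_add_right cscale_add_left)
  show "L2_pair u' (r *\<^sub>R v) *\<^sub>C u = r *\<^sub>R (L2_pair u' v *\<^sub>C u)"
    by (simp add: L2_pair_cscale_right cscale_of_real[symmetric] cscale_cscale)
  show "norm (L2_pair u' v *\<^sub>C u) \<le> norm v * (norm u' * norm u)"
    using mult_right_mono[OF norm_L2_pair_le[of u' v] norm_ge_zero[of u]]
    by (simp add: norm_cscale ac_simps)
qed

lemma tensor_apply [simp]: "blinfun_apply (tensor u u') v = L2_pair u' v *\<^sub>C u"
  by (simp add: tensor_def bounded_linear_Blinfun_apply bounded_linear_tensor)

section \<open>Bochner spaces\<close>

text \<open>
  Elements of $L^q(M,H)$ are represented by functions; everything below respects equality almost
  everywhere. The type of exponents is \<^typ>\<open>ennreal\<close>, so that $q = \infty$ is allowed and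
  $1/\infty = 0$.
\<close>

definition Lp :: "ennreal \<Rightarrow> 'x measure \<Rightarrow> ('x \<Rightarrow> 'h::{banach, second_countable_topology}) set" where
  "Lp q M = {f \<in> borel_measurable M.
     if q = \<infinity> then \<exists>C. AE x in M. norm (f x) \<le> C
     else integrable M (\<lambda>x. norm (f x) powr enn2real q)}"

definition Lp_norm :: "ennreal \<Rightarrow> 'x measure \<Rightarrow> ('x \<Rightarrow> 'h::{banach, second_countable_topology}) \<Rightarrow> real" where
  "Lp_norm q M f =
     (if q = \<infinity> then real_of_ereal (esssup M (\<lambda>x. ereal (norm (f x))))
      else (\<integral>x. norm (f x) powr enn2real q \<partial>M) powr (1 / enn2real q))"

definition Lp_bounded_operator ::
  "ennreal \<Rightarrow> 'x measure \<Rightarrow> (('x \<Rightarrow> 'a::L2_measure L2) \<Rightarrow> ('x \<Rightarrow> 'a L2)) \<Rightarrow> bool" where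
  "Lp_bounded_operator p M T \<longleftrightarrow>
     (\<forall>f\<in>Lp p M. T f \<in> Lp p M) \<and>
     (\<forall>f\<in>Lp p M. \<forall>g\<in>Lp p M. AE x in M. T (\<lambda>x. f x + g x) x = T f x + T g x) \<and>
     (\<forall>c. \<forall>f\<in>Lp p M. AE x in M. T (\<lambda>x. c *\<^sub>C f x) x = c *\<^sub>C T f x) \<and>
     (\<exists>C. \<forall>f\<in>Lp p M. Lp_norm p M (T f) \<le> C * Lp_norm p M f)"

definition Lp_compact_operator ::
  "ennreal \<Rightarrow> 'x measure \<Rightarrow> (('x \<Rightarrow> 'a::L2_measure L2) \<Rightarrow> ('x \<Rightarrow> 'a L2)) \<Rightarrow> bool" where
  "Lp_compact_operator p M T \<longleftrightarrow>
     Lp_bounded_operator p M T \<and>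
     (\<forall>F. (\<forall>m. F m \<in> Lp p M) \<and> (\<exists>C. \<forall>m::nat. Lp_norm p M (F m) \<le> C) \<longrightarrow>
        (\<exists>u\<in>Lp p M. \<exists>r. strict_mono r \<and>
           (\<lambda>m. Lp_norm p M (\<lambda>x. T (F (r m)) x - u x)) \<longlonglongrightarrow> 0))"

definition Lp_dual :: "ennreal \<Rightarrow> 'x measure \<Rightarrow> (('x \<Rightarrow> 'a::L2_measure L2) \<Rightarrow> complex) set" where
  "Lp_dual p M = {\<phi>.
     (\<forall>f\<in>Lp p M. \<forall>g\<in>Lp p M. \<phi> (\<lambda>x. f x + g x) = \<phi> f + \<phi> g) \<and>
     (\<forall>c. \<forall>f\<in>Lp p M. \<phi> (\<lambda>x. c *\<^sub>C f x) = c * \<phi> f) \<and>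
     (\<exists>C. \<forall>f\<in>Lp p M. cmod (\<phi> f) \<le> C * Lp_norm p M f)}"

definition Lp_dual_norm :: "ennreal \<Rightarrow> 'x measure \<Rightarrow> (('x \<Rightarrow> 'a::L2_measure L2) \<Rightarrow> complex) \<Rightarrow> real" where
  "Lp_dual_norm p M \<phi> = (SUP f\<in>{f \<in> Lp p M. Lp_norm p M f \<le> 1}. cmod (\<phi> f))"

definition s_nuclear ::
  "real \<Rightarrow> ennreal \<Rightarrow> 'x measure \<Rightarrow> (('x \<Rightarrow> 'a::L2_measure L2) \<Rightarrow> ('x \<Rightarrow> 'a L2)) \<Rightarrow> bool" where
  "s_nuclear s p M T \<longleftrightarrow>
     Lp_compact_operator p M T \<and>
     (\<exists>\<phi> \<psi>. (\<forall>k::nat. \<phi> k \<in> Lp_dual p M) \<and> (\<forall>k. \<psi> k \<in> Lp p M) \<and>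
        summable (\<lambda>k. Lp_dual_norm p M (\<phi> k) powr s * Lp_norm p M (\<psi> k) powr s) \<and>
        (\<forall>f\<in>Lp p M. (\<lambda>N. Lp_norm p M (\<lambda>x. T f x - (\<Sum>k<N. \<phi> k f *\<^sub>C \<psi> k x))) \<longlonglongrightarrow> 0))"

section \<open>Periodic pseudo-differential operators\<close>

text \<open>
  $\mathbb{T}^n = \mathbb{R}^n/\mathbb{Z}^n$ is represented by the fundamental domain $[0,1)^n$ with
  Lebesgue measure, where $n$ is the cardinality of the index type. Only the values on
  $[0,1)^n$ of functions on the torus matter, except that smoothness is imposed on the periodic extension.
\<close>

definition torus :: "(real ^ 'n) measure" where
  "torus = restrict_space lborel {x. \<forall>i. 0 \<le> x $ i \<and> x $ i < 1}"

definition dot :: "real ^ 'n \<Rightarrow> int ^ 'n \<Rightarrow> real" where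
  "dot x \<xi> = (\<Sum>i\<in>UNIV. x $ i * of_int (\<xi> $ i))"

definition fourier :: "(real ^ 'n \<Rightarrow> 'a::L2_measure L2) \<Rightarrow> int ^ 'n \<Rightarrow> 'a L2" where
  "fourier f \<xi> = (\<integral>x. cis (- 2 * pi * dot x \<xi>) *\<^sub>C f x \<partial>torus)"

primrec Ck :: "nat \<Rightarrow> (real ^ 'n \<Rightarrow> 'h::real_normed_vector) \<Rightarrow> bool" where
  "Ck 0 f \<longleftrightarrow> continuous_on UNIV f"
| "Ck (Suc m) f \<longleftrightarrow>
     (\<exists>D. (\<forall>i x. ((\<lambda>t. f (x + t *\<^sub>R axis i 1)) has_vector_derivative D i x) (at 0)) \<and>
          (\<forall>i. Ck m (D i)))"

definition smooth_torus :: "(real ^ 'n \<Rightarrow> 'h::real_normed_vector) \<Rightarrow> bool" where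
  "smooth_torus f \<longleftrightarrow> (\<forall>i x. f (x + axis i 1) = f x) \<and> (\<forall>m. Ck m f)"

text \<open>\<open>T\<close> is a bounded extension to $L^p$ of the pseudo-differential operator with symbol \<open>\<sigma>\<close>.\<close>

definition pseudo_diff_operator ::
  "ennreal \<Rightarrow> (real ^ 'n \<Rightarrow> int ^ 'n \<Rightarrow> ('a::L2_measure L2 \<Rightarrow>\<^sub>L 'a L2)) \<Rightarrow>
   ((real ^ 'n \<Rightarrow> 'a L2) \<Rightarrow> (real ^ 'n \<Rightarrow> 'a L2)) \<Rightarrow> bool" where
  "pseudo_diff_operator p \<sigma> T \<longleftrightarrow>
     Lp_bounded_operator p torus T \<and>
     (\<forall>f. smooth_torus f \<longrightarrow>
        (AE x in torus.
          ((\<lambda>\<xi>. cis (2 * pi * dot x \<xi>) *\<^sub>C blinfun_apply (\<sigma> x \<xi>) (fourier f \<xi>)) has_sum T f x) UNIV))"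

end

theory Submission
  imports Defs "HOL-Probability.Probability" "HOL-Library.Diagonal_Subsequence"
begin

text \<open>
  A functional on $L^p(\mathbb{T}^n,H)$ is integration against some $g \in L^{p'}(\mathbb{T}^n,H)$, so a
  nuclear representation of $T_\sigma$, evaluated at a character times a vector $v$, reads
  $e^{2\pi i x\cdot\xi}\sigma(x,\xi)v = \sum_k \langle \widehat{g_k}(-\xi), v\rangle h_k(x)$. Since $s \le 1$, the
  series converges absolutely in operator norm for almost every $x$, and a countable dense set of
  vectors $v$ determines the symbol. Conversely the formula for the symbol yields the nuclear
  representation on characters, and both sides are bounded on $L^p$, where trigonometric
  polynomials are dense.
\<close>

text \<open>The main obstacle is the dual of a Bochner space. Over a probability space, a functional
  on L^q restricts to L^(2r) for any integer r with 2r >= q. There an even exponent and Hilbert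
  space values make the norm power a polynomial in squared norms, so uniform convexity and the first
  variation need only the parallelogram law and elementary inequalities for integer powers. The
  density so obtained represents the functional on bounded functions only, which is enough because a
  character times a vector is bounded. Its L^(p') norm is recovered afterwards by testing with
  truncations, with p = 1 as a separate case.

  The identity for the symbol holds off a null set that depends on the frequency and the vector, so
  only countably many of them may be intersected. Summability of the operator series, by contrast,
  is settled by one scalar series free of both.

  In the converse direction compactness is part of s-nuclearity and has to be proved. The images of
  a bounded sequence are controlled by countably many scalar coefficients, which a diagonal
  subsequence makes convergent.\<close>

text \<open>If \<open>a\<close> or \<open>b\<close> vanishes, this is u^q <= u for 0 < u < 1;
  otherwise it is convexity on the positive half-line.\<close>

lemma powr_convex_comb:
  fixes a b t :: real
  assumes q: "1 \<le> q" and ab: "0 \<le> a" "0 \<le> b" and t: "0 < t" "t < 1"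
  shows "((1 - t) * a + t * b) powr q \<le> (1 - t) * a powr q + t * b powr q"
proof -
  have shrink: "(u * c) powr q \<le> u * c powr q" if "0 < u" "u < 1" "0 \<le> c" for u c :: real
  proof -
    have "u powr q \<le> u powr 1" using that q by (intro powr_mono') auto
    then show ?thesis using that by (auto simp: powr_mult intro: mult_right_mono)
  qed
  consider "a = 0" | "b = 0" | "a > 0" "b > 0" using ab by linarith
  then show ?thesis
  proof cases
    case 1 then show ?thesis using shrink[of t b] t ab by simp
  next
    case 2 then show ?thesis using shrink[of "1 - t" a] t ab by simp
  next
    case 3 then show ?thesis
      using convex_onD[OF powr_convex[OF q], of t a b] t by simp
  qed
qed

section \<open>Bochner spaces\<close>

lemma Lp_iff:
  assumes "1 \<le> q"
  shows "f \<in> Lp (ennreal q) M \<longleftrightarrow> f \<in> borel_measurable M \<and> integrable M (\<lambda>x. norm (f x) powr q)"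
  using assms by (simp add: Lp_def)

lemma Lp_norm_eq:
  assumes "1 \<le> q"
  shows "Lp_norm (ennreal q) M f = (\<integral>x. norm (f x) powr q \<partial>M) powr (1 / q)"
  using assms by (simp add: Lp_norm_def)

lemma Lp_measurable [measurable_dest]: "f \<in> Lp p M \<Longrightarrow> f \<in> borel_measurable M"
  by (simp add: Lp_def)

lemma Lp_norm_nonneg [simp]: "0 \<le> Lp_norm (ennreal q) M f"
  by (simp add: Lp_norm_def)

lemma Lp_norm_powr:
  assumes "1 \<le> q"
  shows "Lp_norm (ennreal q) M f powr q = (\<integral>x. norm (f x) powr q \<partial>M)"
  using assms by (simp add: Lp_norm_eq powr_powr)

lemma Lp_norm_le:
  assumes "1 \<le> q" "0 \<le> B" "(\<integral>x. norm (f x) powr q \<partial>M) \<le> B powr q"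
  shows "Lp_norm (ennreal q) M f \<le> B"
proof -
  have "Lp_norm (ennreal q) M f \<le> (B powr q) powr (1 / q)"
    unfolding Lp_norm_eq[OF assms(1)] using assms by (intro powr_mono2) auto
  then show ?thesis using assms by (simp add: powr_powr)
qed

text \<open>The two functions may take values in different Banach spaces, so vector-valued functions
  can be compared with scalar majorants.\<close>

lemma Lp_norm_mono:
  assumes q: "1 \<le> q" and g: "g \<in> Lp (ennreal q) M" and f: "f \<in> borel_measurable M"
    and le: "AE x in M. norm (f x) \<le> norm (g x)"
  shows "f \<in> Lp (ennreal q) M" "Lp_norm (ennreal q) M f \<le> Lp_norm (ennreal q) M g"
proof -
  have le': "AE x in M. norm (f x) powr q \<le> norm (g x) powr q"
    using le by eventually_elim (use q in \<open>auto intro: powr_mono2\<close>)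
  have ig: "integrable M (\<lambda>x. norm (g x) powr q)" using g q by (simp add: Lp_iff)
  have if': "integrable M (\<lambda>x. norm (f x) powr q)"
    using le' f by (intro Bochner_Integration.integrable_bound[OF ig]) auto
  then show "f \<in> Lp (ennreal q) M" using f q by (simp add: Lp_iff)
  show "Lp_norm (ennreal q) M f \<le> Lp_norm (ennreal q) M g"
    using integral_mono_AE[OF if' ig le'] q by (intro Lp_norm_le) (auto simp: Lp_norm_powr)
qed

lemma Lp_norm_cong:
  assumes q: "1 \<le> q" and g: "g \<in> Lp (ennreal q) M" and f: "f \<in> borel_measurable M"
    and eq: "AE x in M. norm (f x) = norm (g x)"
  shows "f \<in> Lp (ennreal q) M" "Lp_norm (ennreal q) M f = Lp_norm (ennreal q) M g"
proof -
  have 1: "AE x in M. norm (f x) \<le> norm (g x)" "AE x in M. norm (g x) \<le> norm (f x)"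
    using eq by (auto elim: eventually_mono)
  show 2: "f \<in> Lp (ennreal q) M" by (rule Lp_norm_mono(1)[OF q g f 1(1)])
  show "Lp_norm (ennreal q) M f = Lp_norm (ennreal q) M g"
    using Lp_norm_mono(2)[OF q g f 1(1)] Lp_norm_mono(2)[OF q 2 _ 1(2)] g by (simp add: Lp_measurable)
qed

lemma Lp_scale:
  fixes f :: "'x \<Rightarrow> 'a::{banach, second_countable_topology}"
    and g :: "'x \<Rightarrow> 'b::{banach, second_countable_topology}"
  assumes q: "1 \<le> q" and g: "g \<in> Lp (ennreal q) M" and f: "f \<in> borel_measurable M" and "0 \<le> c"
    and eq: "\<And>x. norm (f x) = c * norm (g x)"
  shows "f \<in> Lp (ennreal q) M" "Lp_norm (ennreal q) M f = c * Lp_norm (ennreal q) M g"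
proof -
  have e: "norm (f x) powr q = c powr q * norm (g x) powr q" for x
    using \<open>0 \<le> c\<close> by (simp add: eq powr_mult)
  show "f \<in> Lp (ennreal q) M" using g f q by (simp add: Lp_iff e)
  show "Lp_norm (ennreal q) M f = c * Lp_norm (ennreal q) M g"
    using q \<open>0 \<le> c\<close> by (simp add: Lp_norm_eq e powr_mult powr_powr)
qed

lemma Lp_zero: "1 \<le> q \<Longrightarrow> (\<lambda>_. 0) \<in> Lp (ennreal q) M"
  by (simp add: Lp_iff)

lemma Lp_norm_zero: "1 \<le> q \<Longrightarrow> Lp_norm (ennreal q) M (\<lambda>_. 0) = 0"
  by (simp add: Lp_norm_eq)

lemma Lp_norm_eq_0_iff:
  assumes "1 \<le> q" "f \<in> Lp (ennreal q) M"
  shows "Lp_norm (ennreal q) M f = 0 \<longleftrightarrow> (AE x in M. f x = 0)"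
proof -
  have "Lp_norm (ennreal q) M f = 0 \<longleftrightarrow> (\<integral>x. norm (f x) powr q \<partial>M) = 0"
    using assms by (simp add: Lp_norm_eq)
  also have "\<dots> \<longleftrightarrow> (AE x in M. norm (f x) powr q = 0)"
    using assms by (intro integral_nonneg_eq_0_iff_AE) (auto simp: Lp_iff)
  finally show ?thesis by simp
qed

text \<open>Minkowski by convexity: (f + g) / (A + B) is a convex combination of f / A and g / B
  with weight \<open>t = B / (A + B)\<close>. Positive upper bounds take the place of the norms so
  that a vanishing norm does no harm; \<open>Lp_add\<close> then lets them decrease to the
  norms.\<close>

lemma Lp_add_aux:
  fixes f g :: "'x \<Rightarrow> 'a::{banach, second_countable_topology}"
  assumes q: "1 \<le> q" and f: "f \<in> Lp (ennreal q) M" and g: "g \<in> Lp (ennreal q) M"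
    and A: "Lp_norm (ennreal q) M f \<le> A" "0 < A" and B: "Lp_norm (ennreal q) M g \<le> B" "0 < B"
  shows "(\<lambda>x. f x + g x) \<in> Lp (ennreal q) M" "Lp_norm (ennreal q) M (\<lambda>x. f x + g x) \<le> A + B"
proof -
  note [measurable] = f g
  define t where "t = B / (A + B)"
  have t: "0 < t" "t < 1" "1 - t = A / (A + B)"
    using A B by (auto simp: t_def field_simps)
  define R where "R x = (A + B) powr q * ((1 - t) * (norm (f x) / A) powr q + t * (norm (g x) / B) powr q)" for x
  have R: "R x = ((A + B) powr q * (1 - t) / A powr q) * norm (f x) powr q
      + ((A + B) powr q * t / B powr q) * norm (g x) powr q" for x
    using A B by (simp add: R_def powr_divide distrib_left)
  have iR: "integrable M R" unfolding R using f g q by (simp add: Lp_iff)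
  have le: "norm (f x + g x) powr q \<le> R x" for x
  proof -
    have "norm (f x + g x) powr q \<le> (norm (f x) + norm (g x)) powr q"
      using q by (intro powr_mono2 norm_triangle_ineq) auto
    also have "norm (f x) + norm (g x) = (A + B) * ((1 - t) * (norm (f x) / A) + t * (norm (g x) / B))"
      using A B unfolding t(3) unfolding t_def by (simp add: distrib_left)
    also have "\<dots> powr q = (A + B) powr q * ((1 - t) * (norm (f x) / A) + t * (norm (g x) / B)) powr q"
      by (rule powr_mult)
    also have "\<dots> \<le> R x" unfolding R_def
      using A B t q by (intro mult_left_mono powr_convex_comb) auto
    finally show ?thesis .
  qed
  have R0: "0 \<le> R x" for x using le[of x] by (smt (verit) powr_ge_zero)
  have i: "integrable M (\<lambda>x. norm (f x + g x) powr q)"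
    by (rule Bochner_Integration.integrable_bound[OF iR]) (use le R0 in auto)
  then show "(\<lambda>x. f x + g x) \<in> Lp (ennreal q) M" using q by (simp add: Lp_iff)
  have NA: "(\<integral>x. norm (f x) powr q \<partial>M) \<le> A powr q"
    unfolding Lp_norm_powr[OF q, symmetric] using A q by (intro powr_mono2) auto
  have NB: "(\<integral>x. norm (g x) powr q \<partial>M) \<le> B powr q"
    unfolding Lp_norm_powr[OF q, symmetric] using B q by (intro powr_mono2) auto
  have "(\<integral>x. norm (f x + g x) powr q \<partial>M) \<le> (\<integral>x. R x \<partial>M)"
    by (rule integral_mono[OF i iR le])
  also have "\<dots> = ((A + B) powr q * (1 - t) / A powr q) * (\<integral>x. norm (f x) powr q \<partial>M)
      + ((A + B) powr q * t / B powr q) * (\<integral>x. norm (g x) powr q \<partial>M)"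
    unfolding R using f g q by (simp add: Lp_iff)
  also have "\<dots> \<le> ((A + B) powr q * (1 - t) / A powr q) * A powr q + ((A + B) powr q * t / B powr q) * B powr q"
    using A B t by (intro add_mono mult_left_mono NA NB) auto
  also have "\<dots> = (A + B) powr q" using A B by (simp add: field_simps)
  finally show "Lp_norm (ennreal q) M (\<lambda>x. f x + g x) \<le> A + B"
    using A B q by (intro Lp_norm_le) auto
qed

lemma Lp_add:
  fixes f g :: "'x \<Rightarrow> 'a::{banach, second_countable_topology}"
  assumes q: "1 \<le> q" and f: "f \<in> Lp (ennreal q) M" and g: "g \<in> Lp (ennreal q) M"
  shows "(\<lambda>x. f x + g x) \<in> Lp (ennreal q) M"
    "Lp_norm (ennreal q) M (\<lambda>x. f x + g x) \<le> Lp_norm (ennreal q) M f + Lp_norm (ennreal q) M g"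
proof -
  have aux: "(\<lambda>x. f x + g x) \<in> Lp (ennreal q) M"
    "Lp_norm (ennreal q) M (\<lambda>x. f x + g x) \<le> (Lp_norm (ennreal q) M f + e / 2) + (Lp_norm (ennreal q) M g + e / 2)"
    if "0 < e" for e
    using Lp_add_aux[OF q f g, of "Lp_norm (ennreal q) M f + e / 2" "Lp_norm (ennreal q) M g + e / 2"] that
    by (auto simp: add_nonneg_pos)
  show "(\<lambda>x. f x + g x) \<in> Lp (ennreal q) M" using aux(1)[of 1] by simp
  show "Lp_norm (ennreal q) M (\<lambda>x. f x + g x) \<le> Lp_norm (ennreal q) M f + Lp_norm (ennreal q) M g"
  proof (rule field_le_epsilon)
    fix e :: real assume "0 < e"
    from aux(2)[OF this] show "Lp_norm (ennreal q) M (\<lambda>x. f x + g x)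
      \<le> Lp_norm (ennreal q) M f + Lp_norm (ennreal q) M g + e" by linarith
  qed
qed

lemma Lp_uminus:
  assumes q: "1 \<le> q" and f: "f \<in> Lp (ennreal q) M"
  shows "(\<lambda>x. - f x) \<in> Lp (ennreal q) M" "Lp_norm (ennreal q) M (\<lambda>x. - f x) = Lp_norm (ennreal q) M f"
  using Lp_norm_cong[OF q f, of "\<lambda>x. - f x"] f by (auto simp: Lp_measurable)

lemma Lp_diff:
  fixes f g :: "'x \<Rightarrow> 'a::{banach, second_countable_topology}"
  assumes q: "1 \<le> q" and f: "f \<in> Lp (ennreal q) M" and g: "g \<in> Lp (ennreal q) M"
  shows "(\<lambda>x. f x - g x) \<in> Lp (ennreal q) M"
    "Lp_norm (ennreal q) M (\<lambda>x. f x - g x) \<le> Lp_norm (ennreal q) M f + Lp_norm (ennreal q) M g"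
  using Lp_add[OF q f Lp_uminus(1)[OF q g]] Lp_uminus(2)[OF q g] by auto

lemma Lp_triangle:
  fixes f g h :: "'x \<Rightarrow> 'a::{banach, second_countable_topology}"
  assumes q: "1 \<le> q" and "f \<in> Lp (ennreal q) M" "g \<in> Lp (ennreal q) M" "h \<in> Lp (ennreal q) M"
  shows "Lp_norm (ennreal q) M (\<lambda>x. f x - h x)
    \<le> Lp_norm (ennreal q) M (\<lambda>x. f x - g x) + Lp_norm (ennreal q) M (\<lambda>x. g x - h x)"
  using Lp_add(2)[OF q Lp_diff(1)[OF q assms(2,3)] Lp_diff(1)[OF q assms(3,4)]] by simp

lemma Lp_norm_minus_commute:
  fixes f g :: "'x \<Rightarrow> 'a::{banach, second_countable_topology}"
  shows "Lp_norm (ennreal q) M (\<lambda>x. f x - g x) = Lp_norm (ennreal q) M (\<lambda>x. g x - f x)"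
  unfolding Lp_norm_def by (simp add: norm_minus_commute)

lemma Lp_sum:
  fixes f :: "'i \<Rightarrow> 'x \<Rightarrow> 'a::{banach, second_countable_topology}"
  assumes q: "1 \<le> q" and f: "\<And>i. i \<in> I \<Longrightarrow> f i \<in> Lp (ennreal q) M"
  shows "(\<lambda>x. \<Sum>i\<in>I. f i x) \<in> Lp (ennreal q) M \<and>
    Lp_norm (ennreal q) M (\<lambda>x. \<Sum>i\<in>I. f i x) \<le> (\<Sum>i\<in>I. Lp_norm (ennreal q) M (f i))"
  using f
proof (induction I rule: infinite_finite_induct)
  case (insert i I)
  have i: "f i \<in> Lp (ennreal q) M" and I: "(\<lambda>x. \<Sum>i\<in>I. f i x) \<in> Lp (ennreal q) M"
    "Lp_norm (ennreal q) M (\<lambda>x. \<Sum>i\<in>I. f i x) \<le> (\<Sum>i\<in>I. Lp_norm (ennreal q) M (f i))"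
    using insert by auto
  show ?case using insert.hyps Lp_add[OF q i I(1)] I(2) by simp
qed (simp_all add: Lp_zero[OF q] Lp_norm_zero[OF q])

text \<open>Serves where no majorant is at hand: for tails of series, and for a density whose
  truncations alone are known to be bounded in norm.\<close>

lemma Lp_Fatou:
  fixes f :: "'x \<Rightarrow> 'a::{banach, second_countable_topology}"
  assumes q: "1 \<le> q" and F: "\<And>n. F n \<in> Lp (ennreal q) M" and B: "\<And>n. Lp_norm (ennreal q) M (F n) \<le> B"
    and f: "f \<in> borel_measurable M" and lim: "AE x in M. (\<lambda>n. F n x) \<longlonglongrightarrow> f x"
  shows "f \<in> Lp (ennreal q) M" "Lp_norm (ennreal q) M f \<le> B"
proof -
  note [measurable] = F f
  have B0: "0 \<le> B" using B[of 0] Lp_norm_nonneg[of q M "F 0"] by linarith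
  have "(\<integral>\<^sup>+x. ennreal (norm (f x) powr q) \<partial>M) = (\<integral>\<^sup>+x. liminf (\<lambda>n. ennreal (norm (F n x) powr q)) \<partial>M)"
  proof (rule nn_integral_cong_AE, use lim in eventually_elim)
    case (elim x)
    have "(\<lambda>n. ennreal (norm (F n x) powr q)) \<longlonglongrightarrow> ennreal (norm (f x) powr q)"
      using q by (intro tendsto_ennrealI tendsto_powr2 tendsto_norm elim tendsto_const) auto
    then show ?case by (metis lim_imp_Liminf trivial_limit_sequentially)
  qed
  also have "\<dots> \<le> liminf (\<lambda>n. \<integral>\<^sup>+x. ennreal (norm (F n x) powr q) \<partial>M)"
    by (rule nn_integral_liminf) measurable
  also have "\<dots> \<le> liminf (\<lambda>n::nat. ennreal (B powr q))"
  proof (intro Liminf_mono always_eventually allI)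
    fix n
    have i: "integrable M (\<lambda>x. norm (F n x) powr q)" using F[of n] q by (simp add: Lp_iff)
    have "(\<integral>x. norm (F n x) powr q \<partial>M) \<le> B powr q"
      unfolding Lp_norm_powr[OF q, symmetric] using B[of n] q by (intro powr_mono2) auto
    then show "(\<integral>\<^sup>+x. ennreal (norm (F n x) powr q) \<partial>M) \<le> ennreal (B powr q)"
      using i by (subst nn_integral_eq_integral) (auto intro: ennreal_leI)
  qed
  also have "\<dots> = ennreal (B powr q)" by (simp add: Liminf_const)
  finally have le: "(\<integral>\<^sup>+x. ennreal (norm (f x) powr q) \<partial>M) \<le> ennreal (B powr q)" .
  have int: "integrable M (\<lambda>x. norm (f x) powr q)"
    using le by (intro integrableI_nonneg) (auto simp: le_less_trans[OF le])
  then show "f \<in> Lp (ennreal q) M" using q f by (simp add: Lp_iff)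
  show "Lp_norm (ennreal q) M f \<le> B"
    using le B0 q by (intro Lp_norm_le) (auto simp: nn_integral_eq_integral[OF int])
qed

lemma Lp_dominated_convergence:
  fixes f :: "'x \<Rightarrow> 'a::{banach, second_countable_topology}" and G :: "'x \<Rightarrow> real"
  assumes q: "1 \<le> q" and G: "G \<in> Lp (ennreal q) M"
    and F: "\<And>n. F n \<in> borel_measurable M" and f: "f \<in> borel_measurable M"
    and lim: "AE x in M. (\<lambda>n. F n x) \<longlonglongrightarrow> f x"
    and dom: "\<And>n. AE x in M. norm (F n x) \<le> G x"
  shows "f \<in> Lp (ennreal q) M" "\<And>n. F n \<in> Lp (ennreal q) M"
    "(\<lambda>n. Lp_norm (ennreal q) M (\<lambda>x. F n x - f x)) \<longlonglongrightarrow> 0"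
proof -
  note [measurable] = F f G
  show Fn: "F n \<in> Lp (ennreal q) M" for n
    by (rule Lp_norm_mono(1)[OF q G F]) (use dom[of n] in eventually_elim, auto)
  have FB: "Lp_norm (ennreal q) M (F n) \<le> Lp_norm (ennreal q) M G" for n
    by (rule Lp_norm_mono(2)[OF q G F]) (use dom[of n] in eventually_elim, auto)
  show fL: "f \<in> Lp (ennreal q) M" by (rule Lp_Fatou(1)[OF q Fn FB f lim])
  have domf: "AE x in M. norm (f x) \<le> G x"
  proof -
    have "AE x in M. \<forall>n. norm (F n x) \<le> G x" using dom by (simp add: AE_all_countable)
    then show ?thesis using lim
      by eventually_elim (rule LIMSEQ_le_const2[OF tendsto_norm], auto)
  qed
  have "(\<lambda>n. \<integral>x. norm (F n x - f x) powr q \<partial>M) \<longlonglongrightarrow> (\<integral>x. 0 \<partial>M)"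
  proof (rule integral_dominated_convergence)
    show "integrable M (\<lambda>x. 2 powr q * norm (G x) powr q)" using G q by (simp add: Lp_iff)
    show "AE x in M. (\<lambda>n. norm (F n x - f x) powr q) \<longlonglongrightarrow> 0"
      using lim
    proof eventually_elim
      case (elim x)
      have "(\<lambda>n. norm (F n x - f x) powr q) \<longlonglongrightarrow> norm (f x - f x) powr q"
        using q by (intro tendsto_powr2 tendsto_norm tendsto_diff elim tendsto_const) auto
      then show ?case using q by simp
    qed
    show "AE x in M. norm (norm (F n x - f x) powr q) \<le> 2 powr q * norm (G x) powr q" for n
      using dom[of n] domf
    proof eventually_elim
      case (elim x)
      have "norm (F n x - f x) \<le> norm (2 * G x)"
        using elim norm_triangle_ineq4[of "F n x" "f x"] by simp
      then have "norm (F n x - f x) powr q \<le> norm (2 * G x) powr q" using q by (intro powr_mono2) auto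
      then show ?case by (simp add: powr_mult abs_mult)
    qed
  qed measurable
  then have "(\<lambda>n. (\<integral>x. norm (F n x - f x) powr q \<partial>M) powr (1 / q)) \<longlonglongrightarrow> 0 powr (1 / q)"
    using q by (intro tendsto_powr2 tendsto_const) auto
  then show "(\<lambda>n. Lp_norm (ennreal q) M (\<lambda>x. F n x - f x)) \<longlonglongrightarrow> 0"
    using q by (simp add: Lp_norm_eq)
qed

section \<open>Essentially bounded functions, conjugate exponents and Hoelder's inequality\<close>

lemma Lp_inf_iff: "f \<in> Lp \<infinity> M \<longleftrightarrow> f \<in> borel_measurable M \<and> (\<exists>C. AE x in M. norm (f x) \<le> C)"
  by (simp add: Lp_def)

lemma Lp_inf_AE:
  fixes f :: "'x \<Rightarrow> 'a::{banach, second_countable_topology}"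
  assumes "f \<in> Lp \<infinity> M"
  shows "AE x in M. norm (f x) \<le> Lp_norm \<infinity> M f"
proof -
  define e where "e = esssup M (\<lambda>x. ereal (norm (f x)))"
  obtain C where C: "AE x in M. norm (f x) \<le> C" and [measurable]: "f \<in> borel_measurable M"
    using assms unfolding Lp_inf_iff by blast
  have "e \<le> ereal C" unfolding e_def using C by (intro esssup_I) auto
  then have "e \<noteq> \<infinity>" by auto
  have "AE x in M. ereal (norm (f x)) \<le> e" unfolding e_def by (rule esssup_AE)
  then show ?thesis
  proof eventually_elim
    case (elim x)
    then have "norm (f x) \<le> real_of_ereal e" using \<open>e \<noteq> \<infinity>\<close> by (cases e) auto
    then show ?case by (simp add: Lp_norm_def e_def)
  qed
qed

lemma Lp_inf_norm_le:
  fixes f :: "'x \<Rightarrow> 'a::{banach, second_countable_topology}"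
  assumes [measurable]: "f \<in> borel_measurable M" and "AE x in M. norm (f x) \<le> B" "0 \<le> B"
  shows "f \<in> Lp \<infinity> M" "Lp_norm \<infinity> M f \<le> B"
proof -
  show "f \<in> Lp \<infinity> M" unfolding Lp_inf_iff using assms by blast
  define e where "e = esssup M (\<lambda>x. ereal (norm (f x)))"
  have "e \<le> ereal B" unfolding e_def using assms by (intro esssup_I) auto
  \<comment> \<open>On a null measure space \<open>e\<close> is minus infinity and
    \<open>real_of_ereal\<close> returns 0; the assumption \<open>0 \<le> B\<close> covers this
    case.\<close>
  then have "real_of_ereal e \<le> B" using assms(3) by (cases e) auto
  then show "Lp_norm \<infinity> M f \<le> B" by (simp add: Lp_norm_def e_def)
qed

text \<open>In \<open>ennreal\<close> the quotient 1 / 0 is infinite and 1 / \<infinity> is 0. The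
  first excludes p' = 0, the second makes p' = \<infinity> the partner of p = 1.\<close>

lemma conjugate_exponents:
  fixes p p' :: ennreal
  assumes "1 \<le> p" "p < \<infinity>" "1 / p + 1 / p' = 1"
  obtains "p = ennreal 1" "p' = \<infinity>"
  | q q' where "p = ennreal q" "p' = ennreal q'" "1 < q" "1 < q'" "1 / q + 1 / q' = 1"
proof -
  obtain q where q: "p = ennreal q" "0 \<le> q" using assms(2) by (cases p) auto
  have q1: "1 \<le> q" using assms(1) q by simp
  have ip: "1 / p = ennreal (1 / q)" using q q1 by (simp add: divide_ennreal flip: ennreal_1)
  show thesis
  proof (cases p')
    case (real q')
    have "q' \<noteq> 0"
    proof
      assume "q' = 0"
      then have "1 / p' = \<infinity>" using real by simp
      then show False using assms(3) by simp
    qed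
    then have q'0: "0 < q'" using real by simp
    then have ip': "1 / p' = ennreal (1 / q')" using real by (simp add: divide_ennreal flip: ennreal_1)
    have "ennreal (1 / q + 1 / q') = ennreal 1"
      using assms(3) unfolding ip ip' using q1 q'0 by (simp add: ennreal_plus)
    then have e: "1 / q + 1 / q' = 1" using q1 q'0 by (subst (asm) ennreal_inj) auto
    have "0 < 1 / q" "0 < 1 / q'" using q1 q'0 by auto
    then have "1 / q < 1" "1 / q' < 1" using e by linarith+
    then have "1 < q" "1 < q'" using q1 q'0 by (auto simp: field_simps)
    then show thesis using that(2) q(1) real e by blast
  next
    case top
    then have "ennreal (1 / q) = ennreal 1" using assms(3) ip by simp
    then have "1 / q = 1" using q1 by (subst (asm) ennreal_inj) auto
    then have "p = ennreal 1" using q1 q(1) by simp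
    then show thesis using that(1) top by simp
  qed
qed

lemma Hoelder:
  fixes f :: "'x \<Rightarrow> 'a::{banach, second_countable_topology}"
    and g :: "'x \<Rightarrow> 'b::{banach, second_countable_topology}"
  assumes p: "1 \<le> p" "p < \<infinity>" "1 / p + 1 / p' = 1" and f: "f \<in> Lp p M" and g: "g \<in> Lp p' M"
  shows "integrable M (\<lambda>x. norm (f x) * norm (g x))"
    "(\<integral>x. norm (f x) * norm (g x) \<partial>M) \<le> Lp_norm p M f * Lp_norm p' M g"
proof -
  note [measurable] = f g
  have "integrable M (\<lambda>x. norm (f x) * norm (g x)) \<and>
    (\<integral>x. norm (f x) * norm (g x) \<partial>M) \<le> Lp_norm p M f * Lp_norm p' M g"
  using p
  proof (cases rule: conjugate_exponents)
    case 1
    define G where "G = Lp_norm \<infinity> M g"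
    have f1: "integrable M (\<lambda>x. norm (f x))" using f Lp_iff[of 1 f M] unfolding 1 by simp
    then have i: "integrable M (\<lambda>x. norm (f x) * G)" by simp
    have le: "AE x in M. norm (f x) * norm (g x) \<le> norm (f x) * G"
      using Lp_inf_AE[of g M] g unfolding 1 G_def by (auto elim!: eventually_mono intro: mult_left_mono)
    have j: "integrable M (\<lambda>x. norm (f x) * norm (g x))"
      by (rule Bochner_Integration.integrable_bound[OF i]) (use le in \<open>auto elim: eventually_mono\<close>)
    show ?thesis
      using j integral_mono_AE[OF j i le] Lp_norm_eq[of 1 M f] unfolding 1 G_def by simp
  next
    case (2 q q')
    have q: "1 \<le> q" "1 \<le> q'" using 2 by auto
    \<comment> \<open>Young's inequality is applied to the functions divided by their norms. The
      summand \<open>e\<close> keeps the divisors positive and tends to 0 at the end.\<close>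
    have aux: "integrable M (\<lambda>x. norm (f x) * norm (g x)) \<and>
      (\<integral>x. norm (f x) * norm (g x) \<partial>M) \<le> (Lp_norm p M f + e) * (Lp_norm p' M g + e)" if e: "0 < e" for e
    proof -
      define A where "A = Lp_norm p M f + e"
      define B where "B = Lp_norm p' M g + e"
      have AB: "0 < A" "0 < B" unfolding A_def B_def using e 2 by (auto simp: add_nonneg_pos)
      define R where "R x = A * B * ((norm (f x) / A) powr q / q + (norm (g x) / B) powr q' / q')" for x
      have le: "norm (f x) * norm (g x) \<le> R x" for x
      proof -
        have "(norm (f x) / A) * (norm (g x) / B) \<le> (norm (f x) / A) powr q / q + (norm (g x) / B) powr q' / q'"
          using 2 AB by (intro Youngs_inequality) auto
        then have "A * B * ((norm (f x) / A) * (norm (g x) / B)) \<le> R x"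
          unfolding R_def using AB by (intro mult_left_mono) auto
        then show ?thesis using AB by (simp add: field_simps)
      qed
      have R: "R x = (A * B / (A powr q * q)) * norm (f x) powr q + (A * B / (B powr q' * q')) * norm (g x) powr q'" for x
        using AB by (simp add: R_def powr_divide distrib_left)
      have iR: "integrable M R" unfolding R using f g q 2 by (simp add: Lp_iff)
      have j: "integrable M (\<lambda>x. norm (f x) * norm (g x))"
      proof (rule Bochner_Integration.integrable_bound[OF iR])
        have "norm (norm (f x) * norm (g x)) \<le> norm (R x)" for x using le[of x] by simp
        then show "AE x in M. norm (norm (f x) * norm (g x)) \<le> norm (R x)" by simp
      qed measurable
      have NA: "(\<integral>x. norm (f x) powr q \<partial>M) \<le> A powr q"
        unfolding Lp_norm_powr[OF q(1), symmetric] A_def using e q 2 by (intro powr_mono2) auto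
      have NB: "(\<integral>x. norm (g x) powr q' \<partial>M) \<le> B powr q'"
        unfolding Lp_norm_powr[OF q(2), symmetric] B_def using e q 2 by (intro powr_mono2) auto
      have "(\<integral>x. norm (f x) * norm (g x) \<partial>M) \<le> (\<integral>x. R x \<partial>M)"
        by (rule integral_mono[OF j iR le])
      also have "\<dots> = (A * B / (A powr q * q)) * (\<integral>x. norm (f x) powr q \<partial>M) + (A * B / (B powr q' * q')) * (\<integral>x. norm (g x) powr q' \<partial>M)"
        unfolding R using f g q 2 by (simp add: Lp_iff)
      also have "\<dots> \<le> (A * B / (A powr q * q)) * A powr q + (A * B / (B powr q' * q')) * B powr q'"
        using AB q by (intro add_mono mult_left_mono NA NB) auto
      also have "\<dots> = A * B * (1 / q + 1 / q')" using AB by (simp add: distrib_left)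
      also have "\<dots> = A * B" using 2 by simp
      finally show ?thesis using j by (simp add: A_def B_def)
    qed
    have "(\<lambda>n. (Lp_norm p M f + inverse (real (Suc n))) * (Lp_norm p' M g + inverse (real (Suc n))))
        \<longlonglongrightarrow> (Lp_norm p M f + 0) * (Lp_norm p' M g + 0)"
      by (intro tendsto_intros LIMSEQ_inverse_real_of_nat)
    then have "(\<integral>x. norm (f x) * norm (g x) \<partial>M) \<le> (Lp_norm p M f + 0) * (Lp_norm p' M g + 0)"
      by (rule LIMSEQ_le_const) (use aux in auto)
    then show ?thesis using aux[of 1] by simp
  qed
  then show "integrable M (\<lambda>x. norm (f x) * norm (g x))"
    "(\<integral>x. norm (f x) * norm (g x) \<partial>M) \<le> Lp_norm p M f * Lp_norm p' M g" by auto
qed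

section \<open>Inclusions between Bochner spaces over a probability space\<close>

context prob_space
begin

lemma Lp_const:
  fixes c :: "'b::{banach, second_countable_topology}"
  shows "(\<lambda>_. c) \<in> Lp p M"
  by (auto simp: Lp_def)

lemma Lp_bounded:
  fixes f :: "'a \<Rightarrow> 'b::{banach, second_countable_topology}"
  assumes "f \<in> borel_measurable M" "\<And>x. norm (f x) \<le> B" "1 \<le> q"
  shows "f \<in> Lp (ennreal q) M"
proof -
  have "norm (f x) \<le> norm (\<bar>B\<bar>)" for x using assms(2)[of x] by simp
  then show ?thesis using Lp_norm_mono(1)[OF assms(3) Lp_const[of "\<bar>B\<bar>"] assms(1)] by simp
qed

lemma Lp_norm_const:
  assumes "1 \<le> q"
  shows "Lp_norm (ennreal q) M (\<lambda>_. 1 :: real) = 1"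
  using assms by (simp add: Lp_norm_eq prob_space)

text \<open>Hoelder against the constant 1, except for q = 1, where there is nothing to
  show.\<close>

lemma Lp_integrable:
  fixes f :: "'a \<Rightarrow> 'b::{banach, second_countable_topology}"
  assumes q: "1 \<le> q" and f: "f \<in> Lp (ennreal q) M"
  shows "integrable M f" "(\<integral>x. norm (f x) \<partial>M) \<le> Lp_norm (ennreal q) M f"
proof -
  have "integrable M (\<lambda>x. norm (f x)) \<and> (\<integral>x. norm (f x) \<partial>M) \<le> Lp_norm (ennreal q) M f"
  proof (cases "q = 1")
    case True
    then show ?thesis using f Lp_iff[of 1 f M] Lp_norm_eq[of 1 M f] by simp
  next
    case False
    define q' where "q' = q / (q - 1)"
    have q1: "1 < q" using q False by simp
    then have "1 / q' = 1 - 1 / q" by (simp add: q'_def diff_divide_distrib)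
    then have q': "1 < q'" "1 / q + 1 / q' = 1" using q1 by (auto simp: q'_def less_divide_eq)
    have "1 / ennreal q + 1 / ennreal q' = ennreal (1 / q) + ennreal (1 / q')"
      using q1 q' by (simp add: divide_ennreal flip: ennreal_1)
    also have "\<dots> = ennreal (1 / q + 1 / q')" using q1 q' by (intro ennreal_plus[symmetric]) auto
    also have "\<dots> = 1" unfolding q'(2) by simp
    finally have e: "1 / ennreal q + 1 / ennreal q' = 1" .
    have p: "1 \<le> ennreal q" "ennreal q < \<infinity>" using q by auto
    have n1: "Lp_norm (ennreal q') M (\<lambda>_. 1::real) = 1" using q' by (intro Lp_norm_const) simp
    from Hoelder[OF p e f Lp_const[where c = "1::real"]]
    show ?thesis unfolding n1 by simp
  qed
  then show "integrable M f" "(\<integral>x. norm (f x) \<partial>M) \<le> Lp_norm (ennreal q) M f"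
    using f integrable_norm_cancel[of M f] by (auto simp: Lp_measurable)
qed

text \<open>Hoelder against the constant 1 with the roles exchanged, so that p' = \<infinity> is
  covered. For a density \<open>g\<close> it bounds all Fourier coefficients at once by
  \<open>Lp_norm p' M g\<close>.\<close>

lemma Lp_conj_integrable:
  fixes g :: "'a \<Rightarrow> 'b::{banach, second_countable_topology}"
  assumes p: "1 \<le> p" "p < \<infinity>" "1 / p + 1 / p' = 1" and g: "g \<in> Lp p' M"
  shows "integrable M g" "(\<integral>x. norm (g x) \<partial>M) \<le> Lp_norm p' M g" "0 \<le> Lp_norm p' M g"
proof -
  obtain q where q: "p = ennreal q" "1 \<le> q"
    using p by (cases rule: conjugate_exponents) auto
  note * = Hoelder[OF p Lp_const[where c = "1::real"] g]
  show "integrable M g" using *(1) g by - (rule integrable_norm_cancel, simp_all add: Lp_measurable)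
  show 1: "(\<integral>x. norm (g x) \<partial>M) \<le> Lp_norm p' M g" using *(2) Lp_norm_const[OF q(2)] unfolding q(1) by simp
  have "0 \<le> (\<integral>x. norm (g x) \<partial>M)" by simp
  then show "0 \<le> Lp_norm p' M g" using 1 by linarith
qed

text \<open>The case of exponent r / q for the scalar function |f|^q. It allows a functional on L^q
  to be restricted to a space with an even exponent.\<close>

lemma Lp_mono_exponent:
  fixes f :: "'a \<Rightarrow> 'b::{banach, second_countable_topology}"
  assumes q: "1 \<le> q" "q \<le> r" and f: "f \<in> Lp (ennreal r) M"
  shows "f \<in> Lp (ennreal q) M" "Lp_norm (ennreal q) M f \<le> Lp_norm (ennreal r) M f"
proof -
  define F where "F x = norm (f x) powr q" for x
  have r: "1 \<le> r / q" "1 \<le> r" using q by auto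
  have Fp: "norm (F x) powr (r / q) = norm (f x) powr r" for x
    using q by (simp add: F_def powr_powr)
  have F: "F \<in> Lp (ennreal (r / q)) M"
    using f r unfolding Lp_iff[OF r(1)] Fp Lp_iff[OF r(2)] by (auto simp: F_def[abs_def])
  have "integrable M F" by (rule Lp_integrable(1)[OF r(1) F])
  then show fq: "f \<in> Lp (ennreal q) M" using f q by (simp add: Lp_iff F_def[abs_def] Lp_measurable)
  have "(\<integral>x. norm (f x) powr q \<partial>M) = (\<integral>x. norm (F x) \<partial>M)" by (simp add: F_def)
  also have "\<dots> \<le> Lp_norm (ennreal (r / q)) M F" by (rule Lp_integrable(2)[OF r(1) F])
  also have "\<dots> = Lp_norm (ennreal r) M f powr q"
    unfolding Lp_norm_eq[OF r(1)] Fp Lp_norm_eq[OF r(2)] using q by (simp add: powr_powr)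
  finally show "Lp_norm (ennreal q) M f \<le> Lp_norm (ennreal r) M f"
    using q by (intro Lp_norm_le) auto
qed

end

section \<open>Scalar multiplication and duality pairing\<close>

interpretation cscale: bounded_bilinear "cscale :: complex \<Rightarrow> 'a::L2_measure L2 \<Rightarrow> 'a L2"
proof
  fix a b :: complex and x y :: "'a L2" and r :: real
  show "(a + b) *\<^sub>C x = a *\<^sub>C x + b *\<^sub>C x" by (rule cscale_add_left)
  show "a *\<^sub>C (x + y) = a *\<^sub>C x + a *\<^sub>C y" by (rule cscale_add_right)
  show "(r *\<^sub>R a) *\<^sub>C x = r *\<^sub>R (a *\<^sub>C x)"
    by (simp add: scaleR_conv_of_real cscale_of_real flip: cscale_cscale)
  show "a *\<^sub>C (r *\<^sub>R x) = r *\<^sub>R (a *\<^sub>C x)" by (rule cscale_scaleR)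
  show "\<exists>K. \<forall>a x. norm (a *\<^sub>C (x :: 'a L2)) \<le> norm a * norm x * K"
    by (rule exI[of _ 1]) (simp add: norm_cscale)
qed

lemma cscale_one [simp]: "1 *\<^sub>C x = x"
  using cscale_of_real[of 1 x] by simp

interpretation L2_pair: bounded_bilinear "L2_pair :: 'a::L2_measure L2 \<Rightarrow> 'a L2 \<Rightarrow> complex"
proof
  fix r :: real and x y z :: "'a L2"
  show "L2_pair x (y + z) = L2_pair x y + L2_pair x z" by (rule L2_pair_add_right)
  then show "L2_pair (y + z) x = L2_pair y x + L2_pair z x" by (simp add: L2_pair_commute[of _ x])
  show "L2_pair x (r *\<^sub>R y) = r *\<^sub>R L2_pair x y"
    by (simp add: L2_pair_cscale_right scaleR_conv_of_real flip: cscale_of_real)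
  then show "L2_pair (r *\<^sub>R y) x = r *\<^sub>R L2_pair y x" by (simp add: L2_pair_commute[of _ x])
  show "\<exists>K. \<forall>x y. norm (L2_pair x (y :: 'a L2)) \<le> norm x * norm y * K"
    by (rule exI[of _ 1]) (simp add: norm_L2_pair_le)
qed

lemma borel_measurable_bilinear:
  fixes f :: "'x \<Rightarrow> 'b::{real_normed_vector, second_countable_topology}"
    and g :: "'x \<Rightarrow> 'c::{real_normed_vector, second_countable_topology}"
  assumes "bounded_bilinear B" "f \<in> borel_measurable M" "g \<in> borel_measurable M"
  shows "(\<lambda>x. B (f x) (g x)) \<in> borel_measurable M"
proof (rule borel_measurable_continuous_Pair[OF assms(2,3)])
  show "continuous_on UNIV (\<lambda>x. B (fst x) (snd x))"
    by (intro bounded_bilinear.continuous_on[OF assms(1)] continuous_intros)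
qed

lemma borel_measurable_cscale [measurable]:
  "f \<in> borel_measurable M \<Longrightarrow> g \<in> borel_measurable M \<Longrightarrow> (\<lambda>x. f x *\<^sub>C g x) \<in> borel_measurable M"
  by (rule borel_measurable_bilinear[OF cscale.bounded_bilinear_axioms])

lemma borel_measurable_L2_pair [measurable]:
  "f \<in> borel_measurable M \<Longrightarrow> g \<in> borel_measurable M \<Longrightarrow> (\<lambda>x. L2_pair (f x) (g x)) \<in> borel_measurable M"
  by (rule borel_measurable_bilinear[OF L2_pair.bounded_bilinear_axioms])

lemma L2_cnj_L2_cnj [simp]: "L2_cnj (L2_cnj x) = x"
  by transfer (simp add: L2_eq_def)

lemma L2_cnj_add: "L2_cnj (x + y) = L2_cnj x + L2_cnj y"
  by transfer (auto simp: L2_eq_def intro!: L2_fun_add L2_fun_cnj)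

lemma L2_cnj_scaleR: "L2_cnj (r *\<^sub>R x) = r *\<^sub>R L2_cnj x"
  by transfer (auto simp: L2_eq_def intro!: L2_fun_cmult L2_fun_cnj)

lemma bounded_linear_L2_cnj: "bounded_linear L2_cnj"
  by (rule bounded_linear_intro[of _ 1]) (simp_all add: L2_cnj_add L2_cnj_scaleR norm_L2_cnj)

lemma borel_measurable_L2_cnj [measurable]:
  "f \<in> borel_measurable M \<Longrightarrow> (\<lambda>x. L2_cnj (f x)) \<in> borel_measurable M"
  by (rule borel_measurable_continuous_on[OF linear_continuous_on[OF bounded_linear_L2_cnj]])

text \<open>For the bilinear pairing the extremal vector is the conjugate, hence the factors
  \<open>L2_cnj\<close> in all test functions of the duality argument.\<close>

lemma L2_pair_L2_cnj: "L2_pair x (L2_cnj x) = of_real ((norm x)\<^sup>2)"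
proof -
  obtain f where f: "f \<in> L2_fun nu" "x = abs_L2 f" by (rule L2_cases)
  then have eq: "L2_eq f f" by (simp add: L2_eq_def)
  have eq': "L2_eq (\<lambda>y. cnj (f y)) (\<lambda>y. cnj (f y))" using f by (simp add: L2_eq_def L2_fun_cnj)
  have "L2_pair x (L2_cnj x) = (\<integral>y. f y * cnj (f y) \<partial>nu)"
    unfolding f(2) L2_cnj.abs_eq[OF eq] by (rule L2_pair.abs_eq[OF eq eq'])
  also have "\<dots> = of_real (\<integral>y. (cmod (f y))\<^sup>2 \<partial>nu)"
    by (simp add: complex_norm_square[symmetric] del: of_real_power)
  finally show ?thesis using norm_L2_sq[OF f(1)] f(2) by simp
qed

lemma norm_tensor_le: "norm (tensor u v) \<le> norm u * norm v"
proof (rule norm_blinfun_bound)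
  fix w
  show "norm (blinfun_apply (tensor u v) w) \<le> norm u * norm v * norm w"
    using mult_right_mono[OF norm_L2_pair_le[of v w] norm_ge_zero[of u]]
    by (simp add: norm_cscale ac_simps)
qed simp

section \<open>Characters of the torus\<close>

definition character :: "int ^ 'n \<Rightarrow> real ^ 'n \<Rightarrow> complex" where
  "character \<xi> x = cis (2 * pi * dot x \<xi>)"

lemma dot_add_left: "dot (x + y) \<xi> = dot x \<xi> + dot y \<xi>"
  by (simp add: dot_def distrib_right sum.distrib)

lemma dot_add_right: "dot x (\<xi> + \<eta>) = dot x \<xi> + dot x \<eta>"
  by (simp add: dot_def distrib_left sum.distrib)

lemma dot_uminus_right: "dot x (- \<xi>) = - dot x \<xi>"
  by (simp add: dot_def sum_negf)

lemma dot_axis: "dot (t *\<^sub>R axis i 1) \<xi> = t * of_int (\<xi> $ i)"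
proof -
  have "dot (t *\<^sub>R axis i 1) \<xi> = (\<Sum>j\<in>UNIV. if j = i then t * of_int (\<xi> $ j) else 0)"
    unfolding dot_def by (rule sum.cong) (auto simp: axis_def)
  then show ?thesis by simp
qed

lemma continuous_on_dot [continuous_intros]: "continuous_on A (\<lambda>x. dot x \<xi>)"
  unfolding dot_def by (intro continuous_intros)

lemma character_add: "character (\<xi> + \<eta>) x = character \<xi> x * character \<eta> x"
  by (simp add: character_def dot_add_right cis_mult distrib_left)

lemma character_uminus: "character (- \<xi>) x = cis (- 2 * pi * dot x \<xi>)"
  by (simp add: character_def dot_uminus_right)

lemma character_zero: "character 0 x = 1"
  by (simp add: character_def dot_def)

lemma norm_character [simp]: "cmod (character \<xi> x) = 1"
  by (simp add: character_def)

lemma continuous_on_character [continuous_intros]: "continuous_on A (character \<xi>)"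
  unfolding character_def cis_conv_exp by (intro continuous_intros)

lemma borel_measurable_character [measurable]: "character \<xi> \<in> borel_measurable borel"
  by (intro borel_measurable_continuous_onI continuous_intros)

lemma has_vector_derivative_cis:
  "((\<lambda>t. cis (c * t)) has_vector_derivative c *\<^sub>R (\<i> * cis (c * t))) (at t within A)"
proof -
  have e: "cis (c * t) = exp (t *\<^sub>R (\<i> * of_real c))" for t
    by (simp add: cis_conv_exp scaleR_conv_of_real mult_ac)
  show ?thesis unfolding e
    using exp_scaleR_has_vector_derivative_right[of "\<i> * of_real c" t A]
    by (simp add: scaleR_conv_of_real mult_ac)
qed

lemma has_vector_derivative_character:
  fixes \<xi> :: "int ^ 'n"
  shows
  "((\<lambda>t. character \<xi> (x + t *\<^sub>R axis i 1) *\<^sub>C v) has_vector_derivative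
     character \<xi> x *\<^sub>C ((2 * pi * of_int (\<xi> $ i) * \<i>) *\<^sub>C v)) (at 0)"
proof -
  have e: "character \<xi> (x + t *\<^sub>R axis i 1) = character \<xi> x * cis (2 * pi * of_int (\<xi> $ i) * t)" for t
    by (simp add: character_def dot_add_left dot_axis distrib_left cis_mult mult_ac)
  have "((\<lambda>t. character \<xi> x * cis (2 * pi * of_int (\<xi> $ i) * t)) has_vector_derivative
      character \<xi> x * ((2 * pi * of_int (\<xi> $ i)) *\<^sub>R (\<i> * cis (2 * pi * of_int (\<xi> $ i) * 0)))) (at 0)"
    by (intro has_vector_derivative_mult_right has_vector_derivative_cis)
  then have "((\<lambda>t. character \<xi> x * cis (2 * pi * of_int (\<xi> $ i) * t)) has_vector_derivative
      character \<xi> x * (2 * pi * of_int (\<xi> $ i) * \<i>)) (at 0)"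
    by (simp add: scaleR_conv_of_real mult_ac)
  from bounded_linear.has_vector_derivative[OF cscale.bounded_linear_left this, of v]
  show ?thesis unfolding e by (simp add: cscale_cscale)
qed

lemma smooth_torus_character:
  fixes \<xi> :: "int ^ 'n"
  shows "smooth_torus (\<lambda>x. character \<xi> x *\<^sub>C v)"
  unfolding smooth_torus_def
proof (intro conjI allI)
  fix i and x :: "real ^ 'n"
  have "dot (x + axis i 1) \<xi> = dot x \<xi> + of_int (\<xi> $ i)"
    using dot_axis[of 1 i \<xi>] by (simp add: dot_add_left)
  then have "character \<xi> (x + axis i 1) = character \<xi> x * cis (2 * pi * of_int (\<xi> $ i))"
    by (simp add: character_def distrib_left flip: cis_mult)
  then show "character \<xi> (x + axis i 1) *\<^sub>C v = character \<xi> x *\<^sub>C v"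
    by (simp add: cis_multiple_2pi)
next
  fix m show "Ck m (\<lambda>x. character \<xi> x *\<^sub>C v)"
  \<comment> \<open>A partial derivative of a character times a vector is the same character times
    another vector, so letting \<open>v\<close> vary closes the induction.\<close>
  proof (induction m arbitrary: v)
    case 0
    show ?case by (simp add: cscale.continuous_on continuous_on_character continuous_on_const)
  next
    case (Suc m)
    show ?case unfolding Ck.simps
      by (rule exI[of _ "\<lambda>i x. character \<xi> x *\<^sub>C ((2 * pi * of_int (\<xi> $ i) * \<i>) *\<^sub>C v)"])
        (intro conjI allI has_vector_derivative_character Suc.IH)
  qed
qed

section \<open>The torus as a probability space and orthogonality of characters\<close>

lemma space_torus: "space torus = {x :: real ^ 'n. \<forall>i. 0 \<le> x $ i \<and> x $ i < 1}"
  by (simp add: torus_def space_restrict_space)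

lemma unit_cube_measurable [measurable]: "{x :: real ^ 'n. \<forall>i. 0 \<le> x $ i \<and> x $ i < 1} \<in> sets borel"
proof -
  have "{x :: real ^ 'n. \<forall>i. 0 \<le> x $ i \<and> x $ i < 1} =
      (\<Inter>i. {x. 0 \<le> x $ i} \<inter> {x. x $ i < 1})" by auto
  also have "\<dots> \<in> sets borel"
    by (intro sets.countable_INT'' sets.Int borel_closed borel_open closed_Collect_le open_Collect_less continuous_intros) auto
  finally show ?thesis .
qed

lemma measurable_torusI [measurable (raw)]: "f \<in> borel_measurable borel \<Longrightarrow> f \<in> borel_measurable torus"
  unfolding torus_def by (rule measurable_restrict_space1) simp

lemma Basis_vec_eq: "(Basis :: (real ^ 'n) set) = (\<lambda>i. axis i 1) ` UNIV"
  by (auto simp: Basis_vec_def)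

text \<open>The half-open cube is squeezed between the open and the closed unit box, both of volume
  1.\<close>

lemma prob_space_torus: "prob_space (torus :: (real ^ 'n) measure)"
proof
  let ?C = "{x :: real ^ 'n. \<forall>i. 0 \<le> x $ i \<and> x $ i < 1}"
  have eq: "emeasure (torus :: (real ^ 'n) measure) (space torus) = emeasure lborel ?C"
    unfolding space_torus unfolding torus_def by (subst emeasure_restrict_space) auto
  have 1: "box 0 1 \<subseteq> ?C" by (auto simp: box_def Basis_vec_eq inner_axis less_imp_le)
  have 2: "?C \<subseteq> cbox 0 1" by (auto simp: cbox_def Basis_vec_eq inner_axis less_imp_le)
  have "emeasure lborel (box 0 1 :: (real ^ 'n) set) = 1" "emeasure lborel (cbox 0 1 :: (real ^ 'n) set) = 1"
    by (auto simp: emeasure_lborel_box_eq emeasure_lborel_cbox_eq Basis_vec_eq inner_axis intro!: prod.neutral)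
  then show "emeasure (torus :: (real ^ 'n) measure) (space torus) = 1"
    unfolding eq using emeasure_mono[OF 1, of lborel] emeasure_mono[OF 2, of lborel] by simp
qed

interpretation torus: prob_space "torus :: (real ^ 'n) measure"
  by (rule prob_space_torus)

text \<open>Lebesgue measure is the image of a product of lines under the coordinate map, so this is
  Fubini for finite products.\<close>

lemma integral_lborel_prod:
  fixes f :: "'b::euclidean_space \<Rightarrow> real \<Rightarrow> complex"
  assumes f: "\<And>b. b \<in> Basis \<Longrightarrow> integrable lborel (f b)"
  shows "(\<integral>x. (\<Prod>b\<in>Basis. f b (x \<bullet> b)) \<partial>lborel) = (\<Prod>b\<in>Basis. \<integral>t. f b t \<partial>lborel)"
proof -
  interpret product_sigma_finite "\<lambda>_::'b. lborel :: real measure" ..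
  have m [measurable]: "f b \<in> borel_measurable borel" if "b \<in> Basis" for b
    using f[OF that] by simp
  have "(\<integral>x. (\<Prod>b\<in>Basis. f b (x \<bullet> b)) \<partial>lborel) =
      (\<integral>y. (\<Prod>b\<in>Basis. f b ((\<Sum>b\<in>Basis. y b *\<^sub>R b) \<bullet> b)) \<partial>(\<Pi>\<^sub>M b\<in>(Basis::'b set). lborel))"
  proof (subst lborel_eq, rule integral_distr)
    show "(\<lambda>y. \<Sum>b\<in>Basis. y b *\<^sub>R b) \<in> (\<Pi>\<^sub>M b\<in>(Basis::'b set). lborel) \<rightarrow>\<^sub>M borel"
    proof (intro borel_measurable_sum borel_measurable_scaleR borel_measurable_const)
      fix b :: 'b assume "b \<in> Basis"
      from measurable_component_singleton[OF this, of "\<lambda>_. lborel :: real measure"]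
      show "(\<lambda>y. y b) \<in> borel_measurable (\<Pi>\<^sub>M b\<in>(Basis::'b set). (lborel :: real measure))" by simp
    qed
    show "(\<lambda>x. \<Prod>b\<in>Basis. f b (x \<bullet> b)) \<in> borel_measurable borel"
      by (intro borel_measurable_prod measurable_compose[OF _ m]) auto
  qed
  also have "\<dots> = (\<integral>y. (\<Prod>b\<in>Basis. f b (y b)) \<partial>(\<Pi>\<^sub>M b\<in>(Basis::'b set). lborel))"
    by (intro Bochner_Integration.integral_cong prod.cong) simp_all
  also have "\<dots> = (\<Prod>b\<in>Basis. \<integral>t. f b t \<partial>lborel)"
    by (rule product_integral_prod[OF finite_Basis f])
  finally show ?thesis .
qed

lemma integral_cis_period:
  fixes k :: int
  shows "integrable lborel (\<lambda>t. indicator {0..<1} t *\<^sub>R cis (2 * pi * (t * of_int k)))"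
    "(\<integral>t. indicator {0..<1} t *\<^sub>R cis (2 * pi * (t * of_int k)) \<partial>lborel) = (if k = 0 then 1 else 0)"
proof -
  let ?f = "\<lambda>t. cis (2 * pi * (t * of_int k))"
  have cont: "continuous_on A ?f" for A unfolding cis_conv_exp by (intro continuous_intros)
  then have [measurable]: "?f \<in> borel_measurable borel" by (rule borel_measurable_continuous_onI)
  show "integrable lborel (\<lambda>t. indicator {0..<1} t *\<^sub>R ?f t)"
  proof (rule Bochner_Integration.integrable_bound)
    show "integrable lborel (indicator {0..<1::real} :: real \<Rightarrow> real)" by simp
  qed (auto simp: indicator_def)
  \<comment> \<open>Adding the endpoint, a null set, gives a compact interval for the fundamental
    theorem of calculus.\<close>
  have "AE t in lborel. t \<noteq> (1::real)" by (rule AE_lborel_singleton)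
  then have "(\<integral>t. indicator {0..<1} t *\<^sub>R ?f t \<partial>lborel) = (\<integral>t. indicator {0..1} t *\<^sub>R ?f t \<partial>lborel)"
    by (intro integral_cong_AE) (auto elim!: eventually_mono simp: indicator_def)
  also have "\<dots> = (if k = 0 then 1 else 0)"
  proof (cases "k = 0")
    case False
    define F where "F t = ?f t / (2 * pi * of_int k * \<i>)" for t
    have "(\<integral>t. indicator {0..1} t *\<^sub>R ?f t \<partial>lborel) = F 1 - F 0"
    proof (rule integral_FTC_Icc)
      fix t :: real
      have "((\<lambda>t. ?f t) has_vector_derivative (2 * pi * of_int k) *\<^sub>R (\<i> * ?f t)) (at t within {0..1})"
        using has_vector_derivative_cis[of "2 * pi * of_int k" t "{0..1}"] by (simp add: mult_ac)
      then have "(F has_vector_derivative (2 * pi * of_int k) *\<^sub>R (\<i> * ?f t) / (2 * pi * of_int k * \<i>)) (at t within {0..1})"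
        unfolding F_def by (rule has_vector_derivative_divide)
      then show "(F has_vector_derivative ?f t) (at t within {0..1})"
        using False by (simp add: scaleR_conv_of_real)
    qed (auto intro: cont)
    also have "F 1 = F 0" using cis_multiple_2pi[of "of_int k"] by (simp add: F_def)
    finally show ?thesis using False by simp
  qed simp
  finally show "(\<integral>t. indicator {0..<1} t *\<^sub>R ?f t \<partial>lborel) = (if k = 0 then 1 else 0)" .
qed

text \<open>Both the character and the indicator of the cube factor over the coordinates, which
  reduces the claim to dimension one.\<close>

lemma integral_character:
  "(\<integral>x. character \<xi> x \<partial>torus) = (if \<xi> = 0 then 1 else 0)" for \<xi> :: "int ^ 'n"
proof -
  let ?C = "{x :: real ^ 'n. \<forall>i. 0 \<le> x $ i \<and> x $ i < 1}"
  define f :: "real ^ 'n \<Rightarrow> real \<Rightarrow> complex"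
    where "f b t = indicator {0..<1} t *\<^sub>R cis (2 * pi * (t * of_int (\<xi> $ axis_index b)))" for b t
  have inj: "inj (\<lambda>i. axis i (1::real) :: real ^ 'n)" by (auto simp: inj_def axis_eq_axis)
  have cis_sum: "cis (\<Sum>i\<in>I. a i) = (\<Prod>i\<in>I. cis (a i))" for I :: "'n set" and a
    by (induction I rule: infinite_finite_induct) (simp_all add: cis_mult[symmetric])
  have pt: "indicator ?C x *\<^sub>R character \<xi> x = (\<Prod>b\<in>Basis. f b (x \<bullet> b))" for x
  proof -
    have "(\<Prod>b\<in>Basis. f b (x \<bullet> b)) = (\<Prod>i\<in>UNIV. f (axis i 1) (x $ i))"
      unfolding Basis_vec_eq by (subst prod.reindex[OF inj]) (simp add: inner_axis)
    also have "\<dots> = (\<Prod>i\<in>UNIV. indicator {0..<1} (x $ i) * cis (2 * pi * (x $ i * of_int (\<xi> $ i))))"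
      by (simp add: f_def axis_index_axis scaleR_conv_of_real of_real_indicator)
    also have "\<dots> = (\<Prod>i\<in>UNIV. indicator {0..<1} (x $ i)) * character \<xi> x"
      by (simp add: prod.distrib character_def dot_def sum_distrib_left cis_sum)
    also have "(\<Prod>i\<in>UNIV. indicator {0..<1} (x $ i) :: complex) = indicator ?C x"
      by (auto simp: indicator_def)
    finally show ?thesis by (simp add: scaleR_conv_of_real of_real_indicator)
  qed
  have "(\<integral>x. character \<xi> x \<partial>torus) = (\<integral>x. indicator ?C x *\<^sub>R character \<xi> x \<partial>lborel)"
    unfolding torus_def by (rule integral_restrict_space) simp
  also have "\<dots> = (\<Prod>b\<in>Basis. \<integral>t. f b t \<partial>lborel)"
    unfolding pt by (rule integral_lborel_prod) (simp add: f_def[abs_def] integral_cis_period)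
  also have "\<dots> = (\<Prod>i\<in>UNIV. if \<xi> $ i = 0 then 1 else 0)"
    unfolding Basis_vec_eq by (subst prod.reindex[OF inj]) (simp add: f_def[abs_def] axis_index_axis integral_cis_period)
  also have "\<dots> = (if \<xi> = 0 then 1 else 0)" by (auto simp: vec_eq_iff)
  finally show ?thesis .
qed

lemma fourier_character:
  "fourier (\<lambda>x. character \<eta> x *\<^sub>C v) \<xi> = (if \<xi> = \<eta> then v else 0)" for \<eta> :: "int ^ 'n"
proof -
  have "fourier (\<lambda>x. character \<eta> x *\<^sub>C v) \<xi> = (\<integral>x. character (- \<xi> + \<eta>) x *\<^sub>C v \<partial>torus)"
    unfolding fourier_def by (simp only: character_uminus[symmetric] cscale_cscale character_add)
  also have "\<dots> = (\<integral>x. character (- \<xi> + \<eta>) x \<partial>torus) *\<^sub>C v"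
    by (rule integral_bounded_linear[OF cscale.bounded_linear_left])
      (auto intro!: torus.integrable_const_bound[where B = 1])
  also have "\<dots> = (if \<xi> = \<eta> then v else 0)"
    by (auto simp: integral_character cscale.zero_left add_eq_0_iff)
  finally show ?thesis .
qed

text \<open>The Fourier series of the argument has a single term, so the operator exposes the
  symbol. This is the only use of the defining series of \<open>T\<close>; the exceptional null set
  depends on \<open>\<eta>\<close> and \<open>v\<close>.\<close>

lemma pseudo_diff_operator_character:
  assumes "pseudo_diff_operator p \<sigma> T"
  shows "AE x in torus. T (\<lambda>x. character \<eta> x *\<^sub>C v) x = character \<eta> x *\<^sub>C blinfun_apply (\<sigma> x \<eta>) v"
proof -
  have "AE x in torus. ((\<lambda>\<xi>. cis (2 * pi * dot x \<xi>) *\<^sub>C blinfun_apply (\<sigma> x \<xi>)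
      (fourier (\<lambda>x. character \<eta> x *\<^sub>C v) \<xi>)) has_sum T (\<lambda>x. character \<eta> x *\<^sub>C v) x) UNIV"
    using assms smooth_torus_character by (auto simp: pseudo_diff_operator_def)
  then show ?thesis
  proof eventually_elim
    case (elim x)
    have "((\<lambda>\<xi>. cis (2 * pi * dot x \<xi>) *\<^sub>C blinfun_apply (\<sigma> x \<xi>)
      (fourier (\<lambda>x. character \<eta> x *\<^sub>C v) \<xi>)) has_sum character \<eta> x *\<^sub>C blinfun_apply (\<sigma> x \<eta>) v) {\<eta>}"
      by (rule has_sum_finiteI) (simp_all add: fourier_character, simp add: character_def)
    also have "?this \<longleftrightarrow> ((\<lambda>\<xi>. cis (2 * pi * dot x \<xi>) *\<^sub>C blinfun_apply (\<sigma> x \<xi>)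
      (fourier (\<lambda>x. character \<eta> x *\<^sub>C v) \<xi>)) has_sum character \<eta> x *\<^sub>C blinfun_apply (\<sigma> x \<eta>) v) UNIV"
      by (rule has_sum_cong_neutral) (auto simp: fourier_character cscale.zero_right blinfun.zero_right)
    finally show ?case using elim has_sum_unique by blast
  qed
qed

section \<open>Completeness of Bochner spaces\<close>

text \<open>The L^q norm dominates the L^1 norm, so by monotone convergence the sum of the pointwise
  norms has a finite integral.\<close>

lemma (in prob_space) Lp_summable_AE:
  fixes h :: "nat \<Rightarrow> 'a \<Rightarrow> 'b::{banach, second_countable_topology}"
  assumes q: "1 \<le> q" and h: "\<And>k. h k \<in> Lp (ennreal q) M"
    and sm: "summable (\<lambda>k. Lp_norm (ennreal q) M (h k))"
  shows "AE x in M. summable (\<lambda>k. norm (h k x))"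
proof -
  note [measurable] = h
  have "(\<integral>\<^sup>+x. (\<Sum>k. ennreal (norm (h k x))) \<partial>M) = (\<Sum>k. \<integral>\<^sup>+x. ennreal (norm (h k x)) \<partial>M)"
    by (rule nn_integral_suminf) measurable
  also have "\<dots> \<le> (\<Sum>k. ennreal (Lp_norm (ennreal q) M (h k)))"
  proof (intro suminf_le allI)
    fix k
    show "(\<integral>\<^sup>+x. ennreal (norm (h k x)) \<partial>M) \<le> ennreal (Lp_norm (ennreal q) M (h k))"
      using Lp_integrable[OF q h[of k]] by (subst nn_integral_eq_integral) (auto intro: ennreal_leI)
  qed auto
  also have "\<dots> < \<infinity>" using sm by (subst suminf_ennreal2) auto
  finally have "AE x in M. (\<Sum>k. ennreal (norm (h k x))) \<noteq> \<infinity>"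
    by (intro nn_integral_PInf_AE) auto
  then show ?thesis by eventually_elim (auto intro: summable_suminf_not_top)
qed

text \<open>Each tail is an almost everywhere limit of finite sums, so Fatou bounds it by the tail
  of the norms; the tail from 0 gives membership. Points where the pointwise series diverges form a
  null set.\<close>

lemma (in prob_space) Lp_series:
  fixes h :: "nat \<Rightarrow> 'a \<Rightarrow> 'b::{banach, second_countable_topology}"
  assumes q: "1 \<le> q" and h: "\<And>k. h k \<in> Lp (ennreal q) M"
    and sm: "summable (\<lambda>k. Lp_norm (ennreal q) M (h k))"
  shows "(\<lambda>x. \<Sum>k. h k x) \<in> Lp (ennreal q) M"
    "(\<lambda>N. Lp_norm (ennreal q) M (\<lambda>x. (\<Sum>k. h k x) - (\<Sum>k<N. h k x))) \<longlonglongrightarrow> 0"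
proof -
  note [measurable] = h
  have AE: "AE x in M. summable (\<lambda>k. h k x)"
    using Lp_summable_AE[OF q h sm] by eventually_elim (rule summable_norm_cancel)
  let ?B = "\<lambda>N. \<Sum>k. Lp_norm (ennreal q) M (h (k + N))"
  have tail: "(\<lambda>x. (\<Sum>k. h k x) - (\<Sum>k<N. h k x)) \<in> Lp (ennreal q) M \<and>
    Lp_norm (ennreal q) M (\<lambda>x. (\<Sum>k. h k x) - (\<Sum>k<N. h k x)) \<le> ?B N" for N
  proof -
    let ?F = "\<lambda>m x. \<Sum>k<m. h (k + N) x"
    have F: "?F m \<in> Lp (ennreal q) M" for m using Lp_sum[OF q, of "{..<m}" "\<lambda>k. h (k + N)"] h by simp
    have "Lp_norm (ennreal q) M (?F m) \<le> ?B N" for m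
    proof -
      have "Lp_norm (ennreal q) M (?F m) \<le> (\<Sum>k<m. Lp_norm (ennreal q) M (h (k + N)))"
        using Lp_sum[OF q, of "{..<m}" "\<lambda>k. h (k + N)"] h by simp
      also have "\<dots> \<le> ?B N" by (intro sum_le_suminf summable_ignore_initial_segment sm) auto
      finally show ?thesis .
    qed
    moreover have "AE x in M. (\<lambda>m. ?F m x) \<longlonglongrightarrow> (\<Sum>k. h k x) - (\<Sum>k<N. h k x)"
      using AE
    proof eventually_elim
      case (elim x)
      then have "(\<lambda>k. h (k + N) x) sums ((\<Sum>k. h k x) - (\<Sum>k<N. h k x))"
        by (intro sums_split_initial_segment summable_sums)
      then show ?case by (simp add: sums_def)
    qed
    ultimately show ?thesis
      using Lp_Fatou[OF q F, where B = "?B N" and f = "\<lambda>x. (\<Sum>k. h k x) - (\<Sum>k<N. h k x)"] by simp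
  qed
  show "(\<lambda>x. \<Sum>k. h k x) \<in> Lp (ennreal q) M" using tail[of 0] by simp
  have "?B \<longlonglongrightarrow> 0"
  proof -
    have "(\<lambda>N. (\<Sum>k. Lp_norm (ennreal q) M (h k)) - (\<Sum>k<N. Lp_norm (ennreal q) M (h k))) \<longlonglongrightarrow>
        (\<Sum>k. Lp_norm (ennreal q) M (h k)) - (\<Sum>k. Lp_norm (ennreal q) M (h k))"
      by (intro tendsto_diff tendsto_const summable_LIMSEQ sm)
    then show ?thesis by (simp add: suminf_minus_initial_segment[OF sm])
  qed
  then show "(\<lambda>N. Lp_norm (ennreal q) M (\<lambda>x. (\<Sum>k. h k x) - (\<Sum>k<N. h k x))) \<longlonglongrightarrow> 0"
    by (rule tendsto_sandwich[OF _ _ tendsto_const, rotated 2]) (use tail in auto)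
qed

text \<open>The differences form a summable telescoping series. The minimising sequence of the
  duality argument is chosen to satisfy exactly this rate.\<close>

lemma (in prob_space) Lp_fast_Cauchy:
  fixes F :: "nat \<Rightarrow> 'a \<Rightarrow> 'b::{banach, second_countable_topology}"
  assumes q: "1 \<le> q" and F: "\<And>n. F n \<in> Lp (ennreal q) M"
    and C: "\<And>n. Lp_norm (ennreal q) M (\<lambda>x. F (Suc n) x - F n x) \<le> (1 / 2) ^ n"
  obtains f where "f \<in> Lp (ennreal q) M"
    "(\<lambda>n. Lp_norm (ennreal q) M (\<lambda>x. f x - F n x)) \<longlonglongrightarrow> 0"
proof -
  define h where "h n x = F (Suc n) x - F n x" for n x
  have h: "h n \<in> Lp (ennreal q) M" for n unfolding h_def by (intro Lp_diff q F)
  have sm: "summable (\<lambda>n. Lp_norm (ennreal q) M (h n))"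
    by (rule summable_comparison_test'[OF summable_geometric[of "1 / 2 :: real"], of 0])
      (use C in \<open>auto simp: h_def[abs_def]\<close>)
  have e: "(\<Sum>k. h k x) - (\<Sum>k<n. h k x) = (F 0 x + (\<Sum>k. h k x)) - F n x" for n x
    unfolding h_def by (simp add: sum_lessThan_telescope[of "\<lambda>k. F k x"])
  show thesis
  proof (rule that)
    show "(\<lambda>x. F 0 x + (\<Sum>k. h k x)) \<in> Lp (ennreal q) M" by (intro Lp_add q F Lp_series h sm)
    show "(\<lambda>n. Lp_norm (ennreal q) M (\<lambda>x. (F 0 x + (\<Sum>k. h k x)) - F n x)) \<longlonglongrightarrow> 0"
      using Lp_series(2)[OF q h sm] by (simp add: e)
  qed
qed

section \<open>Duality\<close>

text \<open>By convexity of the power, its graph lies above the tangent at \<open>y\<close>. With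
  squared norms for \<open>x\<close> and \<open>y\<close> it replaces the differentiation of a norm
  power in the variational argument.\<close>

lemma power_diff_le_tangent:
  fixes x y :: real
  assumes "0 \<le> x" "0 \<le> y"
  shows "y ^ r - x ^ r \<le> r * y ^ (r - 1) * (y - x)"
proof (induction r)
  case (Suc r)
  have "y ^ Suc r - x ^ Suc r = y * (y ^ r - x ^ r) + x ^ r * (y - x)" by (simp add: algebra_simps)
  also have "\<dots> \<le> y * (r * y ^ (r - 1) * (y - x)) + y ^ r * (y - x)"
  proof (intro add_mono mult_left_mono Suc.IH assms)
    show "x ^ r * (y - x) \<le> y ^ r * (y - x)"
    proof (cases "x \<le> y")
      case True
      then show ?thesis using assms by (intro mult_right_mono power_mono) auto
    next
      case False
      then show ?thesis using assms by (intro mult_right_mono_neg power_mono) auto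
    qed
  qed
  also have "\<dots> = Suc r * y ^ (Suc r - 1) * (y - x)"
    by (cases r) (simp_all add: algebra_simps)
  finally show ?case .
qed simp

lemma power_midpoint_le:
  fixes x y :: real
  assumes "0 \<le> x" "0 \<le> y"
  shows "((x + y) / 2) ^ r \<le> (x ^ r + y ^ r) / 2"
proof -
  let ?m = "(x + y) / 2"
  \<comment> \<open>add the tangent inequalities at the midpoint\<close>
  have t: "u ^ r - m ^ r \<ge> r * m ^ (r - 1) * (u - m)" if "0 \<le> u" "0 \<le> m" for u m :: real
    using power_diff_le_tangent[of u m r] that by (simp add: algebra_simps)
  have "0 = r * ?m ^ (r - 1) * (x - ?m) + r * ?m ^ (r - 1) * (y - ?m)"
    by (simp add: field_simps)
  also have "\<dots> \<le> (x ^ r - ?m ^ r) + (y ^ r - ?m ^ r)" using t assms by (intro add_mono) auto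
  finally show ?thesis by simp
qed

lemma power_add_superadditive:
  fixes x y :: real
  assumes "0 \<le> x" "0 \<le> y" "0 < r"
  shows "x ^ r + y ^ r \<le> (x + y) ^ r"
  using assms(3)
proof (induction r rule: nat_induct_non_zero)
  case (Suc r)
  have "x ^ Suc r + y ^ Suc r \<le> (x + y) * (x ^ r + y ^ r)" using assms by (simp add: algebra_simps)
  also have "\<dots> \<le> (x + y) * (x + y) ^ r" using Suc.IH assms by (intro mult_left_mono) auto
  finally show ?case by simp
qed simp

text \<open>The parallelogram law evaluates the sum of the two squared norms; superadditivity and
  midpoint convexity of t^r then carry it to the power \<open>r\<close>.\<close>

lemma Clarkson_even:
  fixes a b :: "'a::real_inner"
  assumes "0 < r"
  shows "norm ((1/2) *\<^sub>R (a + b)) ^ (2 * r) + norm ((1/2) *\<^sub>R (a - b)) ^ (2 * r)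
    \<le> (norm a ^ (2 * r) + norm b ^ (2 * r)) / 2"
proof -
  let ?X = "(norm ((1/2) *\<^sub>R (a + b)))\<^sup>2" and ?Y = "(norm ((1/2) *\<^sub>R (a - b)))\<^sup>2"
  have e: "?X + ?Y = ((norm a)\<^sup>2 + (norm b)\<^sup>2) / 2"
    unfolding power2_norm_eq_inner by (simp add: inner_add inner_diff inner_commute field_simps)
  have s: "?X ^ r + ?Y ^ r \<le> (?X + ?Y) ^ r" using assms by (intro power_add_superadditive) auto
  have m: "(((norm a)\<^sup>2 + (norm b)\<^sup>2) / 2) ^ r \<le> (((norm a)\<^sup>2) ^ r + ((norm b)\<^sup>2) ^ r) / 2"
    by (rule power_midpoint_le) auto
  show ?thesis unfolding power_mult by (rule order_trans[OF s[unfolded e] m])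
qed

lemma powr_even:
  assumes "0 < r" "0 \<le> (x::real)"
  shows "x powr (2 * real r) = x ^ (2 * r)"
  using assms powr_realpow[of x "2 * r"] by (cases "x = 0") auto

text \<open>
  For an even exponent \<open>2 r\<close> the functional \<open>f \<mapsto> \<parallel>f\<parallel>\<^sup>2\<^sup>r / (2 r) - \<Phi> f\<close> attains its minimum, as
  minimising sequences are Cauchy by Clarkson's inequality; the Euler-Lagrange equation of a
  minimiser represents \<open>\<Phi>\<close>. This avoids the Radon-Nikodym theorem for vector measures.
\<close>

lemma (in prob_space) Lp_even_representation:
  fixes \<Phi> :: "('a \<Rightarrow> 'b::{banach, second_countable_topology, real_inner}) \<Rightarrow> real"
  assumes r: "0 < r" and Edef: "E = ennreal (2 * real r)"
    and add: "\<And>f g. f \<in> Lp E M \<Longrightarrow> g \<in> Lp E M \<Longrightarrow> \<Phi> (\<lambda>x. f x + g x) = \<Phi> f + \<Phi> g"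
    and scale: "\<And>c f. f \<in> Lp E M \<Longrightarrow> \<Phi> (\<lambda>x. c *\<^sub>R f x) = c * \<Phi> f"
    and bound: "\<And>f. f \<in> Lp E M \<Longrightarrow> \<bar>\<Phi> f\<bar> \<le> C * Lp_norm E M f"
  shows "\<exists>u\<in>Lp E M. \<forall>w\<in>Lp E M.
    integrable M (\<lambda>x. (norm (u x)) ^ (2 * (r - 1)) * inner (u x) (w x)) \<and>
    \<Phi> w = (\<integral>x. (norm (u x)) ^ (2 * (r - 1)) * inner (u x) (w x) \<partial>M)"
proof -
  define n where "n = 2 * r"
  have n0: "0 < n" using r by (simp add: n_def)
  have q: "1 \<le> 2 * real r" using r by simp
  have pw: "norm x powr (2 * real r) = norm x ^ n" for x :: "'z::real_normed_vector"
    using powr_even[OF r, of "norm x"] by (simp add: n_def)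
  define N where "N f = (\<integral>x. norm (f x) ^ n \<partial>M)" for f :: "'a \<Rightarrow> 'b"
  have int: "integrable M (\<lambda>x. norm (f x) ^ n)" if "f \<in> Lp E M" for f :: "'a \<Rightarrow> 'z::{banach, second_countable_topology}"
    using that unfolding Edef Lp_iff[OF q] pw by simp
  have nn: "0 \<le> Lp_norm E M f" for f :: "'a \<Rightarrow> 'b" by (simp add: Edef)
  have N: "N f = Lp_norm E M f ^ n" for f
    using Lp_norm_powr[OF q, of M f] powr_even[OF r nn[of f]] unfolding Edef pw N_def n_def by simp
  have scaleR: "(\<lambda>x. c *\<^sub>R f x) \<in> Lp E M" if "f \<in> Lp E M" for f :: "'a \<Rightarrow> 'b" and c
    using Lp_scale(1)[OF q, of f M "\<lambda>x. c *\<^sub>R f x" "\<bar>c\<bar>"] that by (simp add: Edef Lp_measurable)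
  define J where "J f = N f / n - \<Phi> f" for f
  \<comment> \<open>A norm t > \<open>K\<close> satisfies t >= 1 and t >= n |C|, hence t^n / n >=
    t^2 / n >= |C| t; up to \<open>K\<close> the linear term is at most
    \<open>\<bar>C\<bar> * K\<close>. So the functional is bounded below.\<close>
  define K where "K = 1 + n * \<bar>C\<bar>"
  have lower: "- \<bar>C\<bar> * K \<le> J f" if f: "f \<in> Lp E M" for f
  proof -
    define t where "t = Lp_norm E M f"
    have t: "0 \<le> t" by (simp add: t_def nn)
    have "\<Phi> f \<le> \<bar>C\<bar> * t"
      using bound[OF f] mult_right_mono[OF abs_ge_self[of C] t] by (simp add: t_def)
    then have J: "t ^ n / n - \<bar>C\<bar> * t \<le> J f" by (simp add: J_def N t_def)
    show ?thesis
    proof (cases "t \<le> K")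
      case True
      then have "\<bar>C\<bar> * t \<le> \<bar>C\<bar> * K" by (intro mult_left_mono) auto
      moreover have "0 \<le> t ^ n / n" using t by simp
      ultimately show ?thesis using J by linarith
    next
      case False
      then have t1: "1 \<le> t" "n * \<bar>C\<bar> \<le> t" by (auto simp: K_def intro: order_trans[of _ "1 + n * \<bar>C\<bar>"])
      have "n * \<bar>C\<bar> * t \<le> t * t" using t1 by (intro mult_right_mono) auto
      also have "\<dots> = t ^ 2" by (simp add: power2_eq_square)
      also have "\<dots> \<le> t ^ n" using t1 r by (intro power_increasing) (auto simp: n_def)
      finally have "\<bar>C\<bar> * t \<le> t ^ n / n" using n0 by (simp add: field_simps)
      moreover have "- \<bar>C\<bar> * K \<le> 0" by (simp add: K_def)
      ultimately show ?thesis using J by linarith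
    qed
  qed
  define I where "I = (INF f\<in>Lp E M. J f)"
  have bdd: "bdd_below (J ` Lp E M)" using lower by (auto intro!: bdd_belowI2)
  have ne: "Lp E M \<noteq> ({} :: ('a \<Rightarrow> 'b) set)" using Lp_zero[OF q] unfolding Edef by blast
  have Ile: "I \<le> J f" if "f \<in> Lp E M" for f unfolding I_def by (rule cINF_lower[OF bdd that])
  have near: "\<exists>f\<in>Lp E M. J f < I + e" if "0 < e" for e
    using that cINF_less_iff[OF ne bdd, of "I + e"] by (simp add: I_def)
  \<comment> \<open>Chosen so that \<open>2 ^ n * (n * e k) = ((1 / 2) ^ k) ^ n\<close>, which turns
    the estimate for differences of near-minimisers into the rate needed by
    \<open>Lp_fast_Cauchy\<close>.\<close>
  define e where "e k = (1 / 2) ^ (k * n) / (n * 2 ^ n)" for k :: nat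
  have e0: "0 < e k" for k using n0 by (simp add: e_def)
  have "\<forall>k. \<exists>f. f \<in> Lp E M \<and> J f < I + e k" using near[OF e0] by blast
  then obtain F where F: "\<And>k. F k \<in> Lp E M" and FJ: "\<And>k. J (F k) < I + e k" by metis
  \<comment> \<open>The midpoint of \<open>f\<close> and \<open>g\<close> is a competitor, so
    \<open>J\<close> is at least \<open>I\<close> there; the slack in Clarkson's inequality then
    controls the half difference. The factor \<open>2 ^ n\<close> undoes the halving.\<close>
  have Cl: "N (\<lambda>x. f x - g x) \<le> 2 ^ n * (n * ((J f + J g) / 2 - I))" if f: "f \<in> Lp E M" and g: "g \<in> Lp E M" for f g
  proof -
    have m: "(\<lambda>x. (1/2) *\<^sub>R (f x + g x)) \<in> Lp E M"
      using Lp_add(1)[OF q, of f M g] f g by (intro scaleR) (simp add: Edef)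
    have d: "(\<lambda>x. (1/2) *\<^sub>R (f x - g x)) \<in> Lp E M"
      using Lp_diff(1)[OF q, of f M g] f g by (intro scaleR) (simp add: Edef)
    have "N (\<lambda>x. (1/2) *\<^sub>R (f x + g x)) + N (\<lambda>x. (1/2) *\<^sub>R (f x - g x)) =
        (\<integral>x. norm ((1/2) *\<^sub>R (f x + g x)) ^ n + norm ((1/2) *\<^sub>R (f x - g x)) ^ n \<partial>M)"
      unfolding N_def by (rule Bochner_Integration.integral_add[symmetric]) (intro int m d)+
    also have "\<dots> \<le> (\<integral>x. (norm (f x) ^ n + norm (g x) ^ n) / 2 \<partial>M)"
      using Clarkson_even[OF r] unfolding n_def[symmetric]
      by (intro integral_mono Bochner_Integration.integrable_add integrable_divide int m d f g) simp
    also have "\<dots> = (N f + N g) / 2" unfolding N_def using int[OF f] int[OF g] by simp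
    finally have cl: "N (\<lambda>x. (1/2) *\<^sub>R (f x + g x)) + N (\<lambda>x. (1/2) *\<^sub>R (f x - g x)) \<le> (N f + N g) / 2" .
    have P: "\<Phi> (\<lambda>x. (1/2) *\<^sub>R (f x + g x)) = (\<Phi> f + \<Phi> g) / 2"
      using scale[of "\<lambda>x. f x + g x" "1/2"] add[OF f g] Lp_add(1)[OF q, of f M g] f g by (simp add: Edef)
    have "I \<le> N (\<lambda>x. (1/2) *\<^sub>R (f x + g x)) / n - (\<Phi> f + \<Phi> g) / 2"
      using Ile[OF m] unfolding J_def P .
    also have "\<dots> \<le> ((N f + N g) / 2 - N (\<lambda>x. (1/2) *\<^sub>R (f x - g x))) / n - (\<Phi> f + \<Phi> g) / 2"
      using cl by (intro diff_right_mono divide_right_mono) (linarith, simp)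
    also have "\<dots> = (J f + J g) / 2 - N (\<lambda>x. (1/2) *\<^sub>R (f x - g x)) / n"
      by (simp add: J_def diff_divide_distrib add_divide_distrib)
    finally have "N (\<lambda>x. (1/2) *\<^sub>R (f x - g x)) \<le> n * ((J f + J g) / 2 - I)"
      using n0 by (simp add: field_simps)
    then have "2 ^ n * N (\<lambda>x. (1/2) *\<^sub>R (f x - g x)) \<le> 2 ^ n * (n * ((J f + J g) / 2 - I))"
      by (intro mult_left_mono) auto
    moreover have "N (\<lambda>x. f x - g x) = 2 ^ n * N (\<lambda>x. (1/2) *\<^sub>R (f x - g x))"
      unfolding N_def norm_scaleR power_mult_distrib by (simp add: power_one_over)
    ultimately show ?thesis by (simp only:)
  qed
  have Cauchy: "Lp_norm E M (\<lambda>x. F (Suc k) x - F k x) \<le> (1 / 2) ^ k" for k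
  proof (rule power_le_imp_le_base)
    have "e (Suc k) \<le> e k" unfolding e_def using n0
      by (intro divide_right_mono power_decreasing) auto
    then have "(J (F (Suc k)) + J (F k)) / 2 - I \<le> e k"
      using FJ[of k] FJ[of "Suc k"] by (simp add: field_simps)
    then have "2 ^ n * (n * ((J (F (Suc k)) + J (F k)) / 2 - I)) \<le> 2 ^ n * (n * e k)"
      by (intro mult_left_mono) auto
    also have "\<dots> = ((1 / 2) ^ k) ^ n" using n0 by (simp add: e_def power_mult)
    finally have "N (\<lambda>x. F (Suc k) x - F k x) \<le> ((1 / 2) ^ k) ^ n" using Cl[OF F F] by (meson order_trans)
    then show "Lp_norm E M (\<lambda>x. F (Suc k) x - F k x) ^ Suc (n - 1) \<le> ((1 / 2) ^ k) ^ Suc (n - 1)"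
      using n0 by (simp add: N)
  qed simp
  obtain u where u: "u \<in> Lp E M" and lim: "(\<lambda>k. Lp_norm E M (\<lambda>x. u x - F k x)) \<longlonglongrightarrow> 0"
    using Lp_fast_Cauchy[OF q, of F] F Cauchy unfolding Edef by blast
  \<comment> \<open>Both the functional and the norm are continuous along the convergent sequence,
    so the infimum is attained at its limit.\<close>
  have "J u \<le> I"
  proof -
    have "(\<lambda>k. \<Phi> (F k) - \<Phi> u) \<longlonglongrightarrow> 0"
    proof (rule Lim_null_comparison)
      show "(\<lambda>k. \<bar>C\<bar> * Lp_norm E M (\<lambda>x. u x - F k x)) \<longlonglongrightarrow> 0"
        using tendsto_mult_right_zero[OF lim] by simp
      have "norm (\<Phi> (F k) - \<Phi> u) \<le> \<bar>C\<bar> * Lp_norm E M (\<lambda>x. u x - F k x)" for k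
      proof -
        have d: "(\<lambda>x. u x - F k x) \<in> Lp E M" using Lp_diff(1)[OF q] u F unfolding Edef by blast
        have "\<Phi> u = \<Phi> (F k) + \<Phi> (\<lambda>x. u x - F k x)" using add[OF F[of k] d] by simp
        then show ?thesis
          using bound[OF d] mult_right_mono[OF abs_ge_self[of C] nn[of "\<lambda>x. u x - F k x"]] by simp
      qed
      then show "\<forall>\<^sub>F k in sequentially. norm (\<Phi> (F k) - \<Phi> u) \<le> \<bar>C\<bar> * Lp_norm E M (\<lambda>x. u x - F k x)" by simp
    qed
    then have P: "(\<lambda>k. \<Phi> (F k)) \<longlonglongrightarrow> \<Phi> u" by (simp add: LIM_zero_iff)
    have "(\<lambda>k. Lp_norm E M (F k) - Lp_norm E M u) \<longlonglongrightarrow> 0"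
    proof (rule Lim_null_comparison[OF always_eventually lim], intro allI)
      fix k
      have d: "(\<lambda>x. u x - F k x) \<in> Lp E M" "(\<lambda>x. F k x - u x) \<in> Lp E M"
        using Lp_diff(1)[OF q] u F unfolding Edef by blast+
      have "Lp_norm E M u \<le> Lp_norm E M (F k) + Lp_norm E M (\<lambda>x. u x - F k x)"
        using Lp_add(2)[OF q F[of k, unfolded Edef] d(1)[unfolded Edef]] by (simp add: Edef)
      moreover have "Lp_norm E M (F k) \<le> Lp_norm E M u + Lp_norm E M (\<lambda>x. F k x - u x)"
        using Lp_add(2)[OF q u[unfolded Edef] d(2)[unfolded Edef]] by (simp add: Edef)
      moreover have "Lp_norm E M (\<lambda>x. F k x - u x) = Lp_norm E M (\<lambda>x. u x - F k x)"
        unfolding Edef by (rule Lp_norm_minus_commute)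
      ultimately show "norm (Lp_norm E M (F k) - Lp_norm E M u) \<le> Lp_norm E M (\<lambda>x. u x - F k x)" by simp
    qed
    then have "(\<lambda>k. Lp_norm E M (F k)) \<longlonglongrightarrow> Lp_norm E M u" by (simp add: LIM_zero_iff)
    then have "(\<lambda>k. J (F k)) \<longlonglongrightarrow> J u" unfolding J_def N using n0 by (intro tendsto_intros P) auto
    moreover have "(\<lambda>k. I + e k) \<longlonglongrightarrow> I + 0"
    proof (intro tendsto_add tendsto_const)
      have "e = (\<lambda>k. ((1 / 2) ^ n) ^ k / (n * 2 ^ n))"
        by (simp add: e_def power_mult[symmetric] mult.commute fun_eq_iff)
      moreover have "(\<lambda>k. ((1 / 2 :: real) ^ n) ^ k / (n * 2 ^ n)) \<longlonglongrightarrow> 0 / (n * 2 ^ n)"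
        using n0 by (intro tendsto_divide tendsto_const LIMSEQ_power_zero) (auto simp: power_less_one_iff)
      ultimately show "e \<longlonglongrightarrow> 0" by simp
    qed
    ultimately have "J u \<le> I + 0" by (rule LIMSEQ_le) (use FJ less_imp_le in blast)
    then show ?thesis by simp
  qed
  then have min: "J u \<le> J f" if "f \<in> Lp E M" for f using Ile[OF that] by simp
  note [measurable] = u[THEN Lp_measurable]
  \<comment> \<open>Variations with positive \<open>s\<close> give one inequality only; applying it
    to the negative of \<open>w\<close> gives the other.\<close>
  have key: "integrable M (\<lambda>x. (norm (u x)) ^ (2 * (r - 1)) * inner (u x) (w x)) \<and>
    \<Phi> w \<le> (\<integral>x. (norm (u x)) ^ (2 * (r - 1)) * inner (u x) (w x) \<partial>M)" if w: "w \<in> Lp E M" for w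
  proof -
    note [measurable] = w[THEN Lp_measurable]
    define t where "t k = inverse (real (Suc k))" for k
    have t: "0 < t k" "t k \<le> 1" for k by (auto simp: t_def field_simps)
    \<comment> \<open>By the tangent inequality for powers of squared norms,
      \<open>n * s * D s x\<close> bounds the increase of the norm power from \<open>u x\<close> to
      \<open>u x + s *\<^sub>R w x\<close>. \<open>D 0\<close> is the Euler-Lagrange integrand, and
      \<open>G\<close> dominates \<open>D s\<close> for all \<open>s\<close> in [0, 1], so
      \<open>s\<close> may tend to 0 under the integral.\<close>
    define D where "D s x = (norm (u x + s *\<^sub>R w x)) ^ (2 * (r - 1)) * (inner (u x) (w x) + s * (norm (w x))\<^sup>2 / 2)" for s x
    define G where "G x = (norm (u x) + norm (w x)) ^ n" for x
    have [measurable]: "D s \<in> borel_measurable M" for s unfolding D_def by measurable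
    have "(\<lambda>x. norm (u x) + norm (w x)) \<in> Lp E M"
      using Lp_add(1)[OF q, of "\<lambda>x. norm (u x)" M "\<lambda>x. norm (w x)"]
        Lp_norm_cong(1)[OF q, of u M "\<lambda>x. norm (u x)"] Lp_norm_cong(1)[OF q, of w M "\<lambda>x. norm (w x)"] u w
      by (simp add: Edef)
    from int[OF this] have iG: "integrable M G" by (simp add: G_def[abs_def])
    have DG: "norm (D s x) \<le> G x" if "0 \<le> s" "s \<le> 1" for s x
    proof -
      let ?S = "norm (u x) + norm (w x)"
      have sw: "norm (s *\<^sub>R w x) \<le> norm (w x)" using that by (simp add: mult_left_le_one_le)
      have "norm (u x + s *\<^sub>R w x) \<le> ?S"
        using norm_triangle_ineq[of "u x" "s *\<^sub>R w x"] sw by simp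
      then have 1: "norm (u x + s *\<^sub>R w x) ^ (2 * (r - 1)) \<le> ?S ^ (2 * (r - 1))" by (intro power_mono) auto
      have "\<bar>inner (u x) (w x) + s * (norm (w x))\<^sup>2 / 2\<bar> \<le> \<bar>inner (u x) (w x)\<bar> + s * (norm (w x))\<^sup>2 / 2"
        using that by (intro order_trans[OF abs_triangle_ineq]) simp
      also have "\<dots> \<le> norm (u x) * norm (w x) + (norm (w x))\<^sup>2"
      proof (rule add_mono[OF Cauchy_Schwarz_ineq2])
        have "s * (norm (w x))\<^sup>2 \<le> 1 * (norm (w x))\<^sup>2" using that by (intro mult_right_mono) auto
        then show "s * (norm (w x))\<^sup>2 / 2 \<le> (norm (w x))\<^sup>2" using zero_le_power2[of "norm (w x)"] by linarith
      qed
      also have "\<dots> \<le> ?S\<^sup>2" by (simp add: power2_sum)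
      finally have 2: "\<bar>inner (u x) (w x) + s * (norm (w x))\<^sup>2 / 2\<bar> \<le> ?S\<^sup>2" .
      have "norm (D s x) \<le> ?S ^ (2 * (r - 1)) * ?S\<^sup>2"
        unfolding D_def using mult_mono[OF 1 2] by (simp add: abs_mult)
      also have "\<dots> = G x"
      proof -
        have "2 * (r - 1) + 2 = n" using r by (simp add: n_def)
        then show ?thesis unfolding G_def power_add[symmetric] by simp
      qed
      finally show ?thesis .
    qed
    have iD: "integrable M (D s)" if "0 \<le> s" "s \<le> 1" for s
      by (rule Bochner_Integration.integrable_bound[OF iG]) (use DG[OF that] order_trans[OF _ abs_ge_self] in auto)
    have DL: "(\<lambda>k. \<integral>x. D (t k) x \<partial>M) \<longlonglongrightarrow> (\<integral>x. D 0 x \<partial>M)"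
    proof (rule integral_dominated_convergence[OF _ _ iG])
      have "(\<lambda>k. D (t k) x) \<longlonglongrightarrow> D 0 x" for x
      proof -
        have "t \<longlonglongrightarrow> 0" unfolding t_def[abs_def] by (rule LIMSEQ_inverse_real_of_nat)
        then show ?thesis unfolding D_def by (intro tendsto_intros) auto
      qed
      then show "AE x in M. (\<lambda>k. D (t k) x) \<longlonglongrightarrow> D 0 x" by simp
      show "AE x in M. norm (D (t k) x) \<le> G x" for k using DG[of "t k"] t[of k] by simp
    qed measurable
    have DP: "\<Phi> w \<le> (\<integral>x. D (t k) x \<partial>M)" for k
    proof -
      define s where "s = t k"
      have s: "0 < s" "s \<le> 1" using t[of k] by (auto simp: s_def)
      have sw: "(\<lambda>x. s *\<^sub>R w x) \<in> Lp E M" by (rule scaleR[OF w])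
      have us: "(\<lambda>x. u x + s *\<^sub>R w x) \<in> Lp E M" using Lp_add(1)[OF q] u sw unfolding Edef by blast
      have "J u \<le> J (\<lambda>x. u x + s *\<^sub>R w x)" by (rule min[OF us])
      then have "s * \<Phi> w \<le> (N (\<lambda>x. u x + s *\<^sub>R w x) - N u) / n"
        by (simp add: J_def add[OF u sw] scale[OF w] diff_divide_distrib)
      also have "N (\<lambda>x. u x + s *\<^sub>R w x) - N u = (\<integral>x. norm (u x + s *\<^sub>R w x) ^ n - norm (u x) ^ n \<partial>M)"
        unfolding N_def by (rule Bochner_Integration.integral_diff[symmetric]) (intro int us u)+
      also have "\<dots> \<le> (\<integral>x. (n * s) * D s x \<partial>M)"
      proof (rule integral_mono)
        show "integrable M (\<lambda>x. norm (u x + s *\<^sub>R w x) ^ n - norm (u x) ^ n)"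
          by (intro Bochner_Integration.integrable_diff int us u)
        show "integrable M (\<lambda>x. (n * s) * D s x)" using s by (intro integrable_mult_right iD) auto
        fix x
        let ?y = "(norm (u x + s *\<^sub>R w x))\<^sup>2" and ?x = "(norm (u x))\<^sup>2"
        have "?y - ?x = 2 * s * (inner (u x) (w x) + s * (norm (w x))\<^sup>2 / 2)"
          unfolding power2_norm_eq_inner by (simp add: inner_add inner_commute algebra_simps)
        then have "?y ^ r - ?x ^ r \<le> r * ?y ^ (r - 1) * (2 * s * (inner (u x) (w x) + s * (norm (w x))\<^sup>2 / 2))"
          using power_diff_le_tangent[of ?x ?y r] by simp
        also have "\<dots> = real (2 * r) * s * (?y ^ (r - 1) * (inner (u x) (w x) + s * (norm (w x))\<^sup>2 / 2))" by simp
        finally show "norm (u x + s *\<^sub>R w x) ^ n - norm (u x) ^ n \<le> (n * s) * D s x"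
          unfolding D_def n_def power_mult .
      qed
      also have "\<dots> = n * s * (\<integral>x. D s x \<partial>M)" by simp
      finally have "s * \<Phi> w \<le> s * (\<integral>x. D s x \<partial>M)" using n0 by (simp add: divide_right_mono)
      then show ?thesis using s by (simp add: s_def)
    qed
    have "\<Phi> w \<le> (\<integral>x. D 0 x \<partial>M)" by (rule LIMSEQ_le_const[OF DL]) (use DP in blast)
    then show ?thesis using iD[of 0] by (simp add: D_def[abs_def])
  qed
  have "integrable M (\<lambda>x. (norm (u x)) ^ (2 * (r - 1)) * inner (u x) (w x)) \<and>
    \<Phi> w = (\<integral>x. (norm (u x)) ^ (2 * (r - 1)) * inner (u x) (w x) \<partial>M)" if w: "w \<in> Lp E M" for w
    using key[OF w] key[OF scaleR[OF w, of "- 1"]] scale[OF w, of "- 1"] by auto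
  then show ?thesis using u by blast
qed

section \<open>Functionals on Bochner spaces and their densities\<close>

lemma Lp_dual_bound:
  fixes \<phi> :: "('x \<Rightarrow> 'a::L2_measure L2) \<Rightarrow> complex"
  assumes q: "1 \<le> q" and \<phi>: "\<phi> \<in> Lp_dual (ennreal q) M"
  shows "0 \<le> Lp_dual_norm (ennreal q) M \<phi>"
    "f \<in> Lp (ennreal q) M \<Longrightarrow> cmod (\<phi> f) \<le> Lp_dual_norm (ennreal q) M \<phi> * Lp_norm (ennreal q) M f"
proof -
  let ?S = "{f \<in> Lp (ennreal q) M. Lp_norm (ennreal q) M f \<le> 1} :: ('x \<Rightarrow> 'a L2) set"
  have "\<exists>C. \<forall>f\<in>Lp (ennreal q) M. cmod (\<phi> f) \<le> C * Lp_norm (ennreal q) M f"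
    using \<phi> by (simp add: Lp_dual_def)
  then obtain C where C: "\<And>f. f \<in> Lp (ennreal q) M \<Longrightarrow> cmod (\<phi> f) \<le> C * Lp_norm (ennreal q) M f"
    by blast
  have bdd: "bdd_above ((\<lambda>f. cmod (\<phi> f)) ` ?S)"
  proof (rule bdd_aboveI2)
    fix f assume "f \<in> ?S"
    then have f: "f \<in> Lp (ennreal q) M" "Lp_norm (ennreal q) M f \<le> 1" by auto
    have "cmod (\<phi> f) \<le> \<bar>C\<bar> * Lp_norm (ennreal q) M f"
      using C[OF f(1)] mult_right_mono[OF abs_ge_self[of C] Lp_norm_nonneg[of q M f]] by linarith
    also have "\<dots> \<le> \<bar>C\<bar> * 1" using f by (intro mult_left_mono) auto
    finally show "cmod (\<phi> f) \<le> \<bar>C\<bar>" by simp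
  qed
  have up: "cmod (\<phi> f) \<le> Lp_dual_norm (ennreal q) M \<phi>" if "f \<in> ?S" for f
    unfolding Lp_dual_norm_def by (rule cSUP_upper[OF that bdd])
  have "(\<lambda>_. 0) \<in> ?S" using q by (simp add: Lp_zero Lp_norm_zero)
  from order_trans[OF norm_ge_zero up[OF this]] show "0 \<le> Lp_dual_norm (ennreal q) M \<phi>" .
  assume f: "f \<in> Lp (ennreal q) M"
  define c where "c = Lp_norm (ennreal q) M f"
  show "cmod (\<phi> f) \<le> Lp_dual_norm (ennreal q) M \<phi> * Lp_norm (ennreal q) M f"
  proof (cases "c = 0")
    \<comment> \<open>A function of norm zero cannot be normalised, but the defining bound already
      makes the functional vanish on it.\<close>
    case True
    then show ?thesis using C[OF f] by (simp add: c_def)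
  next
    case False
    then have c: "0 < c" using Lp_norm_nonneg[of q M f] unfolding c_def by linarith
    let ?g = "\<lambda>x. complex_of_real (1 / c) *\<^sub>C f x"
    have g: "?g \<in> Lp (ennreal q) M" "Lp_norm (ennreal q) M ?g = 1 / c * c"
      unfolding c_def using Lp_scale[OF q f, of ?g "1 / c"] f c
      by (auto simp: norm_cscale norm_divide c_def Lp_measurable)
    have "\<phi> ?g = complex_of_real (1 / c) * \<phi> f" using \<phi> f by (simp add: Lp_dual_def)
    moreover have "cmod (\<phi> ?g) \<le> Lp_dual_norm (ennreal q) M \<phi>" using up g c by auto
    ultimately have "cmod (\<phi> f) / c \<le> Lp_dual_norm (ennreal q) M \<phi>"
      using c by (simp add: norm_mult norm_divide)
    then show ?thesis using c by (simp add: c_def pos_divide_le_eq)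
  qed
qed

text \<open>The real part of the functional is restricted to L^(2r) with 2r >= q, where the
  variational result applies. Bounded test functions belong to all these spaces, whereas nothing is
  known yet about the integrability of \<open>g\<close> in the conjugate exponent.\<close>

lemma (in prob_space) Lp_dual_representation_bounded:
  fixes \<phi> :: "('a \<Rightarrow> 'c::L2_measure L2) \<Rightarrow> complex"
  assumes q: "1 \<le> q" and \<phi>: "\<phi> \<in> Lp_dual (ennreal q) M"
  obtains g where "g \<in> borel_measurable M"
    "\<And>w B. w \<in> borel_measurable M \<Longrightarrow> (\<And>x. norm (w x) \<le> B) \<Longrightarrow>
      integrable M (\<lambda>x. L2_pair (g x) (w x)) \<and> \<phi> w = (\<integral>x. L2_pair (g x) (w x) \<partial>M)"
proof -
  obtain r :: nat where r: "q \<le> real r" using real_arch_simple by blast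
  then have r0: "0 < r" and qr: "q \<le> 2 * real r" "1 \<le> 2 * real r" using q by auto
  define E where "E = ennreal (2 * real r)"
  have E: "f \<in> Lp (ennreal q) M" "Lp_norm (ennreal q) M f \<le> Lp_norm E M f" if "f \<in> Lp E M" for f :: "'a \<Rightarrow> 'c L2"
    using Lp_mono_exponent[OF q qr(1)] that by (auto simp: E_def)
  have add: "\<phi> (\<lambda>x. f x + g x) = \<phi> f + \<phi> g" if "f \<in> Lp (ennreal q) M" "g \<in> Lp (ennreal q) M" for f g
    using \<phi> that by (simp add: Lp_dual_def)
  have scale: "\<phi> (\<lambda>x. c *\<^sub>C f x) = c * \<phi> f" if "f \<in> Lp (ennreal q) M" for c f
    using \<phi> that by (simp add: Lp_dual_def)
  let ?D = "Lp_dual_norm (ennreal q) M \<phi>"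
  obtain u where u: "u \<in> Lp E M" and rep: "\<And>w. w \<in> Lp E M \<Longrightarrow>
    integrable M (\<lambda>x. (norm (u x)) ^ (2 * (r - 1)) * inner (u x) (w x)) \<and>
    Re (\<phi> w) = (\<integral>x. (norm (u x)) ^ (2 * (r - 1)) * inner (u x) (w x) \<partial>M)"
  proof -
    have "\<exists>u\<in>Lp E M. \<forall>w\<in>Lp E M.
      integrable M (\<lambda>x. (norm (u x)) ^ (2 * (r - 1)) * inner (u x) (w x)) \<and>
      Re (\<phi> w) = (\<integral>x. (norm (u x)) ^ (2 * (r - 1)) * inner (u x) (w x) \<partial>M)"
    proof (rule Lp_even_representation[OF r0 E_def, where \<Phi> = "\<lambda>f. Re (\<phi> f)" and C = ?D])
      fix f g :: "'a \<Rightarrow> 'c L2" assume "f \<in> Lp E M" "g \<in> Lp E M"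
      then show "Re (\<phi> (\<lambda>x. f x + g x)) = Re (\<phi> f) + Re (\<phi> g)" using add E by simp
    next
      fix f :: "'a \<Rightarrow> 'c L2" and c :: real assume f: "f \<in> Lp E M"
      show "Re (\<phi> (\<lambda>x. c *\<^sub>R f x)) = c * Re (\<phi> f)"
        using scale[OF E(1)[OF f], of "of_real c"] by (simp add: cscale_of_real)
    next
      fix f :: "'a \<Rightarrow> 'c L2" assume f: "f \<in> Lp E M"
      have "\<bar>Re (\<phi> f)\<bar> \<le> cmod (\<phi> f)" by (rule abs_Re_le_cmod)
      also have "\<dots> \<le> ?D * Lp_norm (ennreal q) M f" by (rule Lp_dual_bound(2)[OF q \<phi> E(1)[OF f]])
      also have "\<dots> \<le> ?D * Lp_norm E M f" by (intro mult_left_mono E(2) f Lp_dual_bound(1)[OF q \<phi>])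
      finally show "\<bar>Re (\<phi> f)\<bar> \<le> ?D * Lp_norm E M f" .
    qed
    then show thesis using that by blast
  qed
  note [measurable] = u[THEN Lp_measurable]
  \<comment> \<open>The conjugate converts the real inner product with the minimiser into the real
    part of the bilinear pairing.\<close>
  define g where "g x = (norm (u x)) ^ (2 * (r - 1)) *\<^sub>R L2_cnj (u x)" for x
  have g_meas [measurable]: "g \<in> borel_measurable M" unfolding g_def by measurable
  have pair: "(norm (u x)) ^ (2 * (r - 1)) * inner (u x) v = Re (L2_pair (g x) v)" for x v
  proof -
    have "Re (L2_pair (L2_cnj (u x)) v) = inner v (L2_cnj (L2_cnj (u x)))"
      by (subst L2_pair_commute) (rule Re_L2_pair)
    then show ?thesis by (simp add: g_def L2_pair.scaleR_left inner_commute)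
  qed
  show thesis
  proof (rule that[OF g_meas])
    fix w :: "'a \<Rightarrow> 'c L2" and B assume w: "w \<in> borel_measurable M" "\<And>x. norm (w x) \<le> B"
    note [measurable] = w(1)
    have wE: "w \<in> Lp E M" unfolding E_def by (rule Lp_bounded[OF w qr(2)])
    \<comment> \<open>By complex linearity the real part of the functional at \<i> w is minus its
      imaginary part at w, so this second test function supplies the imaginary part.\<close>
    have iwE: "(\<lambda>x. \<i> *\<^sub>C w x) \<in> Lp E M"
      using w unfolding E_def by (intro Lp_bounded[OF _ _ qr(2), of _ B]) (auto simp: norm_cscale)
    have R: "integrable M (\<lambda>x. Re (L2_pair (g x) (w x)))" "Re (\<phi> w) = (\<integral>x. Re (L2_pair (g x) (w x)) \<partial>M)"
      using rep[OF wE, unfolded pair] by auto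
    have "integrable M (\<lambda>x. - Im (L2_pair (g x) (w x)))" and I2: "- Im (\<phi> w) = (\<integral>x. - Im (L2_pair (g x) (w x)) \<partial>M)"
      using rep[OF iwE, unfolded pair] scale[OF E(1)[OF wE], of \<i>] by (simp_all add: L2_pair_cscale_right)
    then have I1: "integrable M (\<lambda>x. Im (L2_pair (g x) (w x)))" by simp
    have "integrable M (\<lambda>x. complex_of_real (Re (L2_pair (g x) (w x))) + \<i> * complex_of_real (Im (L2_pair (g x) (w x))))"
      by (intro Bochner_Integration.integrable_add integrable_mult_right integrable_of_real R(1) I1)
    then have i: "integrable M (\<lambda>x. L2_pair (g x) (w x))" by (simp add: complex_eq[symmetric])
    have "\<phi> w = (\<integral>x. L2_pair (g x) (w x) \<partial>M)"
      using R(2) I2 integral_bounded_linear[OF bounded_linear_Re i] integral_bounded_linear[OF bounded_linear_Im i]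
      by (intro complex_eqI) simp_all
    with i show "integrable M (\<lambda>x. L2_pair (g x) (w x)) \<and> \<phi> w = (\<integral>x. L2_pair (g x) (w x) \<partial>M)" by simp
  qed
qed

text \<open>The density from the previous lemma is only measurable. Testing the functional with
  bounded extremal functions bounds its norm in the conjugate exponent by the dual norm.\<close>

theorem (in prob_space) Lp_dual_representation:
  fixes \<phi> :: "('a \<Rightarrow> 'c::L2_measure L2) \<Rightarrow> complex"
  assumes p: "1 \<le> p" "p < \<infinity>" "1 / p + 1 / p' = 1" and \<phi>: "\<phi> \<in> Lp_dual p M"
  obtains g where "g \<in> Lp p' M" "Lp_norm p' M g \<le> Lp_dual_norm p M \<phi>"
    "\<And>w B. w \<in> borel_measurable M \<Longrightarrow> (\<And>x. norm (w x) \<le> B) \<Longrightarrow> \<phi> w = (\<integral>x. L2_pair (g x) (w x) \<partial>M)"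
proof -
  obtain q where q: "p = ennreal q" "1 \<le> q"
    using p by (cases rule: conjugate_exponents) auto
  define D where "D = Lp_dual_norm p M \<phi>"
  have D0: "0 \<le> D" unfolding D_def q(1) using \<phi> q by (intro Lp_dual_bound(1)) auto
  have D: "cmod (\<phi> f) \<le> D * Lp_norm p M f" if "f \<in> Lp p M" for f
    unfolding D_def q(1) using \<phi> that q by (intro Lp_dual_bound(2)) auto
  have "\<exists>g. g \<in> borel_measurable M \<and>
    (\<forall>w B. w \<in> borel_measurable M \<longrightarrow> (\<forall>x. norm (w x) \<le> B) \<longrightarrow>
      integrable M (\<lambda>x. L2_pair (g x) (w x)) \<and> \<phi> w = (\<integral>x. L2_pair (g x) (w x) \<partial>M))"
    by (rule Lp_dual_representation_bounded[OF q(2) \<phi>[unfolded q(1)]]) blast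
  then obtain g where [measurable]: "g \<in> borel_measurable M" and
    rep: "\<And>w B. w \<in> borel_measurable M \<Longrightarrow> (\<And>x. norm (w x) \<le> B) \<Longrightarrow>
      integrable M (\<lambda>x. L2_pair (g x) (w x)) \<and> \<phi> w = (\<integral>x. L2_pair (g x) (w x) \<partial>M)"
    by blast
  have "g \<in> Lp p' M \<and> Lp_norm p' M g \<le> D"
    using p
  proof (cases rule: conjugate_exponents)
    case 1
    \<comment> \<open>\<open>w\<close> is the unit vector field along the conjugate of
      \<open>g\<close> on the set where D < |g| <= n. Were that set not null, the value at
      \<open>w\<close> would exceed \<open>D\<close> times the L^1 norm of \<open>w\<close>.\<close>
    have null: "AE x in M. \<not> (D < norm (g x) \<and> norm (g x) \<le> real n)" for n :: nat
    proof -
      define w where "w x = (if D < norm (g x) \<and> norm (g x) \<le> real n then (1 / norm (g x)) *\<^sub>R L2_cnj (g x) else 0)" for x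
      define A where "A x = (if D < norm (g x) \<and> norm (g x) \<le> real n then 1 else 0 :: real)" for x
      have nw: "norm (w x) = A x" for x using D0 by (auto simp: w_def A_def norm_L2_cnj)
      have w_meas: "w \<in> borel_measurable M" unfolding w_def by measurable
      have A_meas [measurable]: "A \<in> borel_measurable M" unfolding A_def by measurable
      have A1: "\<bar>A x\<bar> \<le> 1" for x by (simp add: A_def)
      have pw: "L2_pair (g x) (w x) = of_real (A x * norm (g x))" for x
        using D0 by (auto simp: w_def A_def L2_pair.scaleR_right L2_pair_L2_cnj L2_pair.zero_right
            power2_eq_square scaleR_conv_of_real)
      have "w \<in> Lp p M" unfolding q(1) using q nw A1 by (intro Lp_bounded[OF w_meas, of 1]) (auto simp: A_def)
      from D[OF this] have 2: "cmod (\<phi> w) \<le> D * (\<integral>x. A x \<partial>M)"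
        using Lp_norm_eq[of 1 M w] unfolding 1 nw by (simp add: A_def)
      have i1: "integrable M (\<lambda>x. L2_pair (g x) (w x))" and e1: "\<phi> w = (\<integral>x. L2_pair (g x) (w x) \<partial>M)"
        using rep[OF w_meas, of 1] by (auto simp: nw A_def)
      have iA: "integrable M A" by (rule integrable_const_bound[of _ 1]) (auto simp: A_def)
      have i2: "integrable M (\<lambda>x. A x * norm (g x))"
        using integrable_Re[OF i1] by (simp add: pw)
      have "0 \<le> (\<integral>x. A x * norm (g x) \<partial>M)" by (intro Bochner_Integration.integral_nonneg) (simp add: A_def)
      then have "cmod (\<phi> w) = (\<integral>x. A x * norm (g x) \<partial>M)"
        unfolding e1 pw by (simp only: integral_complex_of_real norm_of_real abs_of_nonneg)
      with 2 have le: "(\<integral>x. A x * norm (g x) - D * A x \<partial>M) \<le> 0" using i2 iA by simp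
      have nonneg: "0 \<le> A x * norm (g x) - D * A x" for x by (auto simp: A_def)
      have "(\<integral>x. A x * norm (g x) - D * A x \<partial>M) = 0"
        by (intro antisym le Bochner_Integration.integral_nonneg nonneg)
      then have "AE x in M. A x * norm (g x) - D * A x = 0"
        using i2 iA nonneg by (subst (asm) integral_nonneg_eq_0_iff_AE) auto
      then show ?thesis by eventually_elim (auto simp: A_def)
    qed
    have "AE x in M. \<forall>n::nat. \<not> (D < norm (g x) \<and> norm (g x) \<le> real n)"
      unfolding AE_all_countable using null by blast
    then have "AE x in M. norm (g x) \<le> D"
    proof eventually_elim
      case (elim x)
      obtain n :: nat where "norm (g x) \<le> real n" using real_arch_simple by blast
      then show ?case using elim by force
    qed
    then show ?thesis unfolding 1 using D0 Lp_inf_norm_le[of g M D] by auto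
  next
    case (2 r q')
    have rq: "r = q" using 2 q by simp
    have q': "1 < q" "1 < q'" "1 / q + 1 / q' = 1" "1 \<le> q'" using 2 by (auto simp: rq)
    have "1 / q * (q * q') + 1 / q' * (q * q') = q' + q" using q' by simp
    then have conj: "(q' - 1) * q = q'" unfolding distrib_right[symmetric] q'(3) by (simp add: algebra_simps)
    \<comment> \<open>Truncation makes the integral \<open>S\<close> finite, so that
      \<open>S \<le> D * S powr (1 / q)\<close> may be divided by the power of \<open>S\<close>. For
      \<open>g\<close> itself this would beg the question.\<close>
    define G where "G n x = (if norm (g x) \<le> real n then g x else 0)" for n :: nat and x
    have G_meas [measurable]: "G n \<in> borel_measurable M" for n unfolding G_def by measurable
    have GL: "G n \<in> Lp p' M" and Gn: "Lp_norm p' M (G n) \<le> D" for n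
    proof -
      have gn: "norm (G n x) \<le> real n" for x by (simp add: G_def)
      show GL: "G n \<in> Lp p' M" unfolding 2 by (rule Lp_bounded[OF G_meas gn q'(4)])
      \<comment> \<open>The equality case of Hoelder: the pairing with \<open>g\<close> is |G|^q',
        and since (q' - 1) q = q' the q-th power of |w| is |G|^q' too. For q' < 2 the exponent is
        negative, but \<open>0 powr (q' - 2)\<close> is 0, so \<open>w\<close> vanishes with
        \<open>G n\<close>.\<close>
      define w where "w x = (norm (G n x) powr (q' - 2)) *\<^sub>R L2_cnj (G n x)" for x
      have w_meas: "w \<in> borel_measurable M" unfolding w_def by measurable
      have nw: "norm (w x) = norm (G n x) powr (q' - 1)" for x
        using powr_add[of "norm (G n x)" "q' - 2" 1]
        by (cases "G n x = 0") (auto simp: w_def norm_L2_cnj)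
      have wB: "norm (w x) \<le> real n powr (q' - 1)" for x unfolding nw using q' gn by (intro powr_mono2) auto
      have pw: "L2_pair (g x) (w x) = of_real (norm (G n x) powr q')" for x
      proof (cases "G n x = 0")
        case True
        then show ?thesis by (simp add: w_def L2_pair.zero_right)
      next
        case False
        then have e: "G n x = g x" "g x \<noteq> 0" by (auto simp: G_def split: if_splits)
        have "norm (g x) powr (q' - 2) * (norm (g x))\<^sup>2 = norm (g x) powr q'"
          using e powr_add[of "norm (g x)" "q' - 2" 2] by simp
        then show ?thesis
          by (simp add: w_def e L2_pair.scaleR_right L2_pair_L2_cnj scaleR_conv_of_real flip: of_real_mult of_real_power)
      qed
      define S where "S = (\<integral>x. norm (G n x) powr q' \<partial>M)"
      have S0: "0 \<le> S" unfolding S_def by simp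
      have wL: "w \<in> Lp p M" unfolding q(1) by (rule Lp_bounded[OF w_meas wB q(2)])
      have "Lp_norm p M w = S powr (1 / q)"
        unfolding q(1) Lp_norm_eq[OF q(2)] nw powr_powr conj S_def ..
      moreover have "\<phi> w = of_real S" using rep[OF w_meas wB] by (simp add: pw S_def)
      ultimately have le: "S \<le> D * S powr (1 / q)" using D[OF wL] S0 by simp
      have nG: "Lp_norm p' M (G n) = S powr (1 / q')" unfolding 2 Lp_norm_eq[OF q'(4)] S_def ..
      show "Lp_norm p' M (G n) \<le> D"
      proof (cases "S = 0")
        case True
        then show ?thesis using D0 by (simp add: nG)
      next
        case False
        then have S: "0 < S" using S0 by simp
        have "S powr (1 / q') * S powr (1 / q) = S"
          unfolding powr_add[symmetric] using q'(3) S by (simp add: add.commute)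
        then have "S powr (1 / q') * S powr (1 / q) \<le> D * S powr (1 / q)" using le by simp
        then show ?thesis using S by (simp add: nG)
      qed
    qed
    have lim: "(\<lambda>n. G n x) \<longlonglongrightarrow> g x" for x
    proof (rule tendsto_eventually)
      obtain N :: nat where "norm (g x) \<le> real N" using real_arch_simple by blast
      then show "\<forall>\<^sub>F n in sequentially. G n x = g x"
        by (intro eventually_sequentiallyI[of N]) (simp add: G_def)
    qed
    show ?thesis
      using Lp_Fatou[OF q'(4), of G M D g] GL Gn lim unfolding 2 by simp
  qed
  then show thesis using rep by (intro that[of g]) (auto simp: D_def)
qed

section \<open>Density of trigonometric polynomials\<close>

text \<open>Scalar-valued, because products are needed to pass from single coordinates to boxes;
  vectors enter only as a fixed factor.\<close>

inductive_set trig_polys :: "(real ^ 'n \<Rightarrow> complex) set" where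
  character: "character \<xi> \<in> trig_polys"
| add: "f \<in> trig_polys \<Longrightarrow> g \<in> trig_polys \<Longrightarrow> (\<lambda>x. f x + g x) \<in> trig_polys"
| scale: "f \<in> trig_polys \<Longrightarrow> (\<lambda>x. c * f x) \<in> trig_polys"

lemma trig_polys_const: "(\<lambda>_. c) \<in> trig_polys"
  using trig_polys.scale[OF trig_polys.character[of 0], of c] by (simp add: character_zero)

lemma trig_polys_mult:
  assumes "f \<in> trig_polys" "g \<in> trig_polys"
  shows "(\<lambda>x. f x * g x) \<in> trig_polys"
  using assms(1)
proof induction
  case (character \<xi>)
  show ?case using assms(2)
  proof induction
    case (character \<eta>)
    show ?case using trig_polys.character[of "\<xi> + \<eta>"] by (simp add: character_add[abs_def])
  next
    case (add f g)
    then show ?case using trig_polys.add by (simp add: distrib_left)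
  next
    case (scale f c)
    then show ?case using trig_polys.scale[of _ c] by (simp add: mult.left_commute)
  qed
next
  case (add f g)
  then show ?case using trig_polys.add by (simp add: distrib_right)
next
  case (scale f c)
  then show ?case using trig_polys.scale[of _ c] by (simp add: mult.assoc)
qed

lemma trig_polys_prod:
  "(\<And>i. i \<in> I \<Longrightarrow> f i \<in> trig_polys) \<Longrightarrow> (\<lambda>x. \<Prod>i\<in>I. f i x) \<in> trig_polys"
  by (induction I rule: infinite_finite_induct) (simp_all add: trig_polys_const trig_polys_mult)

lemma trig_polys_polynomial:
  fixes P :: "real \<Rightarrow> real"
  assumes "real_polynomial_function P" and r: "(\<lambda>x. complex_of_real (r x)) \<in> trig_polys"
  shows "(\<lambda>x. complex_of_real (P (r x))) \<in> trig_polys"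
  using assms(1)
proof induction
  case (linear P)
  then have "P y = y * P 1" for y
    using linear_cmul[OF bounded_linear.linear, of P y 1] by simp
  then have "(\<lambda>x. complex_of_real (P (r x))) = (\<lambda>x. complex_of_real (P 1) * complex_of_real (r x))"
    by (metis mult.commute of_real_mult)
  then show ?case using trig_polys.scale[OF r] by simp
qed (simp_all add: trig_polys_const trig_polys.add trig_polys_mult)

lemma trig_polys_cos:
  fixes i :: "'n::finite"
  shows "(\<lambda>x. complex_of_real (cos (2 * pi * (x $ i - m)))) \<in> trig_polys"
proof -
  have d: "dot x (axis i k) = x $ i * of_int k" for x :: "real ^ 'n" and k
  proof -
    have "dot x (axis i k) = (\<Sum>j\<in>UNIV. if j = i then x $ j * of_int k else 0)"
      unfolding dot_def by (rule sum.cong) (auto simp: axis_def)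
    then show ?thesis by simp
  qed
  have "complex_of_real (cos (2 * pi * (x $ i - m))) =
      cis (- 2 * pi * m) / 2 * character (axis i 1) x + cis (2 * pi * m) / 2 * character (axis i (- 1)) x"
    for x :: "real ^ 'n"
  proof -
    have "complex_of_real (cos t) = cis t / 2 + cis (- t) / 2" for t
      by (simp add: complex_eq_iff)
    from this[of "2 * pi * (x $ i - m)"] show ?thesis
      by (simp add: character_def d cis_mult algebra_simps)
  qed
  then show ?thesis by (simp only: trig_polys.intros)
qed

section \<open>Approximation of indicators of boxes and density\<close>

text \<open>\<open>f k\<close> is a ramp of slope \<open>k\<close> starting at \<open>c\<close>. It
  vanishes at \<open>c\<close> itself, so the pointwise limit is the indicator of the open
  half-line. Weierstrass approximation with error 1 / (k + 1) keeps the limit and raises the bound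
  from 1 to at most 2.\<close>

lemma polynomial_indicator_approx:
  fixes c :: real
  obtains P :: "nat \<Rightarrow> real \<Rightarrow> real"
  where "\<And>k. real_polynomial_function (P k)"
    "\<And>k y. y \<in> {-1..1} \<Longrightarrow> \<bar>P k y\<bar> \<le> 2"
    "\<And>y. y \<in> {-1..1} \<Longrightarrow> (\<lambda>k. P k y) \<longlonglongrightarrow> indicator {c<..} y"
proof -
  define f where "f k y = min 1 (max 0 (real k * (y - c)))" for k :: nat and y
  have "\<exists>P. real_polynomial_function P \<and> (\<forall>y\<in>{-1..1}. \<bar>f k y - P y\<bar> < inverse (real (Suc k)))" for k
  proof -
    have "continuous_on {-1..1} (f k)" unfolding f_def by (intro continuous_intros)
    then obtain g where "real_polynomial_function g"
      "\<And>y. y \<in> {-1..1} \<Longrightarrow> \<bar>f k y - g y\<bar> < inverse (real (Suc k))"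
      using Stone_Weierstrass_real_polynomial_function[of "{-1..1::real}" "f k" "inverse (real (Suc k))"]
      by (auto simp del: of_nat_Suc)
    then show ?thesis by blast
  qed
  then have "\<forall>k. \<exists>P. real_polynomial_function P \<and> (\<forall>y\<in>{-1..1}. \<bar>f k y - P y\<bar> < inverse (real (Suc k)))" ..
  from choice[OF this] obtain P where P: "\<And>k. real_polynomial_function (P k)"
    "\<And>k y. y \<in> {-1..1} \<Longrightarrow> \<bar>f k y - P k y\<bar> < inverse (real (Suc k))" by blast
  show thesis
  proof (rule that[OF P(1)])
    fix k and y :: real assume y: "y \<in> {-1..1}"
    have "inverse (real (Suc k)) \<le> 1" by (simp add: field_simps)
    moreover have "0 \<le> f k y" "f k y \<le> 1" by (auto simp: f_def)
    ultimately show "\<bar>P k y\<bar> \<le> 2" using P(2)[OF y, of k] by linarith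
  next
    fix y :: real assume y: "y \<in> {-1..1}"
    have "(\<lambda>k. f k y) \<longlonglongrightarrow> indicator {c<..} y"
    proof (cases "c < y")
      case True
      obtain K :: nat where K: "1 < real K * (y - c)"
        using ex_less_of_nat_mult[of "y - c" 1] True by auto
      show ?thesis
      proof (rule tendsto_eventually, rule eventually_sequentiallyI[of K])
        fix k assume "K \<le> k"
        then have "real K * (y - c) \<le> real k * (y - c)" using True by (intro mult_right_mono) auto
        then have "1 \<le> real k * (y - c)" using K by linarith
        then show "f k y = indicator {c<..} y" using True by (simp add: f_def)
      qed
    next
      case False
      then have "real k * (y - c) \<le> 0" for k by (simp add: mult_nonneg_nonpos)
      then have "f k y = 0" for k by (simp add: f_def max_absorb1)
      then show ?thesis using False by simp
    qed
    moreover have "(\<lambda>k. P k y - f k y) \<longlonglongrightarrow> 0"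
      by (rule Lim_null_comparison[OF always_eventually LIMSEQ_inverse_real_of_nat])
        (use P(2)[OF y] in \<open>auto simp: abs_minus_commute intro: less_imp_le\<close>)
    ultimately have "(\<lambda>k. (P k y - f k y) + f k y) \<longlonglongrightarrow> 0 + indicator {c<..} y"
      by (intro tendsto_add)
    then show "(\<lambda>k. P k y) \<longlonglongrightarrow> indicator {c<..} y" by simp
  qed
qed

text \<open>
  Arcs are superlevel sets of translates of the cosine, so that polynomials in the cosine which
  approximate a step function turn indicators of boxes into bounded limits of trigonometric polynomials.
\<close>

lemma arc_iff_cos:
  fixes a b t :: real
  assumes ab: "0 \<le> a" "a < b" "b \<le> 1" and t: "0 \<le> t" "t < 1"
  shows "a < t \<and> t < b \<longleftrightarrow> cos (pi * (b - a)) < cos (2 * pi * (t - (a + b) / 2))"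
proof -
  define y where "y = 2 * pi * \<bar>t - (a + b) / 2\<bar>"
  define \<theta> where "\<theta> = pi * (b - a)"
  have th: "0 \<le> \<theta>" "\<theta> \<le> pi" using ab by (auto simp: \<theta>_def mult_left_le)
  have y0: "0 \<le> y" by (simp add: y_def)
  \<comment> \<open>As [a, b] lies in [0, 1], the angle \<open>y\<close> never exceeds 2 pi -
    \<theta>: beyond pi, where the cosine grows again, it does not re-enter the arc from the other
    side.\<close>
  have "\<bar>t - (a + b) / 2\<bar> \<le> 1 - (b - a) / 2" using ab t by (auto simp: abs_if field_simps)
  then have "2 * pi * \<bar>t - (a + b) / 2\<bar> \<le> 2 * pi * (1 - (b - a) / 2)" by (intro mult_left_mono) auto
  moreover have "2 * pi * (1 - (b - a) / 2) = 2 * pi - \<theta>" by (simp add: \<theta>_def field_simps)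
  ultimately have y2: "y \<le> 2 * pi - \<theta>" unfolding y_def by linarith
  have cy: "cos (2 * pi * (t - (a + b) / 2)) = cos y"
    using abs_if[of "t - (a + b) / 2"] cos_minus[of "2 * pi * (t - (a + b) / 2)"] unfolding y_def
    by (metis mult_minus_right)
  have "a < t \<and> t < b \<longleftrightarrow> \<bar>t - (a + b) / 2\<bar> < (b - a) / 2" by (auto simp: abs_if field_simps)
  also have "\<dots> \<longleftrightarrow> 2 * pi * \<bar>t - (a + b) / 2\<bar> < 2 * pi * ((b - a) / 2)"
    by (subst mult_less_cancel_left_pos) auto
  also have "\<dots> \<longleftrightarrow> y < \<theta>" by (simp add: y_def \<theta>_def)
  also have "\<dots> \<longleftrightarrow> cos \<theta> < cos y"
  proof (cases "y \<le> pi")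
    case True
    then show ?thesis using cos_mono_less_eq[of \<theta> y] th y0 by simp
  next
    case False
    have "cos (2 * pi - y) \<le> cos \<theta>" using False th y2 by (intro cos_monotone_0_pi_le) auto
    then show ?thesis using False th by (simp add: cos_diff)
  qed
  finally show ?thesis unfolding cy \<theta>_def .
qed

text \<open>The faces of the cube are null, so a box may be clipped to the open cube.\<close>

lemma AE_torus_pos: "AE x in (torus :: (real ^ 'n) measure). \<forall>i. 0 < x $ i \<and> x $ i < 1"
proof -
  let ?A = "space torus \<inter> box 0 (1 :: real ^ 'n)"
  have "prob_space.prob torus ?A = 1"
  proof -
    have "?A = box 0 1"
      by (auto simp: space_torus box_def Basis_vec_eq inner_axis less_imp_le)
    moreover have "emeasure torus (box 0 (1 :: real ^ 'n)) = emeasure lborel (box 0 (1 :: real ^ 'n))"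
      unfolding torus_def by (rule emeasure_restrict_space)
        (auto simp: box_def Basis_vec_eq inner_axis less_imp_le)
    moreover have "emeasure lborel (box 0 (1 :: real ^ 'n)) = 1"
      by (auto simp: emeasure_lborel_box_eq Basis_vec_eq inner_axis intro!: prod.neutral)
    ultimately have "emeasure torus ?A = 1" by metis
    then show ?thesis by (simp only: measure_def enn2real_1)
  qed
  moreover have "?A \<in> sets torus"
    unfolding torus_def space_restrict_space sets_restrict_space by auto
  ultimately have "AE x in torus. x \<in> ?A" using torus.AE_in_set_eq_1[of ?A] by simp
  then show ?thesis
    by eventually_elim (auto simp: box_def Basis_vec_eq inner_axis)
qed

text \<open>Density in the form of an induction principle: \<open>N\<close> will be the set of
  functions on which the partial sums converge to the operator. The passage runs from trigonometric
  polynomials through boxes, Borel sets and simple functions, each limit being a dominated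
  one.\<close>

theorem Lp_torus_density:
  fixes N :: "(real ^ 'n \<Rightarrow> 'a::L2_measure L2) set"
  assumes q: "1 \<le> q"
    and char: "\<And>\<xi> v. (\<lambda>x. character \<xi> x *\<^sub>C v) \<in> N"
    and add: "\<And>f g. f \<in> N \<Longrightarrow> g \<in> N \<Longrightarrow> (\<lambda>x. f x + g x) \<in> N"
    and scale: "\<And>c f. f \<in> N \<Longrightarrow> (\<lambda>x. c *\<^sub>C f x) \<in> N"
    and closed: "\<And>F f. (\<And>n. F n \<in> N) \<Longrightarrow> (\<And>n. F n \<in> Lp (ennreal q) torus) \<Longrightarrow> f \<in> Lp (ennreal q) torus
      \<Longrightarrow> (\<lambda>n. Lp_norm (ennreal q) torus (\<lambda>x. F n x - f x)) \<longlonglongrightarrow> 0 \<Longrightarrow> f \<in> N"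
  shows "Lp (ennreal q) torus \<subseteq> N"
proof -
  have trig: "(\<lambda>x. h x *\<^sub>C v) \<in> N" if "h \<in> trig_polys" for h v
    using that
  proof induction
    case (add f g)
    then show ?case using assms(3) by (simp add: cscale.add_left)
  next
    case (scale f c)
    then show ?case using assms(4)[of _ c] by (simp add: cscale_cscale[symmetric])
  qed (rule char)
  have trig_meas: "h \<in> borel_measurable torus" if "h \<in> trig_polys" for h :: "real ^ 'n \<Rightarrow> complex"
    using that
  proof induction
    case (character \<xi>)
    show ?case by (rule measurable_torusI[OF borel_measurable_character])
  next
    case (add f g)
    then show ?case by (intro borel_measurable_add)
  next
    case (scale f c)
    then show ?case by (intro borel_measurable_times borel_measurable_const)
  qed
  have zero: "(\<lambda>_. 0) \<in> N" using trig[OF trig_polys_const[of 0], of 0] by (simp add: cscale.zero_right)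
  have bdd_lim: "(\<lambda>x. h x *\<^sub>C v) \<in> N"
    if "\<And>k. (\<lambda>x. H k x *\<^sub>C v) \<in> N" "\<And>k. H k \<in> borel_measurable torus" "h \<in> borel_measurable torus"
      "\<And>k x. x \<in> space torus \<Longrightarrow> cmod (H k x) \<le> B" "AE x in torus. (\<lambda>k. H k x) \<longlonglongrightarrow> h x" for H h B v
  proof -
    note [measurable] = that(2,3)
    have *: "AE x in torus. norm (H k x *\<^sub>C v) \<le> B * norm v" for k
      by (rule AE_I2) (use that(4) in \<open>auto simp: norm_cscale intro: mult_right_mono\<close>)
    have **: "AE x in torus. (\<lambda>k. H k x *\<^sub>C v) \<longlonglongrightarrow> h x *\<^sub>C v"
      using that(5) by eventually_elim (intro cscale.tendsto tendsto_const)
    have m: "(\<lambda>x. H k x *\<^sub>C v) \<in> borel_measurable torus" "(\<lambda>x. h x *\<^sub>C v) \<in> borel_measurable torus" for k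
      by measurable
    note dc = Lp_dominated_convergence[OF q torus.Lp_const[of "B * norm v"] m ** *]
    show ?thesis by (rule closed[OF that(1) dc(2) dc(1) dc(3)])
  qed
  have box: "(\<lambda>x. indicator (box l u) x *\<^sub>C v) \<in> N" for l u :: "real ^ 'n" and v
  proof -
    \<comment> \<open>Clipping alters the box only outside the open cube, hence on a null set of the
      torus, and brings the endpoints into the range of \<open>arc_iff_cos\<close>.\<close>
    define a where "a i = max 0 (l $ i)" for i
    define b where "b i = min 1 (u $ i)" for i
    have bx: "x \<in> box l u \<longleftrightarrow> (\<forall>i. a i < x $ i \<and> x $ i < b i)" if "\<forall>i. 0 < x $ i \<and> x $ i < 1" for x
      using that by (auto simp: box_def Basis_vec_eq inner_axis a_def b_def)
    show ?thesis
    proof (cases "\<forall>i. a i < b i")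
      case False
      then obtain i where i: "b i \<le> a i" by (meson not_le)
      have "x \<notin> box l u" if "\<forall>i. 0 < x $ i \<and> x $ i < 1" for x
        using bx[OF that] i by (meson less_le_trans less_trans not_le)
      with AE_torus_pos have "AE x in torus. indicator (box l u) x = (0 :: complex)"
        by (auto elim!: eventually_mono)
      then have "AE x in torus. (\<lambda>k. (0 :: complex)) \<longlonglongrightarrow> indicator (box l u) x"
        by eventually_elim simp
      then show ?thesis
        using bdd_lim[of "\<lambda>_ _. 0" v "indicator (box l u)" 0] zero by (simp add: cscale.zero_left)
    next
      case True
      have "\<forall>i. \<exists>P. (\<forall>k. real_polynomial_function (P k)) \<and> (\<forall>k. \<forall>y\<in>{-1..1}. \<bar>P k y\<bar> \<le> 2) \<and>
        (\<forall>y\<in>{-1..1}. (\<lambda>k. P k y) \<longlonglongrightarrow> indicator {cos (pi * (b i - a i))<..} y)"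
      proof
        fix i
        show "\<exists>P. (\<forall>k. real_polynomial_function (P k)) \<and> (\<forall>k. \<forall>y\<in>{-1..1}. \<bar>P k y\<bar> \<le> 2) \<and>
          (\<forall>y\<in>{-1..1}. (\<lambda>k. P k y) \<longlonglongrightarrow> indicator {cos (pi * (b i - a i))<..} y)"
          by (rule polynomial_indicator_approx[of "cos (pi * (b i - a i))"]) blast
      qed
      from choice[OF this] obtain P where P: "\<And>i k. real_polynomial_function (P i k)"
        "\<And>i k y. y \<in> {-1..1} \<Longrightarrow> \<bar>P i k y\<bar> \<le> 2"
        "\<And>i y. y \<in> {-1..1} \<Longrightarrow> (\<lambda>k. P i k y) \<longlonglongrightarrow> indicator {cos (pi * (b i - a i))<..} y" by blast
      define r where "r i x = cos (2 * pi * (x $ i - (a i + b i) / 2))" for i and x :: "real ^ 'n"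
      have r: "r i x \<in> {-1..1}" for i x by (simp add: r_def)
      \<comment> \<open>One step-function approximation per coordinate, evaluated at a translated
        cosine. The product is a trigonometric polynomial with a bound independent of
        \<open>k\<close>, as \<open>bdd_lim\<close> requires.\<close>
      define H where "H k x = (\<Prod>i\<in>UNIV. complex_of_real (P i k (r i x)))" for k x
      have "(\<lambda>x. complex_of_real (r i x)) \<in> trig_polys" for i unfolding r_def by (rule trig_polys_cos)
      then have H: "H k \<in> trig_polys" for k
        unfolding H_def[abs_def] by (intro trig_polys_prod trig_polys_polynomial[OF P(1)])
      have Hb: "cmod (H k x) \<le> 2 ^ CARD('n)" for k x
      proof -
        have "cmod (H k x) = (\<Prod>i\<in>UNIV. \<bar>P i k (r i x)\<bar>)" by (simp add: H_def prod_norm[symmetric])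
        also have "\<dots> \<le> (\<Prod>i\<in>(UNIV :: 'n set). 2)" by (intro prod_mono) (use P(2) r in auto)
        finally show ?thesis by simp
      qed
      have lim: "AE x in torus. (\<lambda>k. H k x) \<longlonglongrightarrow> indicator (box l u) x"
        using AE_torus_pos
      proof eventually_elim
        case (elim x)
        have "(\<lambda>k. H k x) \<longlonglongrightarrow> (\<Prod>i\<in>UNIV. complex_of_real (indicator {cos (pi * (b i - a i))<..} (r i x)))"
          unfolding H_def by (intro tendsto_prod tendsto_of_real P(3) r)
        also have "(\<Prod>i\<in>UNIV. complex_of_real (indicator {cos (pi * (b i - a i))<..} (r i x))) =
            (\<Prod>i\<in>UNIV. of_bool (a i < x $ i \<and> x $ i < b i))"
        proof (rule prod.cong[OF refl])
          fix i
          have "a i < x $ i \<and> x $ i < b i \<longleftrightarrow> cos (pi * (b i - a i)) < r i x"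
            unfolding r_def by (rule arc_iff_cos) (use True elim in \<open>auto simp: a_def b_def less_imp_le\<close>)
          then show "complex_of_real (indicator {cos (pi * (b i - a i))<..} (r i x)) =
              of_bool (a i < x $ i \<and> x $ i < b i)" by (simp add: indicator_def)
        qed
        also have "\<dots> = indicator (box l u) x"
          unfolding indicator_def bx[OF elim] by (cases "\<forall>i. a i < x $ i \<and> x $ i < b i") auto
        finally show ?case .
      qed
      show ?thesis
        by (rule bdd_lim[of H v, OF trig[OF H] trig_meas[OF H] _ Hb lim]) simp
    qed
  qed
  \<comment> \<open>Boxes are an intersection-stable generator, so the pi-lambda theorem applies;
    countable disjoint unions are bounded limits of finite ones.\<close>
  have borel: "(\<lambda>x. indicator A x *\<^sub>C v) \<in> N" if A: "A \<in> sets borel" for A and v :: "'a L2"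
  proof -
    let ?G = "range (\<lambda>(a, b). box a b :: (real ^ 'n) set)"
    have sb: "sets borel = sigma_sets UNIV ?G" by (subst borel_eq_box) simp
    have int: "Int_stable ?G"
    proof (rule Int_stableI_image)
      fix i j :: "(real ^ 'n) \<times> (real ^ 'n)"
      obtain a b where i: "i = (a, b)" by (cases i)
      obtain c d where j: "j = (c, d)" by (cases j)
      have "\<exists>e f. box a b \<inter> box c d = box e f" unfolding box_Int_box by (intro exI) (rule refl)
      then obtain e f where "box a b \<inter> box c d = box e f" by blast
      then show "\<exists>k\<in>UNIV. (case i of (a, b) \<Rightarrow> box a b) \<inter> (case j of (a, b) \<Rightarrow> box a b) = (case k of (a, b) \<Rightarrow> box a b)"
        unfolding i j by (intro bexI[of _ "(e, f)"]) simp_all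
    qed
    have sub: "?G \<subseteq> Pow UNIV" by simp
    show ?thesis using int sub A[unfolded sb]
    proof (induction rule: sigma_sets_induct_disjoint)
      case (basic A)
      then obtain a b where "A = box a b" by auto
      then show ?case using box[of a b] by simp
    next
      case empty
      then show ?case using zero by (simp add: cscale.zero_left)
    next
      case (compl A)
      have "(\<lambda>x. indicator (UNIV - A) x *\<^sub>C v) = (\<lambda>x. 1 *\<^sub>C v + (- 1) *\<^sub>C (indicator A x *\<^sub>C v))"
        by (auto simp: indicator_def cscale.zero_left cscale.zero_right cscale.minus_left fun_eq_iff)
      then show ?case using add[OF trig[OF trig_polys_const[of 1]] scale[OF compl.IH]] by simp
    next
      case (union A)
      have A: "A i \<in> sets borel" for i using union(2) sb by auto
      have fin: "(\<lambda>x. indicator (\<Union>i<k. A i) x *\<^sub>C v) \<in> N" for k :: nat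
      proof (induction k)
        case 0
        then show ?case using zero by (simp add: cscale.zero_left)
      next
        case (Suc k)
        have "A i \<inter> A k = {}" if "i < k" for i
          using union(1) that by (simp add: disjoint_family_on_def)
        then have "(\<Union>i<k. A i) \<inter> A k = {}" by blast
        then have "(\<lambda>x. indicator (\<Union>i<Suc k. A i) x *\<^sub>C v) =
            (\<lambda>x. indicator (\<Union>i<k. A i) x *\<^sub>C v + indicator (A k) x *\<^sub>C v)"
          by (auto simp: lessThan_Suc indicator_def cscale.zero_left fun_eq_iff)
        then show ?case using add[OF Suc.IH union(3)] by simp
      qed
      show ?case
      proof (rule bdd_lim[of "\<lambda>k. indicator (\<Union>i<k. A i)" v _ 1, OF fin])
        show "AE x in torus. (\<lambda>k. indicator (\<Union>i<k. A i) x) \<longlonglongrightarrow> (indicator (\<Union>i. A i) x :: complex)"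
          by (intro AE_I2 LIMSEQ_indicator_UN)
        have "(\<Union>i<k. A i) \<in> sets borel" "(\<Union>i. A i) \<in> sets borel" for k using A by auto
        then show "indicator (\<Union>i<k. A i) \<in> borel_measurable torus"
          "(indicator (\<Union>i. A i) :: _ \<Rightarrow> complex) \<in> borel_measurable torus" for k :: nat
          by (intro measurable_torusI borel_measurable_indicator; simp)+
      qed (simp add: indicator_def)
    qed
  qed
  show ?thesis
  proof
    fix f :: "real ^ 'n \<Rightarrow> 'a L2" assume f: "f \<in> Lp (ennreal q) torus"
    note [measurable] = f
    obtain s where s: "\<And>i. simple_function torus (s i)"
      "\<And>x. x \<in> space torus \<Longrightarrow> (\<lambda>i. s i x) \<longlonglongrightarrow> f x"
      "\<And>i x. x \<in> space torus \<Longrightarrow> norm (s i x) \<le> 2 * norm (f x)"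
      using borel_measurable_implies_sequence_metric[OF Lp_measurable[OF f], of 0]
      unfolding dist_norm diff_0_right by blast
    define A where "A i y = s i -` {y} \<inter> space torus" for i y
    have A: "A i y \<in> sets borel" for i y
    proof -
      have "A i y \<in> sets torus" unfolding A_def by (rule simple_functionD(2)[OF s(1)])
      then show ?thesis unfolding torus_def by (subst (asm) sets_restrict_space_iff) auto
    qed
    \<comment> \<open>This agrees with \<open>s i\<close> on the cube and is visibly a finite
      combination of indicators of Borel sets.\<close>
    define t where "t i x = (\<Sum>y\<in>s i ` space torus. indicator (A i y) x *\<^sub>C y)" for i x
    have fin: "finite (s i ` space torus)" for i using simple_functionD(1)[OF s(1)] .
    have tN: "t i \<in> N" for i
    proof -
      have "(\<lambda>x. \<Sum>y\<in>Y. indicator (A i y) x *\<^sub>C y) \<in> N" if "finite Y" for Y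
        using that
      proof induction
        case empty then show ?case using zero by simp
      next
        case (insert y Y)
        then show ?case using add[OF borel[OF A[of i y]] insert.IH] by simp
      qed
      then show ?thesis using fin by (simp add: t_def[abs_def])
    qed
    have ts: "t i x = s i x" if "x \<in> space torus" for i x
    proof -
      have "t i x = (\<Sum>y\<in>s i ` space torus. if y = s i x then y else 0)"
        unfolding t_def by (rule sum.cong) (use that in \<open>auto simp: A_def indicator_def cscale.zero_left\<close>)
      then show ?thesis using fin that by simp
    qed
    have t_meas: "t i \<in> borel_measurable torus" for i
      using borel_measurable_simple_function[OF s(1)[of i]] ts by (simp cong: measurable_cong)
    have G: "(\<lambda>x. 2 * norm (f x)) \<in> Lp (ennreal q) torus"
      by (rule Lp_scale(1)[OF q f, of _ 2]) auto
    have a1: "AE x in torus. (\<lambda>i. t i x) \<longlonglongrightarrow> f x" using s(2) ts by (intro AE_I2) simp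
    have a2: "AE x in torus. norm (t i x) \<le> 2 * norm (f x)" for i using s(3) ts by (intro AE_I2) simp
    note dc = Lp_dominated_convergence[where F = t and f = f, OF q G t_meas Lp_measurable[OF f] a1 a2]
    show "f \<in> N" by (rule closed[OF tN dc(2) f dc(3)])
  qed
qed

section \<open>Nuclear operators and their symbols\<close>

text \<open>The terms tend to 0, so eventually they are at most 1, and there a <= a^s because s <=
  1. Thus s-summability gives absolute convergence.\<close>

lemma summable_of_powr:
  fixes a :: "nat \<Rightarrow> real"
  assumes "\<And>k. 0 \<le> a k" "0 < s" "s \<le> 1" and sm: "summable (\<lambda>k. a k powr s)"
  shows "summable a"
proof (rule summable_comparison_test_ev[OF _ sm])
  have "(\<lambda>k. a k powr s) \<longlonglongrightarrow> 0" by (rule summable_LIMSEQ_zero[OF sm])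
  then have "\<forall>\<^sub>F k in sequentially. a k powr s < 1" by (rule order_tendstoD) simp
  then show "\<forall>\<^sub>F k in sequentially. norm (a k) \<le> a k powr s"
  proof eventually_elim
    case (elim k)
    have "a k \<le> 1"
    proof (rule ccontr)
      assume "\<not> a k \<le> 1"
      then have "1 \<le> a k powr s" using assms(2) by (intro ge_one_powr_ge_zero) auto
      then show False using elim by simp
    qed
    then have "a k powr 1 \<le> a k powr s" using assms by (intro powr_mono') auto
    then show ?case using assms(1)[of k] by simp
  qed
qed

lemma Lp_norm_cscale:
  fixes f :: "'x \<Rightarrow> 'a::L2_measure L2"
  assumes "1 \<le> q" "f \<in> Lp (ennreal q) M"
  shows "(\<lambda>x. c *\<^sub>C f x) \<in> Lp (ennreal q) M"
    "Lp_norm (ennreal q) M (\<lambda>x. c *\<^sub>C f x) = cmod c * Lp_norm (ennreal q) M f"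
  using Lp_scale[OF assms, of "\<lambda>x. c *\<^sub>C f x" "cmod c"] assms
  by (simp_all add: norm_cscale Lp_measurable)

lemma (in prob_space) Lp_cscale_series:
  fixes h :: "nat \<Rightarrow> 'a \<Rightarrow> 'c::L2_measure L2"
  assumes q: "1 \<le> q" and h: "\<And>k. h k \<in> Lp (ennreal q) M"
    and sm: "summable (\<lambda>k. cmod (c k) * Lp_norm (ennreal q) M (h k))"
  shows "(\<lambda>x. \<Sum>k. c k *\<^sub>C h k x) \<in> Lp (ennreal q) M"
    "(\<lambda>N. Lp_norm (ennreal q) M (\<lambda>x. (\<Sum>k. c k *\<^sub>C h k x) - (\<Sum>k<N. c k *\<^sub>C h k x))) \<longlonglongrightarrow> 0"
  using Lp_series[OF q Lp_norm_cscale(1)[OF q h]] sm by (auto simp: Lp_norm_cscale(2)[OF q h])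

lemma (in prob_space) Lp_cscale_sum:
  fixes h :: "nat \<Rightarrow> 'a \<Rightarrow> 'c::L2_measure L2"
  assumes q: "1 \<le> q" and h: "\<And>k. h k \<in> Lp (ennreal q) M"
  shows "(\<lambda>x. \<Sum>k\<in>I. c k *\<^sub>C h k x) \<in> Lp (ennreal q) M"
    "Lp_norm (ennreal q) M (\<lambda>x. \<Sum>k\<in>I. c k *\<^sub>C h k x) \<le> (\<Sum>k\<in>I. cmod (c k) * Lp_norm (ennreal q) M (h k))"
  using Lp_sum[OF q, of I "\<lambda>k x. c k *\<^sub>C h k x" M] Lp_norm_cscale[OF q h] by simp_all

text \<open>The pairing has no conjugate, so a character of frequency \<xi> picks out the
  coefficient at -\<xi>. This is where the sign in the formula for the symbol comes from.\<close>

lemma fourier_pairing: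
  assumes g: "integrable torus g"
  shows "(\<integral>x. L2_pair (g x) (character \<xi> x *\<^sub>C v) \<partial>torus) = L2_pair (fourier g (- \<xi>)) v"
proof -
  have m [measurable]: "g \<in> borel_measurable torus" using g by simp
  have i: "integrable torus (\<lambda>x. character \<xi> x *\<^sub>C g x)"
    by (rule Bochner_Integration.integrable_bound[OF g]) (auto simp: norm_cscale)
  have "fourier g (- \<xi>) = (\<integral>x. character \<xi> x *\<^sub>C g x \<partial>torus)"
    by (simp add: fourier_def character_def dot_uminus_right)
  then have "L2_pair (fourier g (- \<xi>)) v = (\<integral>x. L2_pair (character \<xi> x *\<^sub>C g x) v \<partial>torus)"
    using integral_bounded_linear[OF L2_pair.bounded_linear_left i, of v] by simp
  then show ?thesis by (simp add: L2_pair_cscale_left L2_pair_cscale_right)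
qed

lemma norm_fourier_le: "norm (fourier g \<xi>) \<le> (\<integral>x. norm (g x) \<partial>torus)"
  unfolding fourier_def by (rule order_trans[OF integral_norm_bound]) (simp add: norm_cscale)

lemma character_in_Lp: "1 \<le> q \<Longrightarrow> (\<lambda>x. character \<xi> x *\<^sub>C v) \<in> Lp (ennreal q) torus"
  by (rule torus.Lp_bounded[of _ "norm v"]) (auto simp: norm_cscale intro!: measurable_torusI)

text \<open>Bounded operators agree on a closed set. Density is phrased by open sets, the form in
  which a second countable space supplies a countable dense set.\<close>

lemma L2_dense_eq:
  fixes A B :: "'a::L2_measure L2 \<Rightarrow>\<^sub>L 'a L2"
  assumes D: "\<And>U. open U \<Longrightarrow> U \<noteq> {} \<Longrightarrow> \<exists>d\<in>D. d \<in> U"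
    and eq: "\<And>d. d \<in> D \<Longrightarrow> blinfun_apply A d = blinfun_apply B d"
  shows "A = B"
proof (rule blinfun_eqI, rule ccontr)
  fix v assume v: "blinfun_apply A v \<noteq> blinfun_apply B v"
  have "closed {v. blinfun_apply A v = blinfun_apply B v}"
    by (intro closed_Collect_eq continuous_intros)
  then have "open {v. blinfun_apply A v \<noteq> blinfun_apply B v}" by (simp add: closed_def Collect_neg_eq)
  then show False using D[of "{v. blinfun_apply A v \<noteq> blinfun_apply B v}"] v eq by auto
qed

section \<open>From a nuclear representation to the symbol\<close>

lemma nuclear_symbol:
  fixes T :: "(real ^ 'n \<Rightarrow> 'a::L2_measure L2) \<Rightarrow> (real ^ 'n \<Rightarrow> 'a L2)"
  assumes s: "0 < s" "s \<le> 1"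
    and p: "1 \<le> p" "p < \<infinity>" "1 / p + 1 / p' = 1"
    and psd: "pseudo_diff_operator p \<sigma> T" and nuc: "s_nuclear s p torus T"
  shows "\<exists>g h. (\<forall>k::nat. g k \<in> Lp p' torus) \<and> (\<forall>k. h k \<in> Lp p torus) \<and>
       summable (\<lambda>k. Lp_norm p torus (h k) powr s * Lp_norm p' torus (g k) powr s) \<and>
       (AE x in torus. \<forall>\<xi>.
          summable (\<lambda>k. tensor (h k x) (fourier (g k) (- \<xi>))) \<and>
          \<sigma> x \<xi> = cscale_op (cis (- 2 * pi * dot x \<xi>)) (\<Sum>k. tensor (h k x) (fourier (g k) (- \<xi>))))"
proof -
  obtain q where pq: "p = ennreal q" and q: "1 \<le> q"
    using p by (cases rule: conjugate_exponents) auto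
  obtain \<phi> \<psi> where \<phi>: "\<And>k::nat. \<phi> k \<in> Lp_dual p torus" and \<psi>: "\<And>k. \<psi> k \<in> Lp p torus"
    and sm: "summable (\<lambda>k. Lp_dual_norm p torus (\<phi> k) powr s * Lp_norm p torus (\<psi> k) powr s)"
    and conv: "\<And>f. f \<in> Lp p torus \<Longrightarrow>
      (\<lambda>N. Lp_norm p torus (\<lambda>x. T f x - (\<Sum>k<N. \<phi> k f *\<^sub>C \<psi> k x))) \<longlonglongrightarrow> 0"
    using nuc unfolding s_nuclear_def by blast
  define D where "D k = Lp_dual_norm p torus (\<phi> k)" for k
  have D0: "0 \<le> D k" for k unfolding D_def pq using \<phi> q pq by (intro Lp_dual_bound(1)) auto
  have "\<exists>g. g \<in> Lp p' torus \<and> Lp_norm p' torus g \<le> D k \<and>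
    (\<forall>w B. w \<in> borel_measurable torus \<longrightarrow> (\<forall>x. norm (w x) \<le> B) \<longrightarrow> \<phi> k w = (\<integral>x. L2_pair (g x) (w x) \<partial>torus))" for k
    by (rule torus.Lp_dual_representation[OF p \<phi>[of k]]) (auto simp: D_def)
  then have "\<forall>k. \<exists>g. g \<in> Lp p' torus \<and> Lp_norm p' torus g \<le> D k \<and>
    (\<forall>w B. w \<in> borel_measurable torus \<longrightarrow> (\<forall>x. norm (w x) \<le> B) \<longrightarrow> \<phi> k w = (\<integral>x. L2_pair (g x) (w x) \<partial>torus))" ..
  from choice[OF this] obtain g where g: "\<And>k. g k \<in> Lp p' torus" and gD: "\<And>k. Lp_norm p' torus (g k) \<le> D k"
    and rep: "\<And>k w B. w \<in> borel_measurable torus \<Longrightarrow> (\<And>x. norm (w x) \<le> B) \<Longrightarrow>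
      \<phi> k w = (\<integral>x. L2_pair (g k x) (w x) \<partial>torus)" by blast
  note gi = torus.Lp_conj_integrable[OF p g]
  have smg: "summable (\<lambda>k. Lp_norm p torus (\<psi> k) powr s * Lp_norm p' torus (g k) powr s)"
  proof (rule summable_comparison_test'[OF sm, of 0])
    fix k
    have le: "Lp_norm p' torus (g k) powr s \<le> D k powr s" using gD gi(3) s by (intro powr_mono2) auto
    show "norm (Lp_norm p torus (\<psi> k) powr s * Lp_norm p' torus (g k) powr s)
        \<le> Lp_dual_norm p torus (\<phi> k) powr s * Lp_norm p torus (\<psi> k) powr s"
      using mult_right_mono[OF le, of "Lp_norm p torus (\<psi> k) powr s"] by (simp add: D_def mult.commute)
  qed
  have smD: "summable (\<lambda>k. D k * Lp_norm p torus (\<psi> k))"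
    by (rule summable_of_powr[OF _ s]) (use sm D0 in \<open>simp_all add: D_def powr_mult pq\<close>)
  \<comment> \<open>The majorant involves neither a frequency nor a vector, so one null set settles
    convergence in operator norm at all frequencies.\<close>
  have AEs: "AE x in torus. summable (\<lambda>k. D k * norm (\<psi> k x))"
  proof -
    have L: "(\<lambda>x. complex_of_real (D k) *\<^sub>C \<psi> k x) \<in> Lp (ennreal q) torus"
      "Lp_norm (ennreal q) torus (\<lambda>x. complex_of_real (D k) *\<^sub>C \<psi> k x) = D k * Lp_norm p torus (\<psi> k)" for k
      using Lp_norm_cscale[OF q, of "\<psi> k" torus "complex_of_real (D k)"] \<psi>[of k] D0[of k] by (auto simp: pq)
    have "AE x in torus. summable (\<lambda>k. norm (complex_of_real (D k) *\<^sub>C \<psi> k x))"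
      by (rule torus.Lp_summable_AE[OF q L(1)]) (simp add: L(2) smD)
    then show ?thesis by (simp add: norm_cscale D0)
  qed
  have ST: "summable (\<lambda>k. tensor (\<psi> k x) (fourier (g k) (- \<xi>)))"
    if "summable (\<lambda>k. D k * norm (\<psi> k x))" for x \<xi>
  proof (rule summable_comparison_test'[OF that, of 0])
    fix k
    have "norm (fourier (g k) (- \<xi>)) \<le> D k"
      using norm_fourier_le[of "g k" "- \<xi>"] gi(2)[of k] gD[of k] by linarith
    then have "norm (\<psi> k x) * norm (fourier (g k) (- \<xi>)) \<le> norm (\<psi> k x) * D k" by (intro mult_left_mono) auto
    then show "norm (tensor (\<psi> k x) (fourier (g k) (- \<xi>))) \<le> D k * norm (\<psi> k x)"
      using norm_tensor_le[of "\<psi> k x" "fourier (g k) (- \<xi>)"] by (simp add: mult.commute)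
  qed
  \<comment> \<open>Here the null set depends on \<open>\<xi>\<close> and \<open>v\<close>; the
    uniform statement has to wait for the countable dense set \<open>X\<close>.\<close>
  have key: "AE x in torus. character \<xi> x *\<^sub>C blinfun_apply (\<sigma> x \<xi>) v =
      blinfun_apply (\<Sum>k. tensor (\<psi> k x) (fourier (g k) (- \<xi>))) v" for \<xi> v
  proof -
    let ?f = "\<lambda>x. character \<xi> x *\<^sub>C v"
    have f: "?f \<in> Lp p torus" unfolding pq by (rule character_in_Lp[OF q])
    have \<phi>f: "\<phi> k ?f = L2_pair (fourier (g k) (- \<xi>)) v" for k
      using rep[of ?f "norm v" k] fourier_pairing[OF gi(1)[of k], of \<xi> v] f
      by (simp add: norm_cscale Lp_measurable)
    have le: "cmod (\<phi> k ?f) * Lp_norm p torus (\<psi> k) \<le> norm v * (D k * Lp_norm p torus (\<psi> k))" for k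
    proof -
      have "cmod (\<phi> k ?f) \<le> norm (fourier (g k) (- \<xi>)) * norm v" unfolding \<phi>f by (rule norm_L2_pair_le)
      also have "\<dots> \<le> D k * norm v"
        using norm_fourier_le[of "g k" "- \<xi>"] gi(2)[of k] gD[of k] by (intro mult_right_mono) auto
      finally have "cmod (\<phi> k ?f) * Lp_norm p torus (\<psi> k) \<le> D k * norm v * Lp_norm p torus (\<psi> k)"
        by (rule mult_right_mono) (simp add: pq)
      then show ?thesis by (simp add: mult_ac)
    qed
    have "summable (\<lambda>k. cmod (\<phi> k ?f) * Lp_norm p torus (\<psi> k))"
      by (rule summable_comparison_test'[OF summable_mult[OF smD, of "norm v"], of 0])
        (use le in \<open>auto simp: abs_mult pq\<close>)
    note ser = torus.Lp_cscale_series[OF q, of \<psi> "\<lambda>k. \<phi> k ?f", folded pq, OF \<psi> this]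
    let ?S = "\<lambda>x. \<Sum>k. \<phi> k ?f *\<^sub>C \<psi> k x"
    have Tf: "T ?f \<in> Lp p torus" using psd f by (simp add: pseudo_diff_operator_def Lp_bounded_operator_def)
    let ?U = "\<lambda>N x. \<Sum>k<N. \<phi> k ?f *\<^sub>C \<psi> k x"
    have U: "?U N \<in> Lp p torus" for N by (rule torus.Lp_cscale_sum(1)[OF q, folded pq, OF \<psi>])
    have comm: "Lp_norm p torus (\<lambda>x. ?U N x - ?S x) = Lp_norm p torus (\<lambda>x. ?S x - ?U N x)" for N
      unfolding pq by (rule Lp_norm_minus_commute)
    \<comment> \<open>The partial sums converge in L^p both to the image under \<open>T\<close> and
      to the pointwise series, so the two limits agree almost everywhere.\<close>
    have "Lp_norm p torus (\<lambda>x. T ?f x - ?S x) \<le> Lp_norm p torus (\<lambda>x. T ?f x - ?U N x)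
        + Lp_norm p torus (\<lambda>x. ?S x - ?U N x)" for N
      using Lp_triangle[OF q, folded pq, OF Tf U ser(1), of N] unfolding comm .
    then have "Lp_norm p torus (\<lambda>x. T ?f x - ?S x) \<le> 0"
      by (intro LIMSEQ_le_const[OF tendsto_add[OF conv[OF f] ser(2), simplified]]) auto
    moreover have "0 \<le> Lp_norm p torus (\<lambda>x. T ?f x - ?S x)" unfolding pq by (rule Lp_norm_nonneg)
    ultimately have "Lp_norm p torus (\<lambda>x. T ?f x - ?S x) = 0" by (rule antisym)
    then have "AE x in torus. T ?f x - ?S x = 0"
      using Lp_norm_eq_0_iff[OF q Lp_diff(1)[OF q Tf[unfolded pq] ser(1)[unfolded pq]]] by (simp add: pq)
    then show ?thesis using pseudo_diff_operator_character[OF psd, of \<xi> v] AEs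
    proof eventually_elim
      case (elim x)
      have "blinfun_apply (\<Sum>k. tensor (\<psi> k x) (fourier (g k) (- \<xi>))) v = (\<Sum>k. \<phi> k ?f *\<^sub>C \<psi> k x)"
        using bounded_linear.suminf[OF blinfun.bounded_linear_left ST[OF elim(3), of \<xi>], of v] by (simp add: \<phi>f)
      then show ?case using elim by simp
    qed
  qed
  obtain X :: "'a L2 set" where X: "countable X" "\<And>U. open U \<Longrightarrow> U \<noteq> {} \<Longrightarrow> \<exists>d\<in>X. d \<in> U"
    using countable_dense_setE[where 'a = "'a L2"] by blast
  have "AE x in torus. \<forall>\<xi>. \<forall>v\<in>X. character \<xi> x *\<^sub>C blinfun_apply (\<sigma> x \<xi>) v =
      blinfun_apply (\<Sum>k. tensor (\<psi> k x) (fourier (g k) (- \<xi>))) v"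
    unfolding AE_all_countable AE_ball_countable[OF X(1)] using key by blast
  then have "AE x in torus. \<forall>\<xi>. summable (\<lambda>k. tensor (\<psi> k x) (fourier (g k) (- \<xi>))) \<and>
      \<sigma> x \<xi> = cscale_op (cis (- 2 * pi * dot x \<xi>)) (\<Sum>k. tensor (\<psi> k x) (fourier (g k) (- \<xi>)))"
    using AEs
  proof eventually_elim
    case (elim x)
    show ?case
    proof (intro allI conjI ST elim(2) L2_dense_eq[OF X(2)])
      fix \<xi> v assume v: "v \<in> X"
      have one: "cis (- 2 * pi * dot x \<xi>) * character \<xi> x = 1"
        by (simp add: character_def cis_mult)
      have eq: "character \<xi> x *\<^sub>C blinfun_apply (\<sigma> x \<xi>) v =
          blinfun_apply (\<Sum>k. tensor (\<psi> k x) (fourier (g k) (- \<xi>))) v" using elim(1) v by blast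
      show "blinfun_apply (\<sigma> x \<xi>) v = blinfun_apply (cscale_op (cis (- 2 * pi * dot x \<xi>)) (\<Sum>k. tensor (\<psi> k x) (fourier (g k) (- \<xi>)))) v"
        unfolding cscale_op_apply eq[symmetric] cscale_cscale one by simp
    qed
  qed
  then show ?thesis using g \<psi> smg by blast
qed

section \<open>From the symbol to a nuclear representation\<close>

lemma symbol_nuclear:
  fixes T :: "(real ^ 'n \<Rightarrow> 'a::L2_measure L2) \<Rightarrow> (real ^ 'n \<Rightarrow> 'a L2)"
  assumes s: "0 < s" "s \<le> 1"
    and p: "1 \<le> p" "p < \<infinity>" "1 / p + 1 / p' = 1"
    and psd: "pseudo_diff_operator p \<sigma> T"
    and g: "\<And>k::nat. g k \<in> Lp p' torus" and h: "\<And>k. h k \<in> Lp p torus"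
    and sm: "summable (\<lambda>k. Lp_norm p torus (h k) powr s * Lp_norm p' torus (g k) powr s)"
    and symb: "AE x in torus. \<forall>\<xi>.
          summable (\<lambda>k. tensor (h k x) (fourier (g k) (- \<xi>))) \<and>
          \<sigma> x \<xi> = cscale_op (cis (- 2 * pi * dot x \<xi>)) (\<Sum>k. tensor (h k x) (fourier (g k) (- \<xi>)))"
  shows "s_nuclear s p torus T"
proof -
  obtain q where pq: "p = ennreal q" and q: "1 \<le> q"
    using p by (cases rule: conjugate_exponents) auto
  let ?N = "Lp_norm p torus :: (real ^ 'n \<Rightarrow> 'a L2) \<Rightarrow> real"
  have N0: "0 \<le> ?N f" for f unfolding pq by (rule Lp_norm_nonneg)
  note Nadd = Lp_add[OF q, folded pq] and Ndiff = Lp_diff[OF q, folded pq]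
    and Ncs = Lp_norm_cscale[OF q, folded pq] and Ntri = Lp_triangle[OF q, folded pq]
    and Ncsum = torus.Lp_cscale_sum[OF q, folded pq] and Nser = torus.Lp_cscale_series[OF q, folded pq]
  have Ncomm: "?N (\<lambda>x. f x - g x) = ?N (\<lambda>x. g x - f x)" for f g unfolding pq by (rule Lp_norm_minus_commute)
  have bT: "Lp_bounded_operator p torus T" using psd by (simp add: pseudo_diff_operator_def)
  have Tin: "T f \<in> Lp p torus" if "f \<in> Lp p torus" for f using bT that by (simp add: Lp_bounded_operator_def)
  have Tadd: "AE x in torus. T (\<lambda>x. f x + f' x) x = T f x + T f' x" if "f \<in> Lp p torus" "f' \<in> Lp p torus" for f f'
    using bT that by (simp add: Lp_bounded_operator_def)
  have Tscale: "AE x in torus. T (\<lambda>x. c *\<^sub>C f x) x = c *\<^sub>C T f x" if "f \<in> Lp p torus" for c f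
    using bT that by (simp add: Lp_bounded_operator_def)
  have "\<exists>C. \<forall>f\<in>Lp p torus. ?N (T f) \<le> C * ?N f" using bT by (simp add: Lp_bounded_operator_def)
  then obtain C' where C': "\<And>f. f \<in> Lp p torus \<Longrightarrow> ?N (T f) \<le> C' * ?N f" by blast
  define C where "C = \<bar>C'\<bar>"
  have C: "?N (T f) \<le> C * ?N f" if "f \<in> Lp p torus" for f
    using C'[OF that] mult_right_mono[OF abs_ge_self[of C'] N0[of f]] by (simp add: C_def)
  \<comment> \<open>\<open>T\<close> acts on functions and is additive only almost everywhere, so
    its linearity is used through norms.\<close>
  have Tdiff: "?N (\<lambda>x. T f x - T f' x) \<le> C * ?N (\<lambda>x. f x - f' x)" if f: "f \<in> Lp p torus" "f' \<in> Lp p torus" for f f'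
  proof -
    have d: "(\<lambda>x. f x - f' x) \<in> Lp p torus" by (rule Ndiff(1)[OF f])
    have "AE x in torus. norm (T f x - T f' x) = norm (T (\<lambda>x. f x - f' x) x)"
      using Tadd[OF f(2) d] by eventually_elim simp
    then have "?N (\<lambda>x. T f x - T f' x) = ?N (T (\<lambda>x. f x - f' x))"
      using Lp_norm_cong(2)[OF q, of "T (\<lambda>x. f x - f' x)" torus "\<lambda>x. T f x - T f' x"]
        Tin[OF d] Ndiff(1)[OF Tin[OF f(1)] Tin[OF f(2)]] by (simp add: pq Lp_measurable)
    then show ?thesis using C[OF d] by simp
  qed

  define \<phi> where "\<phi> k f = (\<integral>x. L2_pair (g k x) (f x) \<partial>torus)" for k f
  define G where "G k = Lp_norm p' torus (g k)" for k
  define H where "H k = ?N (h k)" for k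
  have G0: "0 \<le> G k" for k unfolding G_def by (rule torus.Lp_conj_integrable(3)[OF p g])
  have H0: "0 \<le> H k" for k unfolding H_def by (rule N0)
  have pi: "integrable torus (\<lambda>x. L2_pair (g k x) (f x))" and \<phi>le: "cmod (\<phi> k f) \<le> G k * ?N f"
    if f: "f \<in> Lp p torus" for k f
  proof -
    note [measurable] = g[THEN Lp_measurable] f[THEN Lp_measurable]
    note Ho = Hoelder[OF p f g[of k]]
    have le: "cmod (L2_pair (g k x) (f x)) \<le> norm (f x) * norm (g k x)" for x
      using norm_L2_pair_le[of "g k x" "f x"] by (simp add: mult.commute)
    show i: "integrable torus (\<lambda>x. L2_pair (g k x) (f x))"
      by (rule Bochner_Integration.integrable_bound[OF Ho(1)]) (use le in auto)
    have "cmod (\<phi> k f) \<le> (\<integral>x. cmod (L2_pair (g k x) (f x)) \<partial>torus)" unfolding \<phi>_def by (rule integral_norm_bound)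
    also have "\<dots> \<le> (\<integral>x. norm (f x) * norm (g k x) \<partial>torus)" by (intro integral_mono integrable_norm i Ho(1) le)
    also have "\<dots> \<le> G k * ?N f" using Ho(2) by (simp add: G_def mult.commute)
    finally show "cmod (\<phi> k f) \<le> G k * ?N f" .
  qed
  have \<phi>add: "\<phi> k (\<lambda>x. f x + f' x) = \<phi> k f + \<phi> k f'" if "f \<in> Lp p torus" "f' \<in> Lp p torus" for k f f'
    unfolding \<phi>_def L2_pair.add_right by (intro Bochner_Integration.integral_add pi that)
  have \<phi>diff: "\<phi> k (\<lambda>x. f x - f' x) = \<phi> k f - \<phi> k f'" if "f \<in> Lp p torus" "f' \<in> Lp p torus" for k f f'
    unfolding \<phi>_def L2_pair.diff_right by (intro Bochner_Integration.integral_diff pi that)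
  have \<phi>scale: "\<phi> k (\<lambda>x. c *\<^sub>C f x) = c * \<phi> k f" for k c f
    unfolding \<phi>_def L2_pair_cscale_right by simp
  have \<phi>dual: "\<phi> k \<in> Lp_dual p torus" for k
    unfolding Lp_dual_def using \<phi>add \<phi>scale \<phi>le by blast
  have dual_le: "Lp_dual_norm p torus (\<phi> k) \<le> G k" for k
    unfolding Lp_dual_norm_def
  proof (rule cSUP_least)
    have "(\<lambda>_. 0) \<in> {f \<in> Lp p torus. ?N f \<le> 1}" by (simp add: pq Lp_zero[OF q] Lp_norm_zero[OF q])
    then show "{f \<in> Lp p torus. ?N f \<le> 1} \<noteq> {}" by blast
    fix f assume f: "f \<in> {f \<in> Lp p torus. ?N f \<le> 1}"
    then have "cmod (\<phi> k f) \<le> G k * ?N f" by (intro \<phi>le) simp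
    also have "\<dots> \<le> G k * 1" using f G0 by (intro mult_left_mono) auto
    finally show "cmod (\<phi> k f) \<le> G k" by simp
  qed
  have sm1: "summable (\<lambda>k. Lp_dual_norm p torus (\<phi> k) powr s * ?N (h k) powr s)"
  proof (rule summable_comparison_test'[OF sm, of 0])
    fix k
    have "0 \<le> Lp_dual_norm p torus (\<phi> k)" by (rule Lp_dual_bound(1)[OF q, folded pq, OF \<phi>dual])
    then have le: "Lp_dual_norm p torus (\<phi> k) powr s \<le> G k powr s" using dual_le s by (intro powr_mono2) auto
    show "norm (Lp_dual_norm p torus (\<phi> k) powr s * ?N (h k) powr s) \<le> ?N (h k) powr s * Lp_norm p' torus (g k) powr s"
      using mult_right_mono[OF le, of "?N (h k) powr s"] by (simp add: G_def mult.commute)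
  qed
  have smGH: "summable (\<lambda>k. G k * H k)"
    by (rule summable_of_powr[OF _ s]) (use sm G0 H0 in \<open>simp_all add: G_def H_def powr_mult mult.commute\<close>)
  \<comment> \<open>Applied to two kinds of coefficients: the values of the functionals at one
    function, and the limits of such values along a bounded sequence.\<close>
  have smc: "summable (\<lambda>k. cmod (c k) * ?N (h k))" if "\<And>k. cmod (c k) \<le> B * G k" for c :: "nat \<Rightarrow> complex" and B
  proof (rule summable_comparison_test'[OF summable_mult[OF smGH, of B], of 0])
    fix k
    have "cmod (c k) * H k \<le> B * G k * H k" by (intro mult_right_mono that H0)
    then show "norm (cmod (c k) * ?N (h k)) \<le> B * (G k * H k)" using N0[of "h k"] by (simp add: H_def mult.assoc)
  qed
  \<comment> \<open>A bound for the partial sums \<open>S n\<close> on L^p that is uniform in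
    \<open>n\<close>; together with the bound \<open>C\<close> of \<open>T\<close> it makes
    \<open>R\<close> closed.\<close>
  define K where "K = (\<Sum>k. G k * H k)"

  define S where "S n f x = (\<Sum>k<n. \<phi> k f *\<^sub>C h k x)" for n f and x :: "real ^ 'n"
  have Sin: "S n f \<in> Lp p torus" for n f unfolding S_def[abs_def] by (rule Ncsum(1)[OF h])
  have Sle: "?N (S n f) \<le> K * ?N f" if f: "f \<in> Lp p torus" for n f
  proof -
    have "?N (S n f) \<le> (\<Sum>k<n. cmod (\<phi> k f) * ?N (h k))" unfolding S_def[abs_def] by (rule Ncsum(2)[OF h])
    also have "\<dots> \<le> (\<Sum>k<n. G k * H k * ?N f)"
    proof (rule sum_mono)
      fix k show "cmod (\<phi> k f) * ?N (h k) \<le> G k * H k * ?N f"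
        using mult_right_mono[OF \<phi>le[OF f, of k] H0[of k]] by (simp add: H_def mult_ac)
    qed
    also have "\<dots> = (\<Sum>k<n. G k * H k) * ?N f" by (simp add: sum_distrib_right)
    also have "\<dots> \<le> K * ?N f"
      unfolding K_def using G0 H0 N0 by (intro mult_right_mono sum_le_suminf smGH) auto
    finally show ?thesis .
  qed
  define R where "R = {f \<in> Lp p torus. (\<lambda>n. ?N (\<lambda>x. T f x - S n f x)) \<longlonglongrightarrow> 0}"
  have Rin: "f \<in> R" if "f \<in> Lp p torus" "\<And>n. ?N (\<lambda>x. T f x - S n f x) \<le> e n" "e \<longlonglongrightarrow> 0" for f e
    using that(1) tendsto_sandwich[OF always_eventually always_eventually tendsto_const that(3), of "\<lambda>n. ?N (\<lambda>x. T f x - S n f x)"]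
      that(2) N0 by (auto simp: R_def)
  have "Lp p torus \<subseteq> R"
  proof (rule Lp_torus_density[OF q, folded pq])
    fix \<xi> :: "int ^ 'n" and v :: "'a L2"
    let ?f = "\<lambda>x. character \<xi> x *\<^sub>C v"
    have f: "?f \<in> Lp p torus" unfolding pq by (rule character_in_Lp[OF q])
    have ser: "(\<lambda>x. \<Sum>k. \<phi> k ?f *\<^sub>C h k x) \<in> Lp p torus"
      "(\<lambda>n. ?N (\<lambda>x. (\<Sum>k. \<phi> k ?f *\<^sub>C h k x) - S n ?f x)) \<longlonglongrightarrow> 0"
      unfolding S_def
      using Nser[OF h smc[of "\<lambda>k. \<phi> k ?f" "?N ?f"]] \<phi>le[OF f] by (simp_all add: mult.commute)
    have "AE x in torus. T ?f x = (\<Sum>k. \<phi> k ?f *\<^sub>C h k x)"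
      using pseudo_diff_operator_character[OF psd, of \<xi> v] symb
    proof eventually_elim
      case (elim x)
      have sx: "summable (\<lambda>k. tensor (h k x) (fourier (g k) (- \<xi>)))"
        and e: "\<sigma> x \<xi> = cscale_op (cis (- 2 * pi * dot x \<xi>)) (\<Sum>k. tensor (h k x) (fourier (g k) (- \<xi>)))"
        using elim(2) by auto
      have "\<phi> k ?f = L2_pair (fourier (g k) (- \<xi>)) v" for k
        unfolding \<phi>_def by (rule fourier_pairing[OF torus.Lp_conj_integrable(1)[OF p g]])
      then have "(\<Sum>k. \<phi> k ?f *\<^sub>C h k x) = blinfun_apply (\<Sum>k. tensor (h k x) (fourier (g k) (- \<xi>))) v"
        using bounded_linear.suminf[OF blinfun.bounded_linear_left sx, of v] by simp
      moreover have "character \<xi> x * cis (- 2 * pi * dot x \<xi>) = 1"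
        by (simp add: character_def cis_mult)
      ultimately show ?case unfolding elim(1) e by (simp add: cscale_cscale)
    qed
    then have "AE x in torus. norm (T ?f x - S n ?f x) = norm ((\<Sum>k. \<phi> k ?f *\<^sub>C h k x) - S n ?f x)" for n
      by eventually_elim simp
    then have "?N (\<lambda>x. T ?f x - S n ?f x) = ?N (\<lambda>x. (\<Sum>k. \<phi> k ?f *\<^sub>C h k x) - S n ?f x)" for n
      using Lp_norm_cong(2)[OF q, folded pq, OF Ndiff(1)[OF ser(1) Sin[of n ?f]]
          Lp_measurable[OF Ndiff(1)[OF Tin[OF f] Sin[of n ?f]]]] by simp
    then show "?f \<in> R" using f ser(2) by (simp add: R_def)
  next
    fix f f' assume "f \<in> R" "f' \<in> R"
    then have f: "f \<in> Lp p torus" "f' \<in> Lp p torus"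
      and lim: "(\<lambda>n. ?N (\<lambda>x. T f x - S n f x)) \<longlonglongrightarrow> 0" "(\<lambda>n. ?N (\<lambda>x. T f' x - S n f' x)) \<longlonglongrightarrow> 0"
      by (auto simp: R_def)
    note d = Ndiff(1)[OF Tin[OF f(1)] Sin[of _ f]] Ndiff(1)[OF Tin[OF f(2)] Sin[of _ f']]
    have ff: "(\<lambda>x. f x + f' x) \<in> Lp p torus" by (rule Nadd(1)[OF f])
    show "(\<lambda>x. f x + f' x) \<in> R"
    proof (rule Rin[OF ff])
      show "(\<lambda>n. ?N (\<lambda>x. T f x - S n f x) + ?N (\<lambda>x. T f' x - S n f' x)) \<longlonglongrightarrow> 0"
        using tendsto_add[OF lim] by simp
      fix n
      have "S n (\<lambda>x. f x + f' x) x = S n f x + S n f' x" for x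
        by (simp add: S_def \<phi>add[OF f] cscale.add_left sum.distrib)
      then have "AE x in torus. norm (T (\<lambda>x. f x + f' x) x - S n (\<lambda>x. f x + f' x) x) =
          norm ((T f x - S n f x) + (T f' x - S n f' x))"
        using Tadd[OF f] by (auto elim!: eventually_mono simp: algebra_simps)
      then have "?N (\<lambda>x. T (\<lambda>x. f x + f' x) x - S n (\<lambda>x. f x + f' x) x) =
          ?N (\<lambda>x. (T f x - S n f x) + (T f' x - S n f' x))"
        by (intro Lp_norm_cong(2)[OF q, folded pq, OF Nadd(1)[OF d] Lp_measurable[OF Ndiff(1)[OF Tin[OF ff] Sin]]])
      also have "\<dots> \<le> ?N (\<lambda>x. T f x - S n f x) + ?N (\<lambda>x. T f' x - S n f' x)" by (rule Nadd(2)[OF d])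
      finally show "?N (\<lambda>x. T (\<lambda>x. f x + f' x) x - S n (\<lambda>x. f x + f' x) x)
        \<le> ?N (\<lambda>x. T f x - S n f x) + ?N (\<lambda>x. T f' x - S n f' x)" .
    qed
  next
    fix c f assume "f \<in> R"
    then have f: "f \<in> Lp p torus" and lim: "(\<lambda>n. ?N (\<lambda>x. T f x - S n f x)) \<longlonglongrightarrow> 0" by (auto simp: R_def)
    note d = Ndiff(1)[OF Tin[OF f] Sin[of _ f]]
    have cf: "(\<lambda>x. c *\<^sub>C f x) \<in> Lp p torus" by (rule Ncs(1)[OF f])
    show "(\<lambda>x. c *\<^sub>C f x) \<in> R"
    proof (rule Rin[OF cf])
      show "(\<lambda>n. cmod c * ?N (\<lambda>x. T f x - S n f x)) \<longlonglongrightarrow> 0" by (rule tendsto_mult_right_zero[OF lim])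
      fix n
      have "S n (\<lambda>x. c *\<^sub>C f x) x = c *\<^sub>C S n f x" for x
        by (simp add: S_def \<phi>scale cscale.sum_right cscale_cscale)
      then have "AE x in torus. norm (T (\<lambda>x. c *\<^sub>C f x) x - S n (\<lambda>x. c *\<^sub>C f x) x) = norm (c *\<^sub>C (T f x - S n f x))"
        using Tscale[OF f, of c] by (auto elim!: eventually_mono simp: cscale.diff_right)
      then have "?N (\<lambda>x. T (\<lambda>x. c *\<^sub>C f x) x - S n (\<lambda>x. c *\<^sub>C f x) x) = ?N (\<lambda>x. c *\<^sub>C (T f x - S n f x))"
        by (intro Lp_norm_cong(2)[OF q, folded pq, OF Ncs(1)[OF d] Lp_measurable[OF Ndiff(1)[OF Tin[OF cf] Sin]]])
      then show "?N (\<lambda>x. T (\<lambda>x. c *\<^sub>C f x) x - S n (\<lambda>x. c *\<^sub>C f x) x) \<le> cmod c * ?N (\<lambda>x. T f x - S n f x)"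
        by (simp add: Ncs(2)[OF d])
    qed
  next
    fix F f assume FR: "\<And>m. F m \<in> R" and f: "f \<in> Lp p torus"
      and lim: "(\<lambda>m. ?N (\<lambda>x. F m x - f x)) \<longlonglongrightarrow> 0"
    have F: "F m \<in> Lp p torus" for m using FR[of m] by (simp add: R_def)
    \<comment> \<open>Compare both operators at \<open>F m\<close>. The index \<open>m\<close> is
      fixed first, by the term with \<open>C + K\<close>; only then is \<open>n\<close> chosen,
      depending on \<open>m\<close>.\<close>
    have le: "?N (\<lambda>x. T f x - S n f x) \<le> (C + K) * ?N (\<lambda>x. F m x - f x) + ?N (\<lambda>x. T (F m) x - S n (F m) x)" for m n
    proof -
      have "S n (F m) x - S n f x = S n (\<lambda>x. F m x - f x) x" for x
        by (simp add: S_def \<phi>diff[OF F f] cscale.diff_left sum_subtractf)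
      then have "?N (\<lambda>x. S n (F m) x - S n f x) \<le> K * ?N (\<lambda>x. F m x - f x)"
        using Sle[OF Ndiff(1)[OF F f], of n m] by simp
      moreover have "?N (\<lambda>x. T f x - T (F m) x) \<le> C * ?N (\<lambda>x. F m x - f x)"
        using Tdiff[OF f F[of m]] by (simp add: Ncomm[of f])
      moreover have "?N (\<lambda>x. T f x - S n f x) \<le> ?N (\<lambda>x. T f x - T (F m) x) + ?N (\<lambda>x. T (F m) x - S n f x)"
        by (rule Ntri[OF Tin[OF f] Tin[OF F] Sin])
      moreover have "?N (\<lambda>x. T (F m) x - S n f x) \<le> ?N (\<lambda>x. T (F m) x - S n (F m) x) + ?N (\<lambda>x. S n (F m) x - S n f x)"
        by (rule Ntri[OF Tin[OF F] Sin Sin])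
      ultimately show ?thesis unfolding distrib_right by linarith
    qed
    have "(\<lambda>n. ?N (\<lambda>x. T f x - S n f x)) \<longlonglongrightarrow> 0"
    proof (rule LIMSEQ_I)
      fix e :: real assume e: "0 < e"
      have "(\<lambda>m. (C + K) * ?N (\<lambda>x. F m x - f x)) \<longlonglongrightarrow> 0" by (rule tendsto_mult_right_zero[OF lim])
      then have "\<forall>\<^sub>F m in sequentially. (C + K) * ?N (\<lambda>x. F m x - f x) < e / 2"
        using e by (intro order_tendstoD) auto
      then obtain m where m: "(C + K) * ?N (\<lambda>x. F m x - f x) < e / 2" by (auto simp: eventually_sequentially)
      have "\<forall>\<^sub>F n in sequentially. ?N (\<lambda>x. T (F m) x - S n (F m) x) < e / 2"
        using FR[of m] e by (intro order_tendstoD(2)[of _ 0]) (auto simp: R_def)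
      then obtain n0 where "\<And>n. n \<ge> n0 \<Longrightarrow> ?N (\<lambda>x. T (F m) x - S n (F m) x) < e / 2"
        by (auto simp: eventually_sequentially)
      then have "norm (?N (\<lambda>x. T f x - S n f x) - 0) < e" if "n \<ge> n0" for n
        using le[of n m] m N0[of "\<lambda>x. T f x - S n f x"] that by fastforce
      then show "\<exists>n0. \<forall>n\<ge>n0. norm (?N (\<lambda>x. T f x - S n f x) - 0) < e" by blast
    qed
    then show "f \<in> R" using f by (simp add: R_def)
  qed
  then have conv: "(\<lambda>n. ?N (\<lambda>x. T f x - S n f x)) \<longlonglongrightarrow> 0" if "f \<in> Lp p torus" for f
    using that by (auto simp: R_def)

  \<comment> \<open>Along a diagonal subsequence every coefficient converges, to \<open>c k\<close>
    say; the limit function is the series of the \<open>h k\<close> with these coefficients. The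
    domination by \<open>G k * H k\<close> makes the convergence uniform enough to sum over
    \<open>k\<close>.\<close>
  have compact: "\<exists>u\<in>Lp p torus. \<exists>r. strict_mono r \<and> (\<lambda>m. ?N (\<lambda>x. T (F (r m)) x - u x)) \<longlonglongrightarrow> 0"
    if F: "\<And>m. F m \<in> Lp p torus" and B: "\<And>m::nat. ?N (F m) \<le> B" for F B
  proof -
    have B0: "0 \<le> B" using B[of 0] N0[of "F 0"] by linarith
    have \<phi>B: "cmod (\<phi> k (F m)) \<le> B * G k" for k m
      using \<phi>le[OF F, of k m] mult_left_mono[OF B[of m] G0[of k]] by (simp add: mult.commute)
    define P where "P k t \<longleftrightarrow> convergent (\<lambda>i. \<phi> k (F (t i)))" for k and t :: "nat \<Rightarrow> nat"
    interpret subseqs P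
    proof
      fix k and t :: "nat \<Rightarrow> nat"
      have "bounded (range (\<lambda>i. \<phi> k (F (t i))))" using \<phi>B by (intro boundedI[of _ "B * G k"]) auto
      from bounded_imp_convergent_subsequence[OF this]
      show "\<exists>r'. strict_mono r' \<and> P k (t \<circ> r')" by (auto simp: P_def o_def convergent_def)
    qed
    define r where "r = diagseq"
    have "\<exists>c. (\<lambda>m. \<phi> k (F (r m))) \<longlonglongrightarrow> c" for k
    proof -
      \<comment> \<open>Only from index k + 1 on is the diagonal sequence known to be a subsequence
        of the one chosen at stage \<open>k\<close>; convergence ignores the initial
        segment.\<close>
      have "P k (diagseq \<circ> (+) (Suc k))"
      proof (rule diagseq_holds)
        fix t u :: "nat \<Rightarrow> nat" and j assume "strict_mono t" "P j u"
        then show "P j (u \<circ> t)"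
          using convergent_subseq_convergent[of "\<lambda>i. \<phi> j (F (u i))" t] by (simp add: P_def o_def)
      qed
      then have "convergent (\<lambda>i. \<phi> k (F (r (i + Suc k))))" by (simp add: P_def r_def o_def add.commute)
      then show ?thesis by (subst (asm) convergent_ignore_initial_segment) (simp add: convergent_def)
    qed
    then obtain c where c: "\<And>k. (\<lambda>m. \<phi> k (F (r m))) \<longlonglongrightarrow> c k" by metis
    have cB: "cmod (c k) \<le> B * G k" for k
      by (rule LIMSEQ_le_const2[OF tendsto_norm[OF c]]) (use \<phi>B in auto)
    let ?u = "\<lambda>x. \<Sum>k. c k *\<^sub>C h k x"
    note u = Nser[OF h smc[OF cB]]
    let ?a = "\<lambda>k m. cmod (\<phi> k (F (r m)) - c k) * H k"
    have a_le: "?a k m \<le> 2 * B * (G k * H k)" for k m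
    proof -
      have "cmod (\<phi> k (F (r m)) - c k) \<le> 2 * B * G k"
        using norm_triangle_ineq4[of "\<phi> k (F (r m))" "c k"] \<phi>B[of k "r m"] cB[of k] by linarith
      from mult_right_mono[OF this H0[of k]] show ?thesis by (simp add: mult_ac)
    qed
    have a0: "0 \<le> ?a k m" for k m using H0 by simp
    have sma: "summable (\<lambda>k. ?a k m)" for m
      by (rule summable_comparison_test'[OF summable_mult[OF smGH, of "2 * B"], of 0]) (use a_le H0 in \<open>simp add: abs_mult\<close>)
    have bound: "?N (\<lambda>x. T (F (r m)) x - ?u x) \<le> (\<Sum>k. ?a k m)" for m
    proof -
      let ?f = "F (r m)"
      let ?U = "\<lambda>n x. \<Sum>k<n. c k *\<^sub>C h k x"
      have U: "?U n \<in> Lp p torus" for n by (rule Ncsum(1)[OF h])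
      have "?N (\<lambda>x. T ?f x - ?u x) \<le> ?N (\<lambda>x. T ?f x - S n ?f x) + ((\<Sum>k. ?a k m) + ?N (\<lambda>x. ?u x - ?U n x))" for n
      proof -
        have "S n ?f x - ?U n x = (\<Sum>k<n. (\<phi> k ?f - c k) *\<^sub>C h k x)" for x
          by (simp add: S_def cscale.diff_left sum_subtractf)
        then have "?N (\<lambda>x. S n ?f x - ?U n x) \<le> (\<Sum>k<n. ?a k m)"
          using Ncsum(2)[where h = h and I = "{..<n}" and c = "\<lambda>k. \<phi> k ?f - c k", OF h] by (simp add: H_def)
        also have "\<dots> \<le> (\<Sum>k. ?a k m)" by (intro sum_le_suminf sma) (use a0 in auto)
        finally have 1: "?N (\<lambda>x. S n ?f x - ?U n x) \<le> (\<Sum>k. ?a k m)" .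
        have 2: "?N (\<lambda>x. T ?f x - ?u x) \<le> ?N (\<lambda>x. T ?f x - S n ?f x) + ?N (\<lambda>x. S n ?f x - ?u x)"
          by (rule Ntri[OF Tin[OF F] Sin u(1)])
        have 3: "?N (\<lambda>x. S n ?f x - ?u x) \<le> ?N (\<lambda>x. S n ?f x - ?U n x) + ?N (\<lambda>x. ?U n x - ?u x)"
          by (rule Ntri[OF Sin U u(1)])
        show ?thesis using 1 2 3 Ncomm[of "?U n" ?u] by linarith
      qed
      moreover have "(\<lambda>n. ?N (\<lambda>x. T ?f x - S n ?f x) + ((\<Sum>k. ?a k m) + ?N (\<lambda>x. ?u x - ?U n x)))
          \<longlonglongrightarrow> 0 + ((\<Sum>k. ?a k m) + 0)"
        by (intro tendsto_add tendsto_const conv[OF F] u(2))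
      ultimately have "?N (\<lambda>x. T ?f x - ?u x) \<le> 0 + ((\<Sum>k. ?a k m) + 0)"
        by (intro LIMSEQ_le_const) auto
      then show ?thesis by simp
    qed
    \<comment> \<open>Dominated convergence for series: each term tends to 0 in \<open>m\<close>,
      and the majorant \<open>2 * B * (G k * H k)\<close> does not depend on
      \<open>m\<close>.\<close>
    have "(\<lambda>m. \<Sum>k. ?a k m) \<longlonglongrightarrow> (\<Sum>k. 0)"
    proof (rule tannerys_theorem[THEN conjunct2, THEN conjunct2])
      fix k
      have "(\<lambda>m. ?a k m) \<longlonglongrightarrow> cmod (c k - c k) * H k" by (intro tendsto_intros c)
      then show "(\<lambda>m. ?a k m) \<longlonglongrightarrow> 0" by simp
    next
      show "\<forall>\<^sub>F (k, m) in at_top \<times>\<^sub>F sequentially. norm (?a k m) \<le> 2 * B * (G k * H k)"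
        using a_le H0 by (intro always_eventually) (auto simp: abs_mult)
      show "summable (\<lambda>k. 2 * B * (G k * H k))" by (rule summable_mult[OF smGH])
    qed simp
    then have "(\<lambda>m. \<Sum>k. ?a k m) \<longlonglongrightarrow> 0" by simp
    then have "(\<lambda>m. ?N (\<lambda>x. T (F (r m)) x - ?u x)) \<longlonglongrightarrow> 0"
      by (rule tendsto_sandwich[OF always_eventually always_eventually tendsto_const, rotated 2]) (use bound N0 in auto)
    then show ?thesis by (intro bexI[OF _ u(1)] exI[of _ r] conjI) (simp_all add: r_def subseq_diagseq)
  qed
  have "Lp_compact_operator p torus T"
    unfolding Lp_compact_operator_def
  proof (intro conjI bT allI impI, elim conjE exE)
    fix F :: "nat \<Rightarrow> real ^ 'n \<Rightarrow> 'a L2" and B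
    assume "\<forall>m. F m \<in> Lp p torus" "\<forall>m. ?N (F m) \<le> B"
    then show "\<exists>u\<in>Lp p torus. \<exists>r. strict_mono r \<and> (\<lambda>m. ?N (\<lambda>x. T (F (r m)) x - u x)) \<longlonglongrightarrow> 0"
      by (intro compact[of F B]) auto
  qed
  then show ?thesis
    unfolding s_nuclear_def
    by (intro conjI exI[of _ \<phi>] exI[of _ h] allI ballI \<phi>dual h sm1 conv[unfolded S_def])
qed

text \<open>The exponents follow from the roles in the nuclear representation: \<open>h k\<close>
  spans the range of a rank-one term and so lies in L^p, while \<open>g k\<close> is the density of
  a functional on L^p and so lies in L^(p').\<close>

theorem theorem3p1:
  fixes s :: real and p p' :: ennreal
    and \<sigma> :: "real ^ 'n \<Rightarrow> int ^ 'n \<Rightarrow> ('y::L2_measure L2 \<Rightarrow>\<^sub>L 'y L2)"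
    and T :: "(real ^ 'n \<Rightarrow> 'y L2) \<Rightarrow> (real ^ 'n \<Rightarrow> 'y L2)"
  assumes "0 < s" and "s \<le> 1"
    and "1 \<le> p" and "p < \<infinity>" and "1 / p + 1 / p' = 1"
    and "\<And>x \<xi>. complex_linear (\<sigma> x \<xi>)"
    and "pseudo_diff_operator p \<sigma> T"
  shows "s_nuclear s p torus T \<longleftrightarrow>
    (\<exists>g h. (\<forall>k::nat. g k \<in> Lp p' torus) \<and> (\<forall>k. h k \<in> Lp p torus) \<and>
       summable (\<lambda>k. Lp_norm p torus (h k) powr s * Lp_norm p' torus (g k) powr s) \<and>
       (AE x in torus. \<forall>\<xi>.
          summable (\<lambda>k. tensor (h k x) (fourier (g k) (- \<xi>))) \<and>
          \<sigma> x \<xi> = cscale_op (cis (- 2 * pi * dot x \<xi>)) (\<Sum>k. tensor (h k x) (fourier (g k) (- \<xi>)))))"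
  by (rule iffI, erule nuclear_symbol[OF assms(1-5,7)], elim exE conjE,
    rule symbol_nuclear[OF assms(1-5,7)]) simp_all

end
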